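(* Let $\rho\in L^1(\Omega)$ be a weight with grading $\gamma_\rho$, let $h\in L^1(\Omega)$ be a mesh size function with grading $\gamma_h$, and let $p\in[1,\infty]$. With $\gamma_{\max}$ the worst grading for $Q$, assume that $$\gamma_\rho\,\gamma_h^{d\left|\frac12-\frac1p\right|}<\gamma_{\max}.$$ Then there exists a constant $c=c(\gamma_\rho,\gamma_h,d,p,K,\chi_0)<\infty$ (with $\chi_0$ the shape-regularity parameter of $\mathcal{T}$) such that $$\|\rho\,Qu\|_p\le c\,\|\rho u\|_p\qquad\text{for all }u\in L^p(\Omega).$$
   Context: Let $d,K\in\mathbb{N}$ (both $\geq 1$), $\Omega\subset\mathbb{R}^d$ a bounded polyhedral (connected) domain, $\mathcal{T}$ a regular triangulation of $\Omega$ into closed simplices with shape-regularity parameter $\chi_0$ (the maximal ratio of the diameter of $T\in\mathcal{T}$ to its inradius), $\mathcal{L}^1_K(\mathcal{T})$ the space of continuous functions on $\Omega$ that are polynomials of degree at most $K$ on each $T\in\mathcal{T}$, and $Q$ the $L^2$-projection onto $\mathcal{L}^1_K(\mathcal{T})$, defined by $\langle Qu,v\rangle=\langle u,v\rangle$ for all $v\in\mathcal{L}^1_K(\mathcal{T})$, where $\langle\cdot,\cdot\rangle$ is the $L^2(\Omega)$ pairing; it extends to $u\in L^1(\Omega)$ by the same formula. $\|\cdot\|_p$ is the norm of $L^p(\Omega)$. Distance $\delta$: there is a fixed symmetric neighbor relation on distinct simplices of $\mathcal{T}$ such that neighbors $T,T'$ satisfy $T\cap T'\ne\emptyset$, and such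 that any two simplices can be joined by a chain of consecutive neighbors; $\delta(T,T')$ is the smallest $N\in\mathbb{N}_0$ such that there are $T_0=T,\dots,T_N=T'$ in $\mathcal{T}$ with $T_{j-1},T_j$ neighbors for $j=1,\dots,N$. A positive function $\rho\in L^1(\Omega)$ is a weight with grading $\gamma_\rho\ge1$ (with respect to $\delta$) if for all $T,T'\in\mathcal{T}$: $\operatorname{ess\,sup}_T\rho\le\gamma_\rho\operatorname{ess\,inf}_T\rho$; and if $\delta(T,T')=1$, then $\operatorname{ess\,sup}_{T'}\rho\le\gamma_\rho\operatorname{ess\,sup}_T\rho$ and $\operatorname{ess\,inf}_{T'}\rho\le\gamma_\rho\operatorname{ess\,inf}_T\rho$. A mesh size function is a positive weight $h\in L^1(\Omega)$ such that $\operatorname{ess\,inf}_Th\eqsim\operatorname{diam}(T)\eqsim\operatorname{ess\,sup}_Th$ for all $T\in\mathcal{T}$ with equivalence constants independent of $T$. The worst grading $\gamma_{\max}$ (for $Q$) is the number such that for all weights $\rho\in L^1(\Omega)$ with grading $\gamma_\rho<\gamma_{\max}$ there is a constant $C(\gamma_\rho)<\infty$ with $\|\rho Qu\|_2\le C(\gamma_\rho)\|\rho u\|_2$ for all $u\in L^2(\Omega)$. *)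

theory Defs
  imports "HOL-Analysis.Analysis" "HOL-Probability.Essential_Supremum"
begin

section \<open>Lebesgue spaces on a subset of Euclidean space\<close>

text \<open>Norms take values in \<^typ>\<open>ennreal\<close>, so that an inequality between norms also says that the
  left-hand side is finite whenever the right-hand side is. The exponent ranges over \<open>[1, \<infinity>]\<close>.\<close>

definition Lp_norm :: "ennreal \<Rightarrow> (real ^ 'n) set \<Rightarrow> (real ^ 'n \<Rightarrow> real) \<Rightarrow> ennreal" where
  "Lp_norm p \<Omega> f =
    (if p = \<infinity> then esssup (lebesgue_on \<Omega>) (\<lambda>x. ennreal \<bar>f x\<bar>)
     else (let I = \<integral>\<^sup>+ x. ennreal (\<bar>f x\<bar> powr enn2real p) \<partial>lebesgue_on \<Omega>
           in if I = \<infinity> then \<infinity> else ennreal (enn2real I powr (1 / enn2real p))))"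

definition Lp_space :: "ennreal \<Rightarrow> (real ^ 'n) set \<Rightarrow> (real ^ 'n \<Rightarrow> real) set" where
  "Lp_space p \<Omega> = {f \<in> borel_measurable (lebesgue_on \<Omega>). Lp_norm p \<Omega> f < \<infinity>}"

text \<open>Counterpart of \<^const>\<open>esssup\<close>, including its convention for non-measurable functions.\<close>

definition essinf :: "'a measure \<Rightarrow> ('a \<Rightarrow> ereal) \<Rightarrow> ereal" where
  "essinf M f = (if f \<in> borel_measurable M then Liminf (ae_filter M) f else bot)"

section \<open>Domains, triangulations and finite element spaces\<close>

definition polyhedral_domain :: "(real ^ 'n) set \<Rightarrow> bool" where
  "polyhedral_domain \<Omega> \<longleftrightarrow> open \<Omega> \<and> connected \<Omega> \<and> bounded \<Omega> \<and> \<Omega> \<noteq> {} \<and>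
    (\<exists>\<F>. finite \<F> \<and> (\<forall>P\<in>\<F>. polytope P) \<and> frontier \<Omega> = \<Union>\<F>)"

text \<open>The library predicate \<^const>\<open>triangulation\<close> provides finiteness and conformity (any two
  simplices meet in a common, possibly empty, face).\<close>

definition regular_triangulation :: "(real ^ 'n) set \<Rightarrow> (real ^ 'n) set set \<Rightarrow> bool" where
  "regular_triangulation \<Omega> \<T> \<longleftrightarrow> triangulation \<T> \<and>
    (\<forall>T\<in>\<T>. int CARD('n) simplex T) \<and> \<Union>\<T> = closure \<Omega>"

definition inradius :: "(real ^ 'n) set \<Rightarrow> real" where
  "inradius T = Sup {r. 0 \<le> r \<and> (\<exists>x. cball x r \<subseteq> T)}"

definition shape_regularity :: "(real ^ 'n) set set \<Rightarrow> real" where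
  "shape_regularity \<T> = Max ((\<lambda>T. diameter T / inradius T) ` \<T>)"

text \<open>Real polynomial functions in \<open>d = CARD('n)\<close> variables of total degree at most \<open>K\<close>;
  \<open>\<alpha>\<close> ranges over multi-indices.\<close>

definition polynomial_of_degree_le :: "nat \<Rightarrow> (real ^ 'n \<Rightarrow> real) \<Rightarrow> bool" where
  "polynomial_of_degree_le K q \<longleftrightarrow>
    (\<exists>a :: ('n \<Rightarrow> nat) \<Rightarrow> real.
      \<forall>x. q x = (\<Sum>\<alpha> | (\<Sum>i\<in>UNIV. \<alpha> i) \<le> K. a \<alpha> * (\<Prod>i\<in>UNIV. (x $ i) ^ \<alpha> i)))"

text \<open>The space \<open>L\<^sup>1\<^sub>K(\<T>)\<close>. Its members are HOL functions on the whole space whose values outside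
  \<open>\<Omega>\<close> are irrelevant.\<close>

definition lagrange_space ::
  "(real ^ 'n) set \<Rightarrow> (real ^ 'n) set set \<Rightarrow> nat \<Rightarrow> (real ^ 'n \<Rightarrow> real) set" where
  "lagrange_space \<Omega> \<T> K = {v. continuous_on \<Omega> v \<and>
    (\<forall>T\<in>\<T>. \<exists>q. polynomial_of_degree_le K q \<and> (\<forall>x\<in>T \<inter> \<Omega>. v x = q x))}"

text \<open>The choice is determined on \<open>\<Omega>\<close> for every \<open>u \<in> L\<^sup>1(\<Omega>)\<close>.\<close>

definition L2_projection ::
  "(real ^ 'n) set \<Rightarrow> (real ^ 'n) set set \<Rightarrow> nat \<Rightarrow> (real ^ 'n \<Rightarrow> real) \<Rightarrow> (real ^ 'n \<Rightarrow> real)" where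
  "L2_projection \<Omega> \<T> K u = (SOME w. w \<in> lagrange_space \<Omega> \<T> K \<and>
    (\<forall>v\<in>lagrange_space \<Omega> \<T> K.
      (\<integral>x. w x * v x \<partial>lebesgue_on \<Omega>) = (\<integral>x. u x * v x \<partial>lebesgue_on \<Omega>)))"

section \<open>Neighbors, weights and gradings\<close>

definition neighbor_relation ::
  "(real ^ 'n) set set \<Rightarrow> ((real ^ 'n) set \<times> (real ^ 'n) set) set \<Rightarrow> bool" where
  "neighbor_relation \<T> N \<longleftrightarrow> N \<subseteq> \<T> \<times> \<T> \<and> sym N \<and> irrefl N \<and>
    (\<forall>(T, T')\<in>N. T \<inter> T' \<noteq> {}) \<and> (\<forall>T\<in>\<T>. \<forall>T'\<in>\<T>. (T, T') \<in> N\<^sup>*)"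

definition mesh_dist ::
  "((real ^ 'n) set \<times> (real ^ 'n) set) set \<Rightarrow> (real ^ 'n) set \<Rightarrow> (real ^ 'n) set \<Rightarrow> nat" where
  "mesh_dist N T T' = (LEAST n. (T, T') \<in> N ^^ n)"

text \<open>A weight is a function on \<open>\<Omega>\<close> only, hence the intersections with \<open>\<Omega>\<close>; they change the closed
  simplices by null sets.\<close>

abbreviation esssup_on :: "(real ^ 'n) set \<Rightarrow> (real ^ 'n) set \<Rightarrow> (real ^ 'n \<Rightarrow> real) \<Rightarrow> ereal" where
  "esssup_on \<Omega> T \<rho> \<equiv> esssup (lebesgue_on (T \<inter> \<Omega>)) (\<lambda>x. ereal (\<rho> x))"

abbreviation essinf_on :: "(real ^ 'n) set \<Rightarrow> (real ^ 'n) set \<Rightarrow> (real ^ 'n \<Rightarrow> real) \<Rightarrow> ereal" where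
  "essinf_on \<Omega> T \<rho> \<equiv> essinf (lebesgue_on (T \<inter> \<Omega>)) (\<lambda>x. ereal (\<rho> x))"

definition weight_with_grading ::
  "(real ^ 'n) set \<Rightarrow> (real ^ 'n) set set \<Rightarrow> ((real ^ 'n) set \<times> (real ^ 'n) set) set \<Rightarrow>
    (real ^ 'n \<Rightarrow> real) \<Rightarrow> real \<Rightarrow> bool" where
  "weight_with_grading \<Omega> \<T> N \<rho> \<gamma> \<longleftrightarrow>
    1 \<le> \<gamma> \<and> integrable (lebesgue_on \<Omega>) \<rho> \<and> (AE x in lebesgue_on \<Omega>. 0 < \<rho> x) \<and>
    (\<forall>T\<in>\<T>. esssup_on \<Omega> T \<rho> \<le> ereal \<gamma> * essinf_on \<Omega> T \<rho>) \<and>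
    (\<forall>T\<in>\<T>. \<forall>T'\<in>\<T>. mesh_dist N T T' = 1 \<longrightarrow>
      esssup_on \<Omega> T' \<rho> \<le> ereal \<gamma> * esssup_on \<Omega> T \<rho> \<and>
      essinf_on \<Omega> T' \<rho> \<le> ereal \<gamma> * essinf_on \<Omega> T \<rho>)"

text \<open>A mesh size function with grading \<open>\<gamma>\<close>; \<open>m\<close> and \<open>M\<close> are the constants in
  \<open>essinf\<^sub>T h \<eqsim> diam T \<eqsim> esssup\<^sub>T h\<close>. They are explicit because estimates may depend on them.\<close>

definition mesh_size_function ::
  "real \<Rightarrow> real \<Rightarrow> (real ^ 'n) set \<Rightarrow> (real ^ 'n) set set \<Rightarrow>
    ((real ^ 'n) set \<times> (real ^ 'n) set) set \<Rightarrow> (real ^ 'n \<Rightarrow> real) \<Rightarrow> real \<Rightarrow> bool" where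
  "mesh_size_function m M \<Omega> \<T> N h \<gamma> \<longleftrightarrow> weight_with_grading \<Omega> \<T> N h \<gamma> \<and>
    (\<forall>T\<in>\<T>. ereal (m * diameter T) \<le> essinf_on \<Omega> T h \<and> essinf_on \<Omega> T h \<le> ereal (M * diameter T) \<and>
      ereal (m * diameter T) \<le> esssup_on \<Omega> T h \<and> esssup_on \<Omega> T h \<le> ereal (M * diameter T))"

text \<open>\<open>g\<close> has the property that characterises the worst grading for \<open>Q\<close>, with \<open>C \<gamma>\<close> as the
  stability constant for weights of grading \<open>\<gamma> < g\<close>. The constants are explicit because on a single
  (finite) triangulation some constant exists for every grading; the notion has content only for
  constants that are shared by many triangulations. If \<open>g\<close> has this property then so has every
  smaller number; the worst grading belonging to \<open>C\<close> is the largest one.\<close>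

definition worst_grading ::
  "(real \<Rightarrow> real) \<Rightarrow> (real ^ 'n) set \<Rightarrow> (real ^ 'n) set set \<Rightarrow>
    ((real ^ 'n) set \<times> (real ^ 'n) set) set \<Rightarrow> nat \<Rightarrow> ereal \<Rightarrow> bool" where
  "worst_grading C \<Omega> \<T> N K g \<longleftrightarrow>
    (\<forall>\<rho> \<gamma>. weight_with_grading \<Omega> \<T> N \<rho> \<gamma> \<and> ereal \<gamma> < g \<longrightarrow>
      (\<forall>u\<in>Lp_space 2 \<Omega>. Lp_norm 2 \<Omega> (\<lambda>x. \<rho> x * L2_projection \<Omega> \<T> K u x)
        \<le> ennreal (C \<gamma>) * Lp_norm 2 \<Omega> (\<lambda>x. \<rho> x * u x)))"

end

theory Submission
  imports Defs "HOL-Computational_Algebra.Polynomial"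
begin

text \<open>
  On a simplex, the \<open>L\<^sup>p\<close> norms of a polynomial are comparable up to powers of the volume, and they
  see a weight only through its size on that simplex, so weights may be taken piecewise constant.
  For \<open>p > 2\<close> the weighted \<open>L\<^sup>2\<close> stability is extrapolated: with \<open>g = \<bar>\<rho> Q u\<bar>\<^sup>p\<^sup>-\<^sup>2\<close> averaged on each
  simplex, \<open>\<integral>\<bar>\<rho> Q u\<bar>\<^sup>p\<close> is at most a constant times \<open>\<integral> \<rho>\<^sup>2 (Q u)\<^sup>2 G\<close> for every \<open>G \<ge> g\<close>. For \<open>G\<close> one
  takes a maximal function of \<open>g\<close> that is damped by a factor \<open>\<eta>\<close> per step of the mesh distance, so
  that \<open>\<rho> G\<^sup>1\<^sup>/\<^sup>2\<close> has grading \<open>\<gamma>\<^sub>\<rho> \<eta>\<^sup>1\<^sup>/\<^sup>2 < \<gamma>\<^sub>m\<^sub>a\<^sub>x\<close>. The maximal function is bounded on \<open>L\<^sup>R\<close> for \<open>R = p / (p - 2)\<close>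
  as soon as \<open>\<eta>\<^sup>R > \<gamma>\<^sub>h\<^sup>d\<close>, because all simplices at distance \<open>n\<close> from \<open>T\<close> lie in a ball of radius
  \<open>O((n + 1) \<gamma>\<^sub>h\<^sup>n diam T)\<close>, whose volume bounds the sum of theirs; this is where the hypothesis on the
  gradings enters. Young's inequality then absorbs the term with \<open>G\<close>. For \<open>p = \<infinity>\<close> the same argument
  works with \<open>g\<close> the indicator of one simplex, for \<open>p = 2\<close> nothing has to be shown, and \<open>p < 2\<close> is dual
  to \<open>p' > 2\<close> with the weight \<open>1 / \<rho>\<close>, since \<open>Q\<close> is symmetric.
\<close>

section \<open>Orthonormal systems in spaces of functions\<close>

text \<open>A single finite mesh always has some constant, so the content is uniformity: each
  constant must be produced before a mesh is fixed. Hence the estimates on one mesh keep their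
  constants explicit, and the uniform lemmas choose the auxiliary grading \<gamma>', the inverse
  constant \<open>B\<close>, the series bound \<open>S\<close> and the absorption parameter
  \<open>t\<close> first and interpret the mesh last. The exponent in the hypothesis is where two
  demands on \<gamma>' meet. With \<eta> = (\<gamma>' / \<gamma>)^2, the decay condition \<eta>^R >
  \<gamma>h^d reads \<gamma>' > \<gamma> \<gamma>h^(d / (2 R)), while stability needs \<gamma>' <
  \<gamma>max; and 1 / (2 R) = 1/2 - 1/p. Absorption is legitimate because the absorbed quantity is
  a finite sum over the finite mesh. The projection is given by a choice operator, so its existence
  on L^1 has to be proved. No nodal basis is constructed: finite dimension of the finite element
  space is drawn from the inverse estimate that also drives the stability proof.\<close>

locale function_inner_product =
  fixes W :: "('a \<Rightarrow> real) set" and ip :: "('a \<Rightarrow> real) \<Rightarrow> ('a \<Rightarrow> real) \<Rightarrow> real"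
  assumes zero_mem: "(\<lambda>x. 0) \<in> W"
    and add_mem: "f \<in> W \<Longrightarrow> g \<in> W \<Longrightarrow> (\<lambda>x. f x + g x) \<in> W"
    and scale_mem: "f \<in> W \<Longrightarrow> (\<lambda>x. c * f x) \<in> W"
    and ip_commute: "ip f g = ip g f"
    and ip_add: "f \<in> W \<Longrightarrow> g \<in> W \<Longrightarrow> h \<in> W \<Longrightarrow> ip (\<lambda>x. f x + g x) h = ip f h + ip g h"
    and ip_scale: "f \<in> W \<Longrightarrow> h \<in> W \<Longrightarrow> ip (\<lambda>x. c * f x) h = c * ip f h"
    and ip_nonneg: "f \<in> W \<Longrightarrow> 0 \<le> ip f f"
    and ip_definite: "f \<in> W \<Longrightarrow> ip f f = 0 \<Longrightarrow> f x = 0"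
begin

lemma sum_mem: "finite I \<Longrightarrow> (\<And>i. i \<in> I \<Longrightarrow> f i \<in> W) \<Longrightarrow> (\<lambda>x. \<Sum>i\<in>I. c i * f i x) \<in> W"
  by (induction I rule: finite_induct) (auto simp: zero_mem intro!: add_mem scale_mem)

lemma ip_zero: "h \<in> W \<Longrightarrow> ip (\<lambda>x. 0) h = 0"
  using ip_scale[of "\<lambda>x. 0" h 0] zero_mem by simp

lemma ip_sum:
  assumes "finite I" "\<And>i. i \<in> I \<Longrightarrow> f i \<in> W" "h \<in> W"
  shows "ip (\<lambda>x. \<Sum>i\<in>I. c i * f i x) h = (\<Sum>i\<in>I. c i * ip (f i) h)"
  using assms
proof (induction I rule: finite_induct)
  case empty
  then show ?case by (simp add: ip_zero)
next
  case (insert i I)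
  then show ?case
    by (simp add: ip_add ip_scale scale_mem sum_mem)
qed

definition orthonormal :: "('a \<Rightarrow> real) set \<Rightarrow> bool" where
  "orthonormal E \<longleftrightarrow> finite E \<and> E \<subseteq> W \<and> (\<forall>e\<in>E. \<forall>e'\<in>E. ip e e' = (if e = e' then 1 else 0))"

text \<open>The orthogonal projection onto the span of an orthonormal \<open>E\<close>. Membership
  in the span is expressed by \<open>expand E f = f\<close>, an equality of functions; this is why
  \<open>ip_definite\<close> asks for pointwise vanishing.\<close>

definition expand :: "('a \<Rightarrow> real) set \<Rightarrow> ('a \<Rightarrow> real) \<Rightarrow> 'a \<Rightarrow> real" where
  "expand E f = (\<lambda>x. \<Sum>e\<in>E. ip f e * e x)"

lemma ip_combination:
  assumes "orthonormal E" "e \<in> E"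
  shows "ip (\<lambda>x. \<Sum>e\<in>E. c e * e x) e = c e"
proof -
  have "ip (\<lambda>x. \<Sum>e\<in>E. c e * e x) e = (\<Sum>e'\<in>E. c e' * ip e' e)"
    using assms unfolding orthonormal_def by (intro ip_sum) auto
  also have "\<dots> = (\<Sum>e'\<in>E. if e' = e then c e' else 0)"
    using assms unfolding orthonormal_def by (intro sum.cong) auto
  also have "\<dots> = c e"
    using assms unfolding orthonormal_def by simp
  finally show ?thesis .
qed

lemma ip_combination_self:
  assumes "orthonormal E"
  shows "ip (\<lambda>x. \<Sum>e\<in>E. c e * e x) (\<lambda>x. \<Sum>e\<in>E. c e * e x) = (\<Sum>e\<in>E. (c e)\<^sup>2)"
proof -
  let ?f = "\<lambda>x. \<Sum>e\<in>E. c e * e x"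
  have f: "?f \<in> W" using assms unfolding orthonormal_def by (intro sum_mem) auto
  have "ip ?f ?f = (\<Sum>e\<in>E. c e * ip e ?f)"
    using assms f unfolding orthonormal_def by (intro ip_sum) auto
  also have "\<dots> = (\<Sum>e\<in>E. c e * c e)"
    using ip_combination[OF assms] by (intro sum.cong) (auto simp: ip_commute[of _ ?f])
  finally show ?thesis by (simp add: power2_eq_square)
qed

lemma expand_mem: "orthonormal E \<Longrightarrow> expand E f \<in> W"
  unfolding expand_def orthonormal_def by (intro sum_mem) auto

text \<open>One Gram-Schmidt step: \<open>e\<close> is the residual \<open>z\<close> of
  \<open>f\<close>, normalised by \<open>s\<close>. The residual is not the zero function, so
  definiteness makes its norm positive.\<close>

lemma orthonormal_extend:
  assumes E: "orthonormal E" and f: "f \<in> W" and ne: "expand E f \<noteq> f"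
  obtains e where "e \<notin> E" "orthonormal (insert e E)" "expand (insert e E) f = f"
proof -
  define z where "z = (\<lambda>x. f x + (-1) * expand E f x)"
  have fin: "finite E" and EW: "E \<subseteq> W" using E by (auto simp: orthonormal_def)
  have zW: "z \<in> W" unfolding z_def by (intro add_mem scale_mem f expand_mem E)
  have ze: "ip z e = 0" if "e \<in> E" for e
  proof -
    have "ip z e = ip f e + (-1) * ip (expand E f) e"
      unfolding z_def using that EW
      by (subst ip_add) (use scale_mem[OF expand_mem[OF E], of "-1" f] f
          ip_scale[OF expand_mem[OF E], of e "-1" f] in auto)
    then show ?thesis using ip_combination[OF E that, of "ip f"] by (simp add: expand_def)
  qed
  have "z \<noteq> (\<lambda>x. 0)"
  proof
    assume "z = (\<lambda>x. 0)"
    then have "f x - expand E f x = 0" for x unfolding z_def by (simp add: fun_eq_iff)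
    with ne show False by auto
  qed
  then have "ip z z \<noteq> 0" using ip_definite[OF zW] by auto
  with ip_nonneg[OF zW] have pos: "0 < ip z z" by simp
  define s where "s = 1 / sqrt (ip z z)"
  have s: "s > 0" "s * (s * ip z z) = 1"
    using pos by (auto simp: s_def field_simps)
  define e where "e = (\<lambda>x. s * z x)"
  have eW: "e \<in> W" unfolding e_def by (intro scale_mem zW)
  have e0: "ip e e' = 0" if "e' \<in> E" for e'
    unfolding e_def using that EW ze[OF that] by (subst ip_scale) (auto simp: zW)
  have e0': "ip e' e = 0" if "e' \<in> E" for e'
    using e0[OF that] ip_commute by metis
  have zz: "ip z e = s * ip z z"
    by (subst ip_commute) (simp add: e_def ip_scale zW)
  have e1: "ip e e = 1"
    using s zz by (simp add: e_def[symmetric] ip_scale[OF zW eW, of s, folded e_def])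
  have nin: "e \<notin> E" using e0[of e] e1 by auto
  have on: "orthonormal (insert e E)"
    using E eW e0 e0' e1 nin unfolding orthonormal_def by auto
  have "ip f e = ip z e + ip (expand E f) e"
  proof -
    have "ip f e = ip (\<lambda>x. z x + expand E f x) e" by (simp add: z_def)
    also have "\<dots> = ip z e + ip (expand E f) e"
      by (intro ip_add zW expand_mem E eW)
    finally show ?thesis .
  qed
  moreover have "ip (expand E f) e = (\<Sum>e'\<in>E. ip f e' * ip e' e)"
    unfolding expand_def using EW by (intro ip_sum fin eW) auto
  then have "ip (expand E f) e = 0" using e0' by simp
  ultimately have fe: "ip f e = s * ip z z" using zz by simp
  have "expand (insert e E) f = f"
  proof
    fix x
    have "ip f e * e x = (s * (s * ip z z)) * z x"
      unfolding fe by (simp only: e_def mult_ac)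
    also have "\<dots> = z x" using s by simp
    finally have "ip f e * e x = z x" .
    then show "expand (insert e E) f x = f x"
      using nin fin unfolding expand_def by (simp add: z_def expand_def)
  qed
  with nin on show ?thesis using that by blast
qed

text \<open>An \<open>f\<close> in the span of \<open>E\<close> is orthogonal to the members of
  \<open>E'\<close> outside \<open>E\<close>, so the additional coefficients vanish.\<close>

lemma expand_mono:
  assumes E: "orthonormal E'" "E \<subseteq> E'" and f: "expand E f = f"
  shows "expand E' f = f"
proof -
  have "ip f e = 0" if "e \<in> E'" "e \<notin> E" for e
  proof -
    have "ip f e = ip (expand E f) e" using f by simp
    also have "\<dots> = (\<Sum>e'\<in>E. ip f e' * ip e' e)"
      using E that unfolding orthonormal_def expand_def by (intro ip_sum) (auto intro: finite_subset)
    also have "\<dots> = 0"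
    proof (intro sum.neutral ballI)
      fix e' assume "e' \<in> E"
      then have "ip e' e = 0" using E that unfolding orthonormal_def by (metis subsetD)
      then show "ip f e' * ip e' e = 0" by simp
    qed
    finally show ?thesis .
  qed
  then have "(\<Sum>e\<in>E'. ip f e * e x) = (\<Sum>e\<in>E'. if e \<in> E then ip f e * e x else 0)" for x
    by (intro sum.cong) auto
  moreover have "E' \<inter> {e. e \<in> E} = E" "finite E'" using E by (auto simp: orthonormal_def)
  ultimately have "expand E' f x = expand E f x" for x
    by (simp add: expand_def sum.If_cases)
  then show ?thesis using f by auto
qed

lemma gram_schmidt:
  assumes "finite F" "F \<subseteq> W"
  shows "\<exists>E. orthonormal E \<and> (\<forall>f\<in>F. expand E f = f)"
  using assms
proof (induction F rule: finite_induct)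
  case empty
  have "orthonormal {}" by (simp add: orthonormal_def)
  then show ?case by blast
next
  case (insert f F)
  from insert.prems have fW: "f \<in> W" and "F \<subseteq> W" by auto
  from insert.IH[OF this(2)] obtain E where E: "orthonormal E" "\<forall>f\<in>F. expand E f = f" by blast
  show ?case
  proof (cases "expand E f = f")
    case False
    obtain e where e: "orthonormal (insert e E)" "expand (insert e E) f = f"
      by (rule orthonormal_extend[OF E(1) fW False])
    have "expand (insert e E) g = g" if "g \<in> F" for g
      using E(2) that by (intro expand_mono[OF e(1) subset_insertI]) blast
    with e show ?thesis by blast
  qed (use E in blast)
qed

text \<open>An orthonormal system of maximal cardinality reproduces every \<open>f\<close>, since
  otherwise it could be extended. It serves the finite element space, for which a bound on
  cardinalities is easier to get than a spanning set; \<open>gram_schmidt\<close> serves the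
  polynomials, which are spanned by monomials.\<close>

lemma orthonormal_basis_exists:
  assumes "\<And>E. orthonormal E \<Longrightarrow> card E \<le> n"
  obtains E where "orthonormal E" "\<And>f. f \<in> W \<Longrightarrow> expand E f = f"
proof -
  have "orthonormal {}" by (simp add: orthonormal_def)
  then obtain E where E: "orthonormal E" "\<And>E'. orthonormal E' \<Longrightarrow> card E' \<le> card E"
    using assms ex_has_greatest_nat[of orthonormal "{}" card "Suc n"] by (auto simp: less_Suc_eq_le)
  have "expand E f = f" if "f \<in> W" for f
  proof (rule ccontr)
    assume "expand E f \<noteq> f"
    then obtain e where e: "e \<notin> E" "orthonormal (insert e E)"
      using orthonormal_extend[OF E(1) \<open>f \<in> W\<close>] by metis
    moreover have "finite E" using E by (simp add: orthonormal_def)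
    ultimately show False using E(2)[OF e(2)] by simp
  qed
  with E that show ?thesis by blast
qed

text \<open>The sum is the diagonal of a reproducing kernel. Its integral is the number of functions in \<open>E\<close>,
  so the dimension of \<open>W\<close> is finite without a spanning set being exhibited.\<close>
lemma sum_squares_le:
  assumes E: "orthonormal E" and B: "0 \<le> B" and bound: "\<And>f. f \<in> W \<Longrightarrow> (f x)\<^sup>2 \<le> B * ip f f"
  shows "(\<Sum>e\<in>E. (e x)\<^sup>2) \<le> B"
proof -
  let ?S = "\<Sum>e\<in>E. (e x)\<^sup>2"
  \<comment> \<open>The kernel with one argument frozen at \<open>x\<close>: both its value at
    \<open>x\<close> and its squared norm equal \<open>?S\<close>, so the bound becomes
    \<open>?S\<close>^2 \<le> \<open>B\<close> \<open>?S\<close>.\<close>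
  have "(\<lambda>y. \<Sum>e\<in>E. e x * e y) \<in> W" using E unfolding orthonormal_def by (intro sum_mem) auto
  from bound[OF this] have "?S\<^sup>2 \<le> B * ?S"
    by (simp add: ip_combination_self[OF E, of "\<lambda>e. e x"] power2_eq_square[symmetric])
  moreover have "0 \<le> ?S" by (intro sum_nonneg) auto
  moreover note B
  ultimately show ?thesis
    by (cases "?S = 0") (auto simp: power2_eq_square)
qed

end

section \<open>Polynomials and the inverse estimate\<close>

abbreviation multi_indices :: "nat \<Rightarrow> ('n::finite \<Rightarrow> nat) set" where
  "multi_indices K \<equiv> {\<alpha>. (\<Sum>i\<in>UNIV. \<alpha> i) \<le> K}"

abbreviation monomial :: "('n::finite \<Rightarrow> nat) \<Rightarrow> real ^ 'n \<Rightarrow> real" where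
  "monomial \<alpha> x \<equiv> \<Prod>i\<in>UNIV. (x $ i) ^ \<alpha> i"

lemma finite_multi_indices: "finite (multi_indices K :: ('n::finite \<Rightarrow> nat) set)"
proof (rule finite_subset)
  show "multi_indices K \<subseteq> (UNIV :: 'n set) \<rightarrow>\<^sub>E {..K}"
  proof
    fix \<alpha> :: "'n \<Rightarrow> nat"
    assume "\<alpha> \<in> multi_indices K"
    then have "\<alpha> i \<le> K" for i
      using member_le_sum[of i UNIV \<alpha>] by simp
    then show "\<alpha> \<in> UNIV \<rightarrow>\<^sub>E {..K}" by auto
  qed
  show "finite ((UNIV :: 'n set) \<rightarrow>\<^sub>E {..K})" by (intro finite_PiE) auto
qed

lemma polynomial_of_degree_le_monomial:
  assumes "(\<Sum>i\<in>UNIV. \<alpha> i) \<le> K"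
  shows "polynomial_of_degree_le K (\<lambda>x. c * monomial \<alpha> x)"
  unfolding polynomial_of_degree_le_def
proof (intro exI[of _ "\<lambda>\<beta>. if \<beta> = \<alpha> then c else 0"] allI)
  fix x :: "real ^ 'a"
  have "(\<Sum>\<beta>\<in>multi_indices K. (if \<beta> = \<alpha> then c else 0) * monomial \<beta> x) =
    (\<Sum>\<beta>\<in>multi_indices K. if \<beta> = \<alpha> then c * monomial \<beta> x else 0)"
    by (intro sum.cong) auto
  then show "c * monomial \<alpha> x = (\<Sum>\<beta>\<in>multi_indices K. (if \<beta> = \<alpha> then c else 0) * monomial \<beta> x)"
    using assms by (simp add: finite_multi_indices)
qed

lemma polynomial_of_degree_le_add:
  assumes "polynomial_of_degree_le K p" "polynomial_of_degree_le K q"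
  shows "polynomial_of_degree_le K (\<lambda>x. p x + q x)"
proof -
  obtain a b where "\<And>x. p x = (\<Sum>\<alpha>\<in>multi_indices K. a \<alpha> * monomial \<alpha> x)"
    "\<And>x. q x = (\<Sum>\<alpha>\<in>multi_indices K. b \<alpha> * monomial \<alpha> x)"
    using assms unfolding polynomial_of_degree_le_def by auto
  then have "\<forall>x. p x + q x = (\<Sum>\<alpha>\<in>multi_indices K. (a \<alpha> + b \<alpha>) * monomial \<alpha> x)"
    by (simp add: sum.distrib distrib_right)
  then show ?thesis
    unfolding polynomial_of_degree_le_def by (rule exI[of _ "\<lambda>\<alpha>. a \<alpha> + b \<alpha>"])
qed

lemma polynomial_of_degree_le_const: "polynomial_of_degree_le K (\<lambda>x. c)"
  using polynomial_of_degree_le_monomial[of "\<lambda>_. 0" K c] by simp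

lemma polynomial_of_degree_le_sum:
  assumes "\<And>i. i \<in> I \<Longrightarrow> polynomial_of_degree_le K (f i)"
  shows "polynomial_of_degree_le K (\<lambda>x. \<Sum>i\<in>I. f i x)"
  using assms
  by (induction I rule: infinite_finite_induct)
    (simp_all add: polynomial_of_degree_le_const polynomial_of_degree_le_add)

lemma polynomial_of_degree_le_mono:
  assumes "polynomial_of_degree_le K p" "K \<le> L"
  shows "polynomial_of_degree_le L p"
proof -
  obtain a where "p = (\<lambda>x. \<Sum>\<alpha>\<in>multi_indices K. a \<alpha> * monomial \<alpha> x)"
    using assms unfolding polynomial_of_degree_le_def by auto
  moreover have "polynomial_of_degree_le L (\<lambda>x. a \<alpha> * monomial \<alpha> x)" if "\<alpha> \<in> multi_indices K" for \<alpha>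
    using that assms(2) by (intro polynomial_of_degree_le_monomial) simp
  ultimately show ?thesis
    by (simp only:) (rule polynomial_of_degree_le_sum)
qed

lemma polynomial_of_degree_le_mult:
  assumes "polynomial_of_degree_le K p" "polynomial_of_degree_le L q"
  shows "polynomial_of_degree_le (K + L) (\<lambda>x. p x * q x)"
proof -
  obtain a b where ab: "\<And>x. p x = (\<Sum>\<alpha>\<in>multi_indices K. a \<alpha> * monomial \<alpha> x)"
    "\<And>x. q x = (\<Sum>\<alpha>\<in>multi_indices L. b \<alpha> * monomial \<alpha> x)"
    using assms unfolding polynomial_of_degree_le_def by auto
  have "(\<lambda>x. p x * q x) = (\<lambda>x. \<Sum>\<alpha>\<in>multi_indices K. \<Sum>\<beta>\<in>multi_indices L.
      (a \<alpha> * b \<beta>) * monomial (\<lambda>i. \<alpha> i + \<beta> i) x)"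
    by (simp add: ab sum_product power_add prod.distrib mult_ac)
  moreover have "polynomial_of_degree_le (K + L) (\<lambda>x. (a \<alpha> * b \<beta>) * monomial (\<lambda>i. \<alpha> i + \<beta> i) x)"
    if "\<alpha> \<in> multi_indices K" "\<beta> \<in> multi_indices L" for \<alpha> \<beta>
    using that by (intro polynomial_of_degree_le_monomial) (simp add: sum.distrib add_mono)
  ultimately show ?thesis
    by (simp only:) (intro polynomial_of_degree_le_sum)
qed

lemma polynomial_of_degree_le_scale:
  "polynomial_of_degree_le K p \<Longrightarrow> polynomial_of_degree_le K (\<lambda>x. c * p x)"
  using polynomial_of_degree_le_mult[OF polynomial_of_degree_le_const[of 0 c]] by simp

lemma polynomial_of_degree_le_power:
  "polynomial_of_degree_le K p \<Longrightarrow> polynomial_of_degree_le (n * K) (\<lambda>x. p x ^ n)"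
  by (induction n)
    (simp_all add: polynomial_of_degree_le_const polynomial_of_degree_le_mult)

lemma polynomial_of_degree_le_prod:
  assumes "\<And>i. i \<in> I \<Longrightarrow> polynomial_of_degree_le (k i) (f i)" "finite I"
  shows "polynomial_of_degree_le (\<Sum>i\<in>I. k i) (\<lambda>x. \<Prod>i\<in>I. f i x)"
  using assms(2,1)
  by (induction I rule: finite_induct)
    (simp_all add: polynomial_of_degree_le_const polynomial_of_degree_le_mult)

lemma polynomial_of_degree_le_coordinate: "polynomial_of_degree_le 1 (\<lambda>x. x $ j)"
proof -
  have eq: "monomial (\<lambda>i. if i = j then 1 else 0) x = x $ j" for x
  proof -
    have "monomial (\<lambda>i. if i = j then 1 else 0) x = (\<Prod>i\<in>UNIV. if i = j then x $ i else 1)"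
      by (intro prod.cong) auto
    then show ?thesis by simp
  qed
  show ?thesis
    using polynomial_of_degree_le_monomial[of "\<lambda>i. if i = j then 1 else 0" 1 1]
    by (simp add: eq del: of_nat_sum)
qed

lemma polynomial_of_degree_le_affine:
  assumes "polynomial_of_degree_le K p"
  shows "polynomial_of_degree_le K (\<lambda>x. p (a + r *\<^sub>R x))"
proof -
  obtain c where c: "\<And>x. p x = (\<Sum>\<alpha>\<in>multi_indices K. c \<alpha> * monomial \<alpha> x)"
    using assms unfolding polynomial_of_degree_le_def by auto
  have lin: "polynomial_of_degree_le 1 (\<lambda>x. a $ i + r * x $ i)" for i
    by (intro polynomial_of_degree_le_add polynomial_of_degree_le_const
        polynomial_of_degree_le_scale polynomial_of_degree_le_coordinate)
  have m: "polynomial_of_degree_le (\<Sum>i\<in>UNIV. \<alpha> i) (\<lambda>x. \<Prod>i\<in>UNIV. (a $ i + r * x $ i) ^ \<alpha> i)" for \<alpha>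
  proof (rule polynomial_of_degree_le_prod)
    show "polynomial_of_degree_le (\<alpha> i) (\<lambda>x. (a $ i + r * x $ i) ^ \<alpha> i)" for i
      using polynomial_of_degree_le_power[OF lin] by simp
  qed simp
  have "p (a + r *\<^sub>R x) = (\<Sum>\<alpha>\<in>multi_indices K. c \<alpha> * (\<Prod>i\<in>UNIV. (a $ i + r * x $ i) ^ \<alpha> i))" for x
    by (simp add: c)
  moreover have "polynomial_of_degree_le K (\<lambda>x. c \<alpha> * (\<Prod>i\<in>UNIV. (a $ i + r * x $ i) ^ \<alpha> i))"
    if "\<alpha> \<in> multi_indices K" for \<alpha>
    using that by (intro polynomial_of_degree_le_scale polynomial_of_degree_le_mono[OF m]) simp
  ultimately show ?thesis
    by (simp only:) (rule polynomial_of_degree_le_sum)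
qed

lemma continuous_on_polynomial_of_degree_le:
  assumes "polynomial_of_degree_le K p"
  shows "continuous_on S p"
proof -
  obtain c where "p = (\<lambda>x. \<Sum>\<alpha>\<in>multi_indices K. c \<alpha> * monomial \<alpha> x)"
    using assms unfolding polynomial_of_degree_le_def by auto
  then show ?thesis by (auto intro!: continuous_intros)
qed

lemma polynomial_of_degree_le_line:
  assumes "polynomial_of_degree_le K p"
  shows "\<exists>P. \<forall>t. p (t *\<^sub>R x) = poly P t"
proof -
  obtain c where c: "\<And>x. p x = (\<Sum>\<alpha>\<in>multi_indices K. c \<alpha> * monomial \<alpha> x)"
    using assms unfolding polynomial_of_degree_le_def by auto
  have "p (t *\<^sub>R x) = poly (\<Sum>\<alpha>\<in>multi_indices K. monom (c \<alpha> * monomial \<alpha> x) (\<Sum>i\<in>UNIV. \<alpha> i)) t" for t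
    by (simp add: c poly_sum poly_monom power_mult_distrib prod.distrib power_sum mult_ac)
  then show ?thesis by blast
qed

text \<open>Along the ray through \<open>x\<close> the function is a univariate polynomial that
  vanishes for all small positive parameters, hence has infinitely many roots; parameter 1 gives the
  value at \<open>x\<close>.\<close>

lemma polynomial_of_degree_le_eq_zero:
  assumes p: "polynomial_of_degree_le K p" and z: "\<And>x. x \<in> ball 0 1 \<Longrightarrow> p x = 0"
  shows "p x = 0"
proof -
  obtain P where P: "\<And>t. p (t *\<^sub>R x) = poly P t"
    using polynomial_of_degree_le_line[OF p] by blast
  \<comment> \<open>The added 1 keeps \<open>t *\<^sub>R x\<close> inside the unit ball for t below
    \<open>?e\<close> without treating \<open>x\<close> = 0 separately.\<close>
  let ?e = "1 / (norm x + 1)"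
  have "poly P t = 0" if "t \<in> {0<..<?e}" for t
  proof -
    have "norm (t *\<^sub>R x) \<le> t * (norm x + 1)" using that by (simp add: mult_left_mono)
    also have "\<dots> < ?e * (norm x + 1)" using that by (intro mult_strict_right_mono) (auto simp: add_nonneg_pos)
    also have "\<dots> = 1" by (simp add: add_nonneg_eq_0_iff)
    finally show ?thesis using z P by (metis mem_ball_0)
  qed
  then have "{0<..<?e} \<subseteq> {t. poly P t = 0}" by auto
  moreover have "infinite {0<..<?e}"
    by (intro infinite_Ioo) (simp add: add_nonneg_pos)
  ultimately have "P = 0" using poly_roots_finite[of P] finite_subset by blast
  then show ?thesis using P[of 1] by simp
qed

section \<open>The inverse estimate on balls, by equivalence of norms and scaling\<close>

lemma lborel_integral_affine:
  fixes f :: "real ^ 'n \<Rightarrow> real"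
  assumes [measurable]: "f \<in> borel_measurable borel" and "0 < r"
  shows "(\<integral>x. f x \<partial>lborel) = r ^ CARD('n) * (\<integral>x. f (a + r *\<^sub>R x) \<partial>lborel)"
proof -
  have "(\<integral>x. f x \<partial>lborel) =
      (\<integral>x. f x \<partial>density (distr lborel borel (\<lambda>x. a + r *\<^sub>R x)) (\<lambda>_. ennreal (\<bar>r\<bar> ^ CARD('n))))"
    using lborel_affine[of r a] \<open>0 < r\<close> by simp
  also have "\<dots> = r ^ CARD('n) * (\<integral>x. f (a + r *\<^sub>R x) \<partial>lborel)"
    using \<open>0 < r\<close> by (subst integral_density) (auto simp: integral_distr)
  finally show ?thesis .
qed

text \<open>In a basis that is orthonormal in L^2 of the unit ball, Cauchy-Schwarz bounds
  \<open>p x\<close> by the L^2 norm times the size of the basis at \<open>x\<close>, which is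
  bounded on compact sets. The point may lie far outside the unit ball: a simplex is larger than the
  ball inscribed in it.\<close>

lemma polynomial_norm_equivalence:
  fixes K :: nat
  obtains B where "0 \<le> B"
    "\<And>p x. polynomial_of_degree_le K p \<Longrightarrow> x \<in> cball (0 :: real ^ 'n) R \<Longrightarrow>
      (p x)\<^sup>2 \<le> B * (\<integral>x. indicator (cball 0 1) x * (p x)\<^sup>2 \<partial>lborel)"
proof -
  define W where "W = {p :: real ^ 'n \<Rightarrow> real. polynomial_of_degree_le K p}"
  define ip where "ip = (\<lambda>(f::real ^ 'n \<Rightarrow> real) g. \<integral>x. indicator (cball 0 1) x * (f x * g x) \<partial>lborel)"
  have cont: "f \<in> W \<Longrightarrow> continuous_on S f" for f S
    by (auto simp: W_def intro: continuous_on_polynomial_of_degree_le)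
  have int: "integrable lborel (\<lambda>x. indicator (cball 0 1) x * (f x * g x))" if "f \<in> W" "g \<in> W" for f g
    using borel_integrable_compact[of "cball 0 1" "\<lambda>x. f x * g x"] that
    by (simp add: cont continuous_on_mult)
  interpret function_inner_product W ip
  proof
    fix f g h c x
    show "(\<lambda>x. 0) \<in> W" by (simp add: W_def polynomial_of_degree_le_const)
    show "f \<in> W \<Longrightarrow> g \<in> W \<Longrightarrow> (\<lambda>x. f x + g x) \<in> W" by (simp add: W_def polynomial_of_degree_le_add)
    show "f \<in> W \<Longrightarrow> (\<lambda>x. c * f x) \<in> W" by (simp add: W_def polynomial_of_degree_le_scale)
    show "ip f g = ip g f" by (simp add: ip_def mult.commute)
    show "f \<in> W \<Longrightarrow> g \<in> W \<Longrightarrow> h \<in> W \<Longrightarrow> ip (\<lambda>x. f x + g x) h = ip f h + ip g h"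
      unfolding ip_def using Bochner_Integration.integral_add[OF int int, of f h g h]
      by (simp add: algebra_simps)
    show "f \<in> W \<Longrightarrow> h \<in> W \<Longrightarrow> ip (\<lambda>x. c * f x) h = c * ip f h"
      unfolding ip_def by (subst integral_mult_right_zero[symmetric]) (simp add: mult_ac)
    show "0 \<le> ip f f" unfolding ip_def by (intro integral_nonneg_AE) auto
    assume f: "f \<in> W" and 0: "ip f f = 0"
    have "AE x in lborel. indicator (cball 0 1) x * (f x * f x) = 0"
      using 0 integral_nonneg_eq_0_iff_AE[OF int[OF f f]] by (auto simp: ip_def)
    then have "AE x in lebesgue. indicator (cball 0 1) x * (f x * f x) = 0"
      by (rule AE_completion)
    then have "{x. indicator (cball 0 1) x * (f x * f x) \<noteq> 0} \<in> null_sets lebesgue"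
      by (simp add: AE_iff_null_sets completion.AE_iff_null_sets)
    then have neg: "negligible {x. indicator (cball 0 1) x * (f x * f x) \<noteq> 0}"
      by (simp add: negligible_iff_null_sets)
    \<comment> \<open>The set of nonzeros in the open ball is open and negligible, hence empty; the
      rest of space follows because \<open>f\<close> is a polynomial.\<close>
    have "open (ball 0 1 \<inter> f -` (- {0}))"
      using cont[OF f, of UNIV] by (intro open_Int open_vimage) auto
    moreover have "negligible (ball 0 1 \<inter> f -` (- {0}))"
      by (rule negligible_subset[OF neg]) auto
    ultimately have "ball 0 1 \<inter> f -` (- {0}) = {}"
      using open_not_negligible by blast
    then have "f y = 0" if "y \<in> ball 0 1" for y
      using that by blast
    moreover have "polynomial_of_degree_le K f" using f by (simp add: W_def)
    ultimately show "f x = 0"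
      by (rule polynomial_of_degree_le_eq_zero[rotated])
  qed
  \<comment> \<open>The factor 1 makes the term an instance of
    \<open>polynomial_of_degree_le_monomial\<close>.\<close>
  let ?m = "\<lambda>\<alpha> x. 1 * monomial \<alpha> x :: real"
  have "?m ` multi_indices K \<subseteq> W"
    unfolding W_def using polynomial_of_degree_le_monomial by blast
  then obtain E where E: "orthonormal E" "\<And>\<alpha>. \<alpha> \<in> multi_indices K \<Longrightarrow> expand E (?m \<alpha>) = ?m \<alpha>"
    using gram_schmidt[of "?m ` multi_indices K"] finite_multi_indices by blast
  have fin: "finite E" and EW: "E \<subseteq> W" using E by (auto simp: orthonormal_def)
  have "\<exists>c. \<forall>x. p x = (\<Sum>e\<in>E. c e * e x)" if p: "p \<in> W" for p
  proof -
    obtain a where a: "\<forall>x. p x = (\<Sum>\<alpha>\<in>multi_indices K. a \<alpha> * monomial \<alpha> x)"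
      using p unfolding W_def polynomial_of_degree_le_def mem_Collect_eq by blast
    have "p x = (\<Sum>\<alpha>\<in>multi_indices K. a \<alpha> * expand E (?m \<alpha>) x)" for x
      using E(2) by (simp add: a)
    also have "\<dots> x = (\<Sum>e\<in>E. (\<Sum>\<alpha>\<in>multi_indices K. a \<alpha> * ip (?m \<alpha>) e) * e x)" for x
      unfolding expand_def sum_distrib_left sum_distrib_right
      by (subst sum.swap) (simp add: mult_ac)
    finally show ?thesis by (intro exI) auto
  qed
  note comb = this
  have "\<exists>b. \<forall>x\<in>cball 0 R. \<bar>e x\<bar> \<le> b" if "e \<in> E" for e
  proof -
    have "bounded (e ` cball 0 R)"
      using that EW cont by (intro compact_imp_bounded compact_continuous_image) auto
    then show ?thesis by (auto simp: bounded_iff)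
  qed
  then obtain b where b: "\<And>e x. e \<in> E \<Longrightarrow> x \<in> cball 0 R \<Longrightarrow> \<bar>e x\<bar> \<le> b e" by metis
  show ?thesis
  proof
    show "0 \<le> (\<Sum>e\<in>E. (b e)\<^sup>2)" by (intro sum_nonneg) auto
    fix p :: "real ^ 'n \<Rightarrow> real" and x :: "real ^ 'n" assume p: "polynomial_of_degree_le K p" and x: "x \<in> cball 0 R"
    obtain c where c: "p = (\<lambda>x. \<Sum>e\<in>E. c e * e x)" using comb[of p] p by (auto simp: W_def)
    have "(p x)\<^sup>2 \<le> (\<Sum>e\<in>E. (c e)\<^sup>2) * (\<Sum>e\<in>E. (e x)\<^sup>2)"
      unfolding c by (rule Cauchy_Schwarz_ineq_sum)
    also have "\<dots> \<le> (\<Sum>e\<in>E. (c e)\<^sup>2) * (\<Sum>e\<in>E. (b e)\<^sup>2)"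
      using b[OF _ x] by (intro mult_left_mono sum_mono sum_nonneg) (auto simp: abs_le_square_iff[symmetric] intro: order_trans[OF _ abs_ge_self])
    also have "(\<Sum>e\<in>E. (c e)\<^sup>2) = ip p p" unfolding c by (rule ip_combination_self[OF E(1), symmetric])
    finally show "(p x)\<^sup>2 \<le> (\<Sum>e\<in>E. (b e)\<^sup>2) * (\<integral>x. indicator (cball 0 1) x * (p x)\<^sup>2 \<partial>lborel)"
      by (simp add: ip_def power2_eq_square mult_ac)
  qed
qed

text \<open>The substitution x = a + r y reduces to the unit ball, because the degree bound is
  invariant under it; \<open>r ^ CARD('n)\<close> is the Jacobian.\<close>

lemma polynomial_inverse_estimate:
  fixes K :: nat
  obtains B where "0 < B"
    "\<And>p a r x. polynomial_of_degree_le K p \<Longrightarrow> 0 < r \<Longrightarrow> x \<in> cball (a :: real ^ 'n) (R * r) \<Longrightarrow>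
      (p x)\<^sup>2 * r ^ CARD('n) \<le> B * (\<integral>x. indicator (cball a r) x * (p x)\<^sup>2 \<partial>lborel)"
proof -
  obtain B where B: "0 \<le> B"
    "\<And>p x. polynomial_of_degree_le K p \<Longrightarrow> x \<in> cball (0 :: real ^ 'n) R \<Longrightarrow>
      (p x)\<^sup>2 \<le> B * (\<integral>x. indicator (cball 0 1) x * (p x)\<^sup>2 \<partial>lborel)"
    using polynomial_norm_equivalence[of K R] by blast
  show ?thesis
  proof
    show "0 < B + 1" using B(1) by simp
    fix p :: "real ^ 'n \<Rightarrow> real" and r and a x :: "real ^ 'n"
    assume p: "polynomial_of_degree_le K p" and r: "0 < r" and x: "x \<in> cball a (R * r)"
    define y where "y = (1 / r) *\<^sub>R (x - a)"
    have "norm y = norm (x - a) / r"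
      using r by (simp only: y_def norm_scaleR) simp
    moreover have "norm (x - a) \<le> R * r" using x by (simp add: dist_norm norm_minus_commute)
    ultimately have y: "a + r *\<^sub>R y = x" "y \<in> cball 0 R"
      using r by (auto simp: y_def pos_divide_le_eq)
    have [measurable]: "p \<in> borel_measurable borel"
      using continuous_on_polynomial_of_degree_le[OF p] by (intro borel_measurable_continuous_onI)
    have ind: "indicator (cball a r) (a + r *\<^sub>R x) = (indicator (cball 0 1) x :: real)" for x
      using r by (auto simp: indicator_def dist_norm)
    have eq: "(\<integral>x. indicator (cball a r) x * (p x)\<^sup>2 \<partial>lborel)
        = r ^ CARD('n) * (\<integral>x. indicator (cball 0 1) x * (p (a + r *\<^sub>R x))\<^sup>2 \<partial>lborel)"
      using r by (subst lborel_integral_affine[of _ r a]) (measurable, auto simp: ind)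
    have "(p (a + r *\<^sub>R y))\<^sup>2 \<le> B * (\<integral>x. indicator (cball 0 1) x * (p (a + r *\<^sub>R x))\<^sup>2 \<partial>lborel)"
      by (rule B(2)[OF polynomial_of_degree_le_affine[OF p] y(2)])
    also have "\<dots> \<le> (B + 1) * (\<integral>x. indicator (cball 0 1) x * (p (a + r *\<^sub>R x))\<^sup>2 \<partial>lborel)"
      by (intro mult_right_mono integral_nonneg_AE) auto
    finally have "(p x)\<^sup>2 * r ^ CARD('n) \<le> (B + 1) * (\<integral>x. indicator (cball 0 1) x * (p (a + r *\<^sub>R x))\<^sup>2 \<partial>lborel) * r ^ CARD('n)"
      using r by (simp add: y(1))
    then show "(p x)\<^sup>2 * r ^ CARD('n) \<le> (B + 1) * (\<integral>x. indicator (cball a r) x * (p x)\<^sup>2 \<partial>lborel)"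
      by (simp add: eq mult_ac)
  qed
qed

section \<open>Geometry of triangulations\<close>

abbreviation vol :: "(real ^ 'n) set \<Rightarrow> real" where "vol T \<equiv> measure lebesgue T"

text \<open>\<kappa> is a parameter and not an abbreviation, so that constants depending on it can
  be chosen before there is a mesh.\<close>

locale triangulated_domain =
  fixes \<Omega> :: "(real ^ 'n) set" and \<T> :: "(real ^ 'n) set set" and \<kappa> :: real
  assumes domain: "polyhedral_domain \<Omega>"
    and regular: "regular_triangulation \<Omega> \<T>"
    and shape: "shape_regularity \<T> = \<kappa>"
begin

lemma finite_T: "finite \<T>"
  using regular by (simp add: regular_triangulation_def triangulation_def)

lemma open_domain: "open \<Omega>" and bounded_domain: "bounded \<Omega>" and domain_ne: "\<Omega> \<noteq> {}"
  using domain by (auto simp: polyhedral_domain_def)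

lemma lmeasurable_domain: "\<Omega> \<in> lmeasurable"
  using bounded_domain open_domain by (rule lmeasurable_open)

lemma sets_domain [measurable, simp]: "\<Omega> \<in> sets lebesgue"
  using lmeasurable_domain by (rule fmeasurableD)

lemma finite_measure_domain: "finite_measure (lebesgue_on \<Omega>)"
  using lmeasurable_domain by (rule finite_measure_lebesgue_on)

lemma AE_domain_iff: "(AE x in lebesgue_on \<Omega>. P x) \<longleftrightarrow> (AE x in lebesgue. x \<in> \<Omega> \<longrightarrow> P x)"
  by (simp add: AE_restrict_space_iff)

lemma simplex_properties:
  assumes "T \<in> \<T>"
  shows "compact T" "convex T" "interior T \<noteq> {}"
proof -
  obtain C where C: "finite C" "\<not> affine_dependent C" "card C = CARD('n) + 1" "T = convex hull C"
    using assms regular unfolding regular_triangulation_def simplex by (auto simp: nat_eq_iff)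
  show "compact T" "convex T" using C by (auto simp: finite_imp_compact_convex_hull)
  show "interior T \<noteq> {}"
    using C by (simp add: interior_convex_hull_eq_empty)
qed

lemma sets_simplex [measurable, simp]: "T \<in> \<T> \<Longrightarrow> T \<in> sets lebesgue"
  using simplex_properties lmeasurable_compact fmeasurableD by blast

text \<open>By conformity \<open>T\<close> is a face of \<open>T'\<close>. A proper face misses the
  interior of \<open>T'\<close>, but \<open>T\<close> has interior points, and these are interior to
  \<open>T'\<close> too.\<close>

lemma simplex_eq:
  assumes "T \<in> \<T>" "T' \<in> \<T>" "T \<subseteq> T'"
  shows "T = T'"
proof -
  have "T' \<inter> T face_of T'" using assms regular
    by (simp add: regular_triangulation_def triangulation_def)
  then have "T face_of T'" using assms by (simp add: Int_absorb1)
  then show ?thesis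
    using simplex_properties(3)[OF assms(1)] face_of_disjoint_interior[of T T'] interior_mono[OF assms(3)]
      interior_subset[of T] by blast
qed

text \<open>The common part is a proper face, so it lies in the frontier of a convex set.\<close>

lemma negligible_overlap:
  assumes "T \<in> \<T>" "T' \<in> \<T>" "T \<noteq> T'"
  shows "negligible (T \<inter> T')"
proof -
  have "T \<inter> T' face_of T"
    using assms regular by (auto simp: regular_triangulation_def triangulation_def)
  moreover have "T \<inter> T' \<noteq> T" using simplex_eq assms by blast
  ultimately have "(T \<inter> T') \<inter> interior T = {}" by (rule face_of_disjoint_interior)
  then have "T \<inter> T' \<subseteq> frontier T" using interior_subset[of T] closure_subset[of T]
    unfolding frontier_def by blast
  moreover have "negligible (frontier T)"
    using simplex_properties[OF assms(1)] by (intro negligible_convex_frontier)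
  ultimately show ?thesis by (rule negligible_subset[rotated])
qed

text \<open>The boundary of a general open set may have positive measure; here polyhedrality enters.
  The boundary of an open set has empty interior, hence so has each of the finitely many polytopes
  that form it, and a convex set with empty interior is negligible.\<close>

lemma negligible_frontier_domain: "negligible (frontier \<Omega>)"
proof -
  obtain \<F> where F: "finite \<F>" "\<forall>P\<in>\<F>. polytope P" "frontier \<Omega> = \<Union>\<F>"
    using domain by (auto simp: polyhedral_domain_def)
  have "interior (frontier \<Omega>) = {}"
  proof -
    have "interior (frontier \<Omega>) \<inter> \<Omega> = {}"
      using open_domain interior_subset[of "frontier \<Omega>"] by (auto simp: frontier_def interior_open)
    then have "interior (frontier \<Omega>) \<inter> closure \<Omega> = {}"
      by (simp add: open_Int_closure_eq_empty)
    then show ?thesis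
      using interior_subset[of "frontier \<Omega>"] by (auto simp: frontier_def)
  qed
  then have "negligible P" if "P \<in> \<F>" for P
    using that F interior_mono[of P "frontier \<Omega>"] negligible_convex_interior[of P] polytope_imp_convex[of P]
    by auto
  then show ?thesis unfolding F(3) using F(1) by (intro negligible_Union) auto
qed

lemma AE_domain_simplex: "AE x in lebesgue. x \<in> T \<longrightarrow> x \<in> \<Omega>" if "T \<in> \<T>"
proof -
  have "T \<subseteq> closure \<Omega>" using that regular by (auto simp: regular_triangulation_def)
  moreover have "AE x in lebesgue. x \<notin> frontier \<Omega>"
    using negligible_frontier_domain by (simp add: AE_not_in negligible_iff_null_sets)
  ultimately show ?thesis
    using open_domain by (auto simp: frontier_def interior_open elim!: AE_mp)
qed

lemma simplex_covering: "x \<in> \<Omega> \<Longrightarrow> \<exists>T\<in>\<T>. x \<in> T"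
  using regular closure_subset[of \<Omega>] by (auto simp: regular_triangulation_def)

lemma AE_unique_simplex: "AE x in lebesgue_on \<Omega>. \<exists>T\<in>\<T>. x \<in> T \<and> (\<forall>T'\<in>\<T>. x \<in> T' \<longrightarrow> T' = T)"
proof -
  let ?N = "\<Union>((\<lambda>(T, T'). T \<inter> T') ` {(T, T') \<in> \<T> \<times> \<T>. T \<noteq> T'})"
  have "finite {(T, T') \<in> \<T> \<times> \<T>. T \<noteq> T'}"
    by (rule finite_subset[of _ "\<T> \<times> \<T>"]) (auto simp: finite_T)
  then have "negligible ?N"
    using negligible_overlap by (intro negligible_Union) auto
  then have AE: "AE x in lebesgue. x \<notin> ?N" unfolding negligible_iff_null_sets by (rule AE_not_in)
  have "\<exists>T\<in>\<T>. x \<in> T \<and> (\<forall>T'\<in>\<T>. x \<in> T' \<longrightarrow> T' = T)" if x: "x \<notin> ?N" "x \<in> \<Omega>" for x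
  proof -
    obtain T where "T \<in> \<T>" "x \<in> T" using simplex_covering x(2) by blast
    moreover have "T' = T" if "T' \<in> \<T>" "x \<in> T'" for T'
      using x(1) calculation that by auto
    ultimately show ?thesis by blast
  qed
  then have "x \<notin> ?N \<Longrightarrow> x \<in> \<Omega> \<longrightarrow> (\<exists>T\<in>\<T>. x \<in> T \<and> (\<forall>T'\<in>\<T>. x \<in> T' \<longrightarrow> T' = T))" for x
    by simp
  then show ?thesis
    unfolding AE_domain_iff by (rule eventually_mono[OF AE])
qed

lemma ball_in_simplex:
  assumes "T \<in> \<T>"
  obtains a r where "0 < r" "cball a r \<subseteq> T" "diameter T \<le> 2 * \<kappa> * r"
proof -
  let ?R = "{r. 0 \<le> r \<and> (\<exists>x. cball x r \<subseteq> T)}"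
  have bT: "bounded T" using simplex_properties[OF assms] by (simp add: compact_imp_bounded)
  have le: "r \<le> diameter T" if r: "r \<in> ?R" for r
  proof -
    obtain x where "cball x r \<subseteq> T" "0 \<le> r" using r by auto
    then have "diameter (cball x r) \<le> diameter T" using bT by (intro diameter_subset)
    then show ?thesis using \<open>0 \<le> r\<close> by simp
  qed
  then have bdd: "bdd_above ?R" by (auto simp: bdd_above_def)
  obtain x where "x \<in> interior T" using simplex_properties[OF assms] by blast
  then obtain e where e: "0 < e" "cball x e \<subseteq> T" by (auto simp: mem_interior_cball)
  then have "e \<in> ?R" by auto
  then have "e \<le> Sup ?R" using bdd by (rule cSup_upper)
  then have pos: "0 < inradius T" using e(1) by (simp add: inradius_def)
  \<comment> \<open>The supremum is not shown to be attained; a radius above half of it is enough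
    and costs the factor 2 in the conclusion.\<close>
  then have "inradius T / 2 < Sup ?R" by (simp add: inradius_def)
  then obtain r where r: "r \<in> ?R" "inradius T / 2 < r"
    using less_cSup_iff[OF _ bdd] \<open>e \<in> ?R\<close> by blast
  then obtain a where a: "cball a r \<subseteq> T" by auto
  have "diameter T / inradius T \<le> \<kappa>"
    unfolding shape[symmetric] shape_regularity_def using finite_T assms by (intro Max_ge) auto
  then have d: "diameter T \<le> \<kappa> * inradius T" using pos by (simp add: field_simps)
  have "0 \<le> \<kappa>"
    using d pos diameter_ge_0[OF bT] by (smt (verit) mult_neg_pos)
  then have "\<kappa> * inradius T \<le> \<kappa> * (2 * r)" using r by (intro mult_left_mono) auto
  then show ?thesis using that[of r a] r a pos d by (simp add: mult_ac)
qed

lemma shape_nonneg: "0 \<le> \<kappa>"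
proof -
  obtain x where "x \<in> \<Omega>" using domain_ne by blast
  then obtain T where T: "T \<in> \<T>" using simplex_covering by blast
  obtain a r where "0 < r" "cball a r \<subseteq> T" "diameter T \<le> 2 * \<kappa> * r" by (rule ball_in_simplex[OF T])
  moreover have "0 \<le> diameter T"
    using simplex_properties[OF T] by (simp add: compact_imp_bounded diameter_ge_0)
  ultimately show ?thesis by (smt (verit) mult_neg_pos)
qed

lemma vol_le_vol:
  assumes "T \<in> \<T>" "cball a r \<subseteq> T" "0 \<le> r"
  shows "unit_ball_vol (real CARD('n)) * r ^ CARD('n) \<le> vol T"
proof -
  have "measure lebesgue (cball a r) \<le> measure lebesgue T"
    using assms simplex_properties by (intro measure_mono_fmeasurable) (auto simp: lmeasurable_compact)
  then show ?thesis using assms(3) by (simp add: content_cball)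
qed

lemma vol_pos: "T \<in> \<T> \<Longrightarrow> 0 < vol T"
proof -
  assume T: "T \<in> \<T>"
  obtain a r where "0 < r" "cball a r \<subseteq> T" "diameter T \<le> 2 * \<kappa> * r" by (rule ball_in_simplex[OF T])
  moreover have "0 < unit_ball_vol (real CARD('n)) * r ^ CARD('n)"
    using calculation by (intro mult_pos_pos unit_ball_vol_pos) auto
  ultimately show "0 < vol T" using vol_le_vol[OF T, of a r] by linarith
qed

lemma vol_le:
  assumes "T \<in> \<T>" "a \<in> T"
  shows "vol T \<le> unit_ball_vol (real CARD('n)) * diameter T ^ CARD('n)"
proof -
  have bT: "bounded T" using simplex_properties[OF assms(1)] by (simp add: compact_imp_bounded)
  have "T \<subseteq> cball a (diameter T)"
    using diameter_bounded_bound[OF bT assms(2)] by auto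
  then have "vol T \<le> measure lebesgue (cball a (diameter T))"
    using assms by (intro measure_mono_fmeasurable) auto
  then show ?thesis using diameter_ge_0[OF bT] by (simp add: content_cball)
qed

lemma integral_indicator_simplex:
  assumes T: "T \<in> \<T>" and f: "f \<in> borel_measurable lebesgue"
  shows "(\<integral>x. indicator T x * f x \<partial>lebesgue_on \<Omega>) = (\<integral>x. indicator T x * (f x :: real) \<partial>lebesgue)"
proof -
  have "(\<integral>x. indicator T x * f x \<partial>lebesgue_on \<Omega>) = (\<integral>x. indicator \<Omega> x * (indicator T x * f x) \<partial>lebesgue)"
    by (simp add: integral_restrict_space)
  also have "\<dots> = (\<integral>x. indicator T x * f x \<partial>lebesgue)"
    using AE_domain_simplex[OF T] f T
    by (intro integral_cong_AE) (auto elim!: AE_mp simp: indicator_def)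
  finally show ?thesis .
qed

lemma integral_vol: "T \<in> \<T> \<Longrightarrow> (\<integral>x. indicator T x \<partial>lebesgue_on \<Omega>) = vol T"
  using integral_indicator_simplex[of T "\<lambda>_. 1"] by (simp add:)

lemma emeasure_simplex:
  assumes "T \<in> \<T>" shows "emeasure (lebesgue_on \<Omega>) (T \<inter> \<Omega>) = ennreal (vol T)"
proof -
  have "emeasure (lebesgue_on \<Omega>) (T \<inter> \<Omega>) = emeasure lebesgue (T \<inter> \<Omega>)"
    by (simp add: emeasure_restrict_space)
  also have "\<dots> = emeasure lebesgue T"
    using AE_domain_simplex[OF assms] assms by (intro emeasure_eq_AE) auto
  also have "\<dots> = ennreal (vol T)"
    using simplex_properties[OF assms]
    by (intro emeasure_eq_measure2 lmeasurable_compact)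
  finally show ?thesis .
qed

end

section \<open>Finite element functions and the projection\<close>

text \<open>A simplex contains a ball of some radius r and lies in the concentric ball of radius 2
  \<kappa> r, so the estimate on balls with \<open>R\<close> = 2 \<kappa> reaches all of
  \<open>T\<close>. The constant precedes the mesh.\<close>

lemma mesh_inverse_estimate:
  fixes K :: nat and \<kappa> :: real
  obtains B where "0 < B"
    "\<And>(\<Omega> :: (real ^ 'n) set) \<T> T q x. triangulated_domain \<Omega> \<T> \<kappa> \<Longrightarrow> T \<in> \<T> \<Longrightarrow>
      polynomial_of_degree_le K q \<Longrightarrow> x \<in> T \<Longrightarrow>
      (q x)\<^sup>2 * vol T \<le> B * (\<integral>x. indicator T x * (q x)\<^sup>2 \<partial>lebesgue_on \<Omega>)"
proof -
  let ?d = "CARD('n)"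
  let ?\<omega> = "unit_ball_vol (real CARD('n))"
  obtain B where B: "0 < B"
    "\<And>p a r x. polynomial_of_degree_le K p \<Longrightarrow> 0 < r \<Longrightarrow> x \<in> cball (a :: real ^ 'n) (2 * \<kappa> * r) \<Longrightarrow>
      (p x)\<^sup>2 * r ^ ?d \<le> B * (\<integral>x. indicator (cball a r) x * (p x)\<^sup>2 \<partial>lborel)"
    using polynomial_inverse_estimate[of K "2 * \<kappa>"] by blast
  \<comment> \<open>The first factor bounds vol T / r^d through the diameter bound 2 \<kappa> r. The
    absolute value keeps it nonnegative at a stage where no mesh has yet shown 0 \<le>
    \<kappa>.\<close>
  define B' where "B' = (?\<omega> * (2 * \<bar>\<kappa>\<bar>) ^ ?d + 1) * B"
  have "0 < ?\<omega> * (2 * \<bar>\<kappa>\<bar>) ^ ?d + 1" by (intro add_nonneg_pos mult_nonneg_nonneg) auto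
  then have "0 < B'" unfolding B'_def using B(1) by (intro mult_pos_pos)
  moreover have "(q x)\<^sup>2 * vol T \<le> B' * (\<integral>x. indicator T x * (q x)\<^sup>2 \<partial>lebesgue_on \<Omega>)"
    if mesh: "triangulated_domain \<Omega> \<T> \<kappa>" and T: "T \<in> \<T>" and q: "polynomial_of_degree_le K q" and x: "x \<in> T"
    for \<Omega> :: "(real ^ 'n) set" and \<T> T q x
  proof -
    interpret triangulated_domain \<Omega> \<T> \<kappa> by (rule mesh)
    obtain a r where ar: "0 < r" "cball a r \<subseteq> T" "diameter T \<le> 2 * \<kappa> * r"
      by (rule ball_in_simplex[OF T])
    have compact: "compact T" and bT: "bounded T"
      using simplex_properties[OF T] by (auto simp: compact_imp_bounded)
    have "a \<in> T" using ar by auto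
    then have "dist a x \<le> diameter T" using diameter_bounded_bound[OF bT] x by auto
    then have xc: "x \<in> cball a (2 * \<kappa> * r)" using ar by auto
    have cont: "continuous_on S q" for S by (rule continuous_on_polynomial_of_degree_le[OF q])
    have [measurable]: "q \<in> borel_measurable borel" by (intro borel_measurable_continuous_onI cont)
    have int: "integrable lborel (\<lambda>x. indicator S x * (q x)\<^sup>2)" if "compact S" for S
      using borel_integrable_compact[OF that, of "\<lambda>x. (q x)\<^sup>2"] by (simp add: cont continuous_on_power)
    have "(\<integral>x. indicator (cball a r) x * (q x)\<^sup>2 \<partial>lborel) \<le> (\<integral>x. indicator T x * (q x)\<^sup>2 \<partial>lborel)"
      using ar by (intro integral_mono int compact compact_cball) (auto simp: indicator_def)
    also have "\<dots> = (\<integral>x. indicator T x * (q x)\<^sup>2 \<partial>lebesgue)"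
      using borel_measurable_integrable[OF int[OF compact]] by (intro integral_completion[symmetric]) simp
    also have "\<dots> = (\<integral>x. indicator T x * (q x)\<^sup>2 \<partial>lebesgue_on \<Omega>)"
      by (intro integral_indicator_simplex[symmetric] T measurable_completion) simp
    finally have mono: "(\<integral>x. indicator (cball a r) x * (q x)\<^sup>2 \<partial>lborel) \<le> (\<integral>x. indicator T x * (q x)\<^sup>2 \<partial>lebesgue_on \<Omega>)" .
    have "vol T \<le> ?\<omega> * diameter T ^ ?d" by (rule vol_le[OF T x])
    also have "\<dots> \<le> ?\<omega> * (2 * \<kappa> * r) ^ ?d"
      using ar diameter_ge_0[OF bT] by (intro mult_left_mono power_mono) auto
    also have "\<dots> = (?\<omega> * (2 * \<bar>\<kappa>\<bar>) ^ ?d) * r ^ ?d"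
      using shape_nonneg by (simp add: power_mult_distrib)
    also have "\<dots> \<le> (?\<omega> * (2 * \<bar>\<kappa>\<bar>) ^ ?d + 1) * r ^ ?d"
      using ar by (intro mult_right_mono) auto
    finally have "(q x)\<^sup>2 * vol T \<le> (q x)\<^sup>2 * ((?\<omega> * (2 * \<bar>\<kappa>\<bar>) ^ ?d + 1) * r ^ ?d)"
      by (intro mult_left_mono) auto
    also have "\<dots> = (?\<omega> * (2 * \<bar>\<kappa>\<bar>) ^ ?d + 1) * ((q x)\<^sup>2 * r ^ ?d)" by simp
    also have "\<dots> \<le> (?\<omega> * (2 * \<bar>\<kappa>\<bar>) ^ ?d + 1) * (B * (\<integral>x. indicator (cball a r) x * (q x)\<^sup>2 \<partial>lborel))"
      by (intro mult_left_mono B(2) q ar xc add_nonneg_nonneg mult_nonneg_nonneg) auto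
    also have "\<dots> = B' * (\<integral>x. indicator (cball a r) x * (q x)\<^sup>2 \<partial>lborel)" by (simp add: B'_def)
    also have "\<dots> \<le> B' * (\<integral>x. indicator T x * (q x)\<^sup>2 \<partial>lebesgue_on \<Omega>)"
      using \<open>0 < B'\<close> by (intro mult_left_mono mono) auto
    finally show ?thesis .
  qed
  ultimately show ?thesis using that by blast
qed

context triangulated_domain
begin

text \<open>A predicate on \<open>B\<close>, so that one \<open>B\<close> can be chosen for all
  meshes with the same \<kappa> and \<open>K\<close> and then handed to the lemmas about a fixed
  mesh.\<close>

definition inverse_bound :: "nat \<Rightarrow> real \<Rightarrow> bool" where
  "inverse_bound K B \<longleftrightarrow> (\<forall>v\<in>lagrange_space \<Omega> \<T> K. \<forall>T\<in>\<T>. \<forall>x\<in>T \<inter> \<Omega>.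
    (v x)\<^sup>2 * vol T \<le> B * (\<integral>x. indicator T x * (v x)\<^sup>2 \<partial>lebesgue_on \<Omega>))"

end

lemma inverse_bound_exists:
  fixes K :: nat and \<kappa> :: real
  obtains B where "0 < B" "\<And>(\<Omega> :: (real ^ 'n) set) \<T>.
    triangulated_domain \<Omega> \<T> \<kappa> \<Longrightarrow> triangulated_domain.inverse_bound \<Omega> \<T> K B"
proof -
  obtain B where B: "0 < B"
    "\<And>(\<Omega> :: (real ^ 'n) set) \<T> T q x. triangulated_domain \<Omega> \<T> \<kappa> \<Longrightarrow> T \<in> \<T> \<Longrightarrow>
      polynomial_of_degree_le K q \<Longrightarrow> x \<in> T \<Longrightarrow>
      (q x)\<^sup>2 * vol T \<le> B * (\<integral>x. indicator T x * (q x)\<^sup>2 \<partial>lebesgue_on \<Omega>)"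
    using mesh_inverse_estimate[of \<kappa> K] by blast
  have "triangulated_domain.inverse_bound \<Omega> \<T> K B" if mesh: "triangulated_domain \<Omega> \<T> \<kappa>"
    for \<Omega> :: "(real ^ 'n) set" and \<T>
  proof -
    interpret triangulated_domain \<Omega> \<T> \<kappa> by (rule mesh)
    show ?thesis
      unfolding inverse_bound_def
    proof (intro ballI)
      fix v T x assume v: "v \<in> lagrange_space \<Omega> \<T> K" and T: "T \<in> \<T>" and x: "x \<in> T \<inter> \<Omega>"
      obtain q where q: "polynomial_of_degree_le K q" "\<And>x. x \<in> T \<inter> \<Omega> \<Longrightarrow> v x = q x"
        using v T unfolding lagrange_space_def by blast
      have "(\<integral>x. indicator T x * (q x)\<^sup>2 \<partial>lebesgue_on \<Omega>) = (\<integral>x. indicator T x * (v x)\<^sup>2 \<partial>lebesgue_on \<Omega>)"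
        using q(2) by (intro Bochner_Integration.integral_cong) (auto simp: indicator_def)
      with B(2)[OF mesh T q(1), of x] x q(2)[OF x]
      show "(v x)\<^sup>2 * vol T \<le> B * (\<integral>x. indicator T x * (v x)\<^sup>2 \<partial>lebesgue_on \<Omega>)" by simp
    qed
  qed
  with B(1) show ?thesis using that by blast
qed

context triangulated_domain
begin

lemma lagrange_add:
  assumes v: "v \<in> lagrange_space \<Omega> \<T> K" and w: "w \<in> lagrange_space \<Omega> \<T> K"
  shows "(\<lambda>x. v x + w x) \<in> lagrange_space \<Omega> \<T> K"
  unfolding lagrange_space_def mem_Collect_eq
proof (intro conjI ballI)
  show "continuous_on \<Omega> (\<lambda>x. v x + w x)"
    using v w by (auto simp: lagrange_space_def intro: continuous_on_add)
  fix T assume T: "T \<in> \<T>"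
  obtain q r where "polynomial_of_degree_le K q" "\<forall>x\<in>T \<inter> \<Omega>. v x = q x"
    "polynomial_of_degree_le K r" "\<forall>x\<in>T \<inter> \<Omega>. w x = r x"
    using v w T unfolding lagrange_space_def by blast
  then show "\<exists>q. polynomial_of_degree_le K q \<and> (\<forall>x\<in>T \<inter> \<Omega>. v x + w x = q x)"
    by (intro exI[of _ "\<lambda>x. q x + r x"]) (simp add: polynomial_of_degree_le_add)
qed

lemma lagrange_scale:
  assumes v: "v \<in> lagrange_space \<Omega> \<T> K"
  shows "(\<lambda>x. c * v x) \<in> lagrange_space \<Omega> \<T> K"
  unfolding lagrange_space_def mem_Collect_eq
proof (intro conjI ballI)
  show "continuous_on \<Omega> (\<lambda>x. c * v x)"
    using v by (auto simp: lagrange_space_def intro: continuous_on_mult_left)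
  fix T assume T: "T \<in> \<T>"
  obtain q where "polynomial_of_degree_le K q" "\<forall>x\<in>T \<inter> \<Omega>. v x = q x"
    using v T unfolding lagrange_space_def by blast
  then show "\<exists>q. polynomial_of_degree_le K q \<and> (\<forall>x\<in>T \<inter> \<Omega>. c * v x = q x)"
    by (intro exI[of _ "\<lambda>x. c * q x"]) (simp add: polynomial_of_degree_le_scale)
qed

lemma lagrange_zero: "(\<lambda>x. 0) \<in> lagrange_space \<Omega> \<T> K"
  unfolding lagrange_space_def mem_Collect_eq
  by (intro conjI ballI exI[of _ "\<lambda>x. 0"] polynomial_of_degree_le_const) auto

lemma lagrange_cong:
  assumes "v \<in> lagrange_space \<Omega> \<T> K" "\<And>x. x \<in> \<Omega> \<Longrightarrow> w x = v x"
  shows "w \<in> lagrange_space \<Omega> \<T> K"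
proof -
  have "continuous_on \<Omega> w" using assms by (auto simp: lagrange_space_def cong: continuous_on_cong)
  then show ?thesis using assms unfolding lagrange_space_def by simp
qed

lemma lagrange_measurable:
  "v \<in> lagrange_space \<Omega> \<T> K \<Longrightarrow> v \<in> borel_measurable (lebesgue_on \<Omega>)"
  unfolding lagrange_space_def
  by (intro continuous_imp_measurable_on_sets_lebesgue sets_domain) simp

text \<open>Continuity on the open set \<Omega> gives no bound, but on each piece the function
  agrees with a polynomial, which is bounded on the whole compact simplex.\<close>

lemma lagrange_bounded:
  assumes "v \<in> lagrange_space \<Omega> \<T> K"
  obtains b where "\<And>x. x \<in> \<Omega> \<Longrightarrow> \<bar>v x\<bar> \<le> b"
proof -
  have "\<exists>b. \<forall>x\<in>T \<inter> \<Omega>. \<bar>v x\<bar> \<le> b" if T: "T \<in> \<T>" for T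
  proof -
    obtain q where q: "polynomial_of_degree_le K q" "\<forall>x\<in>T \<inter> \<Omega>. v x = q x"
      using assms T unfolding lagrange_space_def by blast
    have "bounded (q ` T)"
      using simplex_properties[OF T] continuous_on_polynomial_of_degree_le[OF q(1)]
      by (intro compact_imp_bounded compact_continuous_image) auto
    then show ?thesis using q(2) by (auto simp: bounded_iff)
  qed
  then obtain b where b: "\<And>T x. T \<in> \<T> \<Longrightarrow> x \<in> T \<Longrightarrow> x \<in> \<Omega> \<Longrightarrow> \<bar>v x\<bar> \<le> b T" by (metis IntI)
  have "\<bar>v x\<bar> \<le> Max (b ` \<T>)" if x: "x \<in> \<Omega>" for x
  proof -
    obtain T where T: "T \<in> \<T>" "x \<in> T" using simplex_covering x by blast
    then have "b T \<le> Max (b ` \<T>)" using finite_T by (intro Max_ge) auto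
    then show ?thesis using b[OF T x] by simp
  qed
  then show ?thesis using that by blast
qed

section \<open>Pairings with finite element functions and existence of the projection\<close>

lemma integrable_bounded_mult:
  assumes u: "integrable (lebesgue_on \<Omega>) u" and v: "v \<in> borel_measurable (lebesgue_on \<Omega>)"
    and b: "\<And>x. x \<in> \<Omega> \<Longrightarrow> \<bar>v x\<bar> \<le> (b::real)"
  shows "integrable (lebesgue_on \<Omega>) (\<lambda>x. u x * v x :: real)"
proof (rule Bochner_Integration.integrable_bound)
  show "integrable (lebesgue_on \<Omega>) (\<lambda>x. b * u x)" using u by simp
  show "AE x in lebesgue_on \<Omega>. norm (u x * v x) \<le> norm (b * u x)"
  proof (rule AE_I2)
    fix x assume "x \<in> space (lebesgue_on \<Omega>)"
    then have "\<bar>u x\<bar> * \<bar>v x\<bar> \<le> \<bar>u x\<bar> * b" using b by (intro mult_left_mono) auto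
    also have "\<dots> \<le> \<bar>u x\<bar> * \<bar>b\<bar>" by (intro mult_left_mono) auto
    finally show "norm (u x * v x) \<le> norm (b * u x)" by (simp add: abs_mult mult.commute)
  qed
qed (use u v borel_measurable_integrable in auto)

lemma integrable_bounded:
  assumes "v \<in> borel_measurable (lebesgue_on \<Omega>)" "\<And>x. x \<in> \<Omega> \<Longrightarrow> \<bar>v x\<bar> \<le> (b::real)"
  shows "integrable (lebesgue_on \<Omega>) v"
proof -
  interpret finite_measure "lebesgue_on \<Omega>" by (rule finite_measure_domain)
  show ?thesis using integrable_bounded_mult[of "\<lambda>_. 1" v b] assms by simp
qed

lemma lagrange_integrable:
  assumes "v \<in> lagrange_space \<Omega> \<T> K"
  shows "integrable (lebesgue_on \<Omega>) v"
proof -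
  obtain b where "\<And>x. x \<in> \<Omega> \<Longrightarrow> \<bar>v x\<bar> \<le> b"
    using lagrange_bounded[OF assms] by blast
  then show ?thesis by (rule integrable_bounded[OF lagrange_measurable[OF assms]])
qed

lemma lagrange_integrable_mult:
  assumes "v \<in> lagrange_space \<Omega> \<T> K" "integrable (lebesgue_on \<Omega>) u"
  shows "integrable (lebesgue_on \<Omega>) (\<lambda>x. u x * v x)"
proof -
  obtain b where "\<And>x. x \<in> \<Omega> \<Longrightarrow> \<bar>v x\<bar> \<le> b"
    using lagrange_bounded[OF assms(1)] by blast
  then show ?thesis by (rule integrable_bounded_mult[OF assms(2) lagrange_measurable[OF assms(1)]])
qed

text \<open>Here the constant may depend on the mesh: it only serves to show that the space is
  finite-dimensional.\<close>

lemma lagrange_sup_bound: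
  fixes K :: nat
  obtains c where "0 \<le> c"
    "\<And>v x. v \<in> lagrange_space \<Omega> \<T> K \<Longrightarrow> x \<in> \<Omega> \<Longrightarrow> (v x)\<^sup>2 \<le> c * (\<integral>x. v x * v x \<partial>lebesgue_on \<Omega>)"
proof -
  obtain B where B': "0 < B" "\<And>(\<Omega> :: (real ^ 'n) set) \<T>.
      triangulated_domain \<Omega> \<T> \<kappa> \<Longrightarrow> triangulated_domain.inverse_bound \<Omega> \<T> K B"
    using inverse_bound_exists[of \<kappa> K] by blast
  note B = B'(1) B'(2)[OF triangulated_domain_axioms]
  \<comment> \<open>The sum dominates each of its terms, so one constant fits every simplex.\<close>
  define c where "c = (\<Sum>T\<in>\<T>. B / vol T)"
  have c: "B / vol T \<le> c" if "T \<in> \<T>" for T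
    unfolding c_def using B(1) finite_T that vol_pos
    by (intro member_le_sum) (auto simp: less_imp_le)
  have "0 \<le> c" unfolding c_def using B(1) vol_pos by (intro sum_nonneg) (auto simp: less_imp_le)
  moreover have "(v x)\<^sup>2 \<le> c * (\<integral>x. v x * v x \<partial>lebesgue_on \<Omega>)"
    if v: "v \<in> lagrange_space \<Omega> \<T> K" and x: "x \<in> \<Omega>" for v x
  proof -
    obtain T where T: "T \<in> \<T>" "x \<in> T" using simplex_covering x by blast
    have vv: "integrable (lebesgue_on \<Omega>) (\<lambda>x. v x * v x)"
      by (rule lagrange_integrable_mult[OF v lagrange_integrable[OF v]])
    have "(v x)\<^sup>2 * vol T \<le> B * (\<integral>x. indicator T x * (v x)\<^sup>2 \<partial>lebesgue_on \<Omega>)"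
      using B(2) v T x unfolding inverse_bound_def by blast
    also have "(\<integral>x. indicator T x * (v x)\<^sup>2 \<partial>lebesgue_on \<Omega>) = (\<integral>x. (v x * v x) * indicator T x \<partial>lebesgue_on \<Omega>)"
      by (simp add: power2_eq_square mult.commute)
    also have "\<dots> \<le> (\<integral>x. v x * v x \<partial>lebesgue_on \<Omega>)"
    proof (intro integral_mono vv)
      show "integrable (lebesgue_on \<Omega>) (\<lambda>x. (v x * v x) * indicator T x)"
      proof (rule integrable_bounded_mult[OF vv, where b=1])
        show "(indicator T :: _ \<Rightarrow> real) \<in> borel_measurable (lebesgue_on \<Omega>)"
          by (intro measurable_restrict_space1 borel_measurable_indicator sets_simplex T(1))
      qed (simp add: indicator_def)
    qed (auto simp: indicator_def)
    finally have "(v x)\<^sup>2 \<le> B / vol T * (\<integral>x. v x * v x \<partial>lebesgue_on \<Omega>)"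
      using vol_pos[OF T(1)] B(1) by (simp add: field_simps)
    also have "\<dots> \<le> c * (\<integral>x. v x * v x \<partial>lebesgue_on \<Omega>)"
      by (intro mult_right_mono c T integral_nonneg_AE) auto
    finally show ?thesis .
  qed
  ultimately show ?thesis using that by blast
qed

text \<open>Expansion in an orthonormal basis of the finite element space. Its members are bounded,
  so the coefficients make sense for every integrable \<open>u\<close>.\<close>

lemma L2_projection_exists:
  assumes u: "integrable (lebesgue_on \<Omega>) u"
  shows "\<exists>w\<in>lagrange_space \<Omega> \<T> K. \<forall>v\<in>lagrange_space \<Omega> \<T> K.
    (\<integral>x. w x * v x \<partial>lebesgue_on \<Omega>) = (\<integral>x. u x * v x \<partial>lebesgue_on \<Omega>)"
proof -
  \<comment> \<open>Setting the functions to 0 outside \<Omega> makes definiteness hold at every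
    point of the space.\<close>
  define W where "W = {v \<in> lagrange_space \<Omega> \<T> K. \<forall>x. x \<notin> \<Omega> \<longrightarrow> v x = 0}"
  define ip where "ip = (\<lambda>f g. \<integral>x. f x * (g x :: real) \<partial>lebesgue_on \<Omega>)"
  obtain c where c: "0 \<le> c" "\<And>v x. v \<in> lagrange_space \<Omega> \<T> K \<Longrightarrow> x \<in> \<Omega> \<Longrightarrow> (v x)\<^sup>2 \<le> c * ip v v"
    using lagrange_sup_bound[of K] unfolding ip_def by blast
  have int: "integrable (lebesgue_on \<Omega>) (\<lambda>x. f x * g x)" if "f \<in> W" "g \<in> W" for f g
    using that lagrange_integrable_mult lagrange_integrable by (auto simp: W_def)
  interpret function_inner_product W ip
  proof
    fix f g h c' x
    show "(\<lambda>x. 0) \<in> W" by (simp add: W_def lagrange_zero)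
    show "f \<in> W \<Longrightarrow> g \<in> W \<Longrightarrow> (\<lambda>x. f x + g x) \<in> W" by (simp add: W_def lagrange_add)
    show "f \<in> W \<Longrightarrow> (\<lambda>x. c' * f x) \<in> W" by (simp add: W_def lagrange_scale)
    show "ip f g = ip g f" by (simp add: ip_def mult.commute)
    show "f \<in> W \<Longrightarrow> g \<in> W \<Longrightarrow> h \<in> W \<Longrightarrow> ip (\<lambda>x. f x + g x) h = ip f h + ip g h"
      unfolding ip_def using Bochner_Integration.integral_add[OF int int, of f h g h]
      by (simp add: algebra_simps)
    show "f \<in> W \<Longrightarrow> h \<in> W \<Longrightarrow> ip (\<lambda>x. c' * f x) h = c' * ip f h"
      unfolding ip_def by (subst integral_mult_right_zero[symmetric]) (simp add: mult_ac)
    show "0 \<le> ip f f" unfolding ip_def by (intro integral_nonneg_AE) auto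
    show "f x = 0" if "f \<in> W" "ip f f = 0"
      using c(2)[of f x] that by (cases "x \<in> \<Omega>") (auto simp: W_def)
  qed
  \<comment> \<open>Integrating the bound of \<open>sum_squares_le\<close> over \<Omega> gives card
    E on one side and at most c vol \<Omega> on the other.\<close>
  have card: "card E \<le> nat \<lceil>c * vol \<Omega>\<rceil>" if E: "orthonormal E" for E
  proof -
    have EW: "E \<subseteq> W" and E1: "\<And>e. e \<in> E \<Longrightarrow> ip e e = 1" using E by (auto simp: orthonormal_def)
    have "real (card E) = (\<Sum>e\<in>E. ip e e)" using E1 by simp
    also have "\<dots> = (\<integral>x. (\<Sum>e\<in>E. e x * e x) \<partial>lebesgue_on \<Omega>)"
      unfolding ip_def using EW int by (intro Bochner_Integration.integral_sum[symmetric]) auto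
    also have "\<dots> \<le> (\<integral>x. c \<partial>lebesgue_on \<Omega>)"
    proof (rule integral_mono)
      show "integrable (lebesgue_on \<Omega>) (\<lambda>x. \<Sum>e\<in>E. e x * e x)"
        using EW int by (intro Bochner_Integration.integrable_sum) auto
      show "integrable (lebesgue_on \<Omega>) (\<lambda>x. c)" by (intro integrable_bounded[where b = "\<bar>c\<bar>"]) auto
      fix x assume "x \<in> space (lebesgue_on \<Omega>)"
      then have "(\<Sum>e\<in>E. (e x)\<^sup>2) \<le> c"
        using c by (intro sum_squares_le E) (auto simp: W_def)
      then show "(\<Sum>e\<in>E. e x * e x) \<le> c" by (simp add: power2_eq_square)
    qed
    also have "\<dots> = c * vol \<Omega>" by (simp add: measure_restrict_space)
    finally show ?thesis by linarith
  qed
  obtain E where E: "orthonormal E" "\<And>f. f \<in> W \<Longrightarrow> expand E f = f"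
    using orthonormal_basis_exists[OF card] by blast
  have EW: "E \<subseteq> W" and fin: "finite E" using E(1) by (auto simp: orthonormal_def)
  define w where "w = (\<lambda>x. \<Sum>e\<in>E. (\<integral>x. u x * e x \<partial>lebesgue_on \<Omega>) * e x)"
  have wW: "w \<in> W" unfolding w_def using EW fin by (intro sum_mem) auto
  have "(\<integral>x. w x * v x \<partial>lebesgue_on \<Omega>) = (\<integral>x. u x * v x \<partial>lebesgue_on \<Omega>)"
    if v: "v \<in> lagrange_space \<Omega> \<T> K" for v
  proof -
    define v' where "v' = (\<lambda>x. if x \<in> \<Omega> then v x else 0)"
    have v': "v' \<in> W"
      unfolding W_def v'_def using lagrange_cong[OF v] by simp
    have "(\<integral>x. u x * v x \<partial>lebesgue_on \<Omega>) = (\<integral>x. u x * expand E v' x \<partial>lebesgue_on \<Omega>)"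
      unfolding E(2)[OF v'] by (intro Bochner_Integration.integral_cong) (auto simp: v'_def)
    also have "\<dots> = (\<integral>x. (\<Sum>e\<in>E. ip v' e * (u x * e x)) \<partial>lebesgue_on \<Omega>)"
      by (simp add: expand_def sum_distrib_left mult_ac)
    also have "\<dots> = (\<Sum>e\<in>E. \<integral>x. ip v' e * (u x * e x) \<partial>lebesgue_on \<Omega>)"
      using EW u by (intro Bochner_Integration.integral_sum Bochner_Integration.integrable_mult_right
          lagrange_integrable_mult) (auto simp: W_def)
    also have "\<dots> = (\<Sum>e\<in>E. (\<integral>x. u x * e x \<partial>lebesgue_on \<Omega>) * ip e v')"
      by (intro sum.cong) (auto simp: ip_commute[of v'])
    also have "\<dots> = ip w v'"
      unfolding w_def using EW fin v' by (intro ip_sum[symmetric]) auto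
    also have "\<dots> = (\<integral>x. w x * v x \<partial>lebesgue_on \<Omega>)"
      unfolding ip_def by (intro Bochner_Integration.integral_cong) (auto simp: v'_def)
    finally show ?thesis by simp
  qed
  with wW show ?thesis by (auto simp: W_def)
qed

lemma L2_projection:
  assumes "integrable (lebesgue_on \<Omega>) u"
  shows "L2_projection \<Omega> \<T> K u \<in> lagrange_space \<Omega> \<T> K"
    and "v \<in> lagrange_space \<Omega> \<T> K \<Longrightarrow>
      (\<integral>x. L2_projection \<Omega> \<T> K u x * v x \<partial>lebesgue_on \<Omega>) = (\<integral>x. u x * v x \<partial>lebesgue_on \<Omega>)"
proof -
  have "\<exists>w. w \<in> lagrange_space \<Omega> \<T> K \<and> (\<forall>v\<in>lagrange_space \<Omega> \<T> K.
      (\<integral>x. w x * v x \<partial>lebesgue_on \<Omega>) = (\<integral>x. u x * v x \<partial>lebesgue_on \<Omega>))"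
    using L2_projection_exists[OF assms] by blast
  from someI_ex[OF this] show "L2_projection \<Omega> \<T> K u \<in> lagrange_space \<Omega> \<T> K"
    and "v \<in> lagrange_space \<Omega> \<T> K \<Longrightarrow>
      (\<integral>x. L2_projection \<Omega> \<T> K u x * v x \<partial>lebesgue_on \<Omega>) = (\<integral>x. u x * v x \<partial>lebesgue_on \<Omega>)"
    unfolding L2_projection_def by blast+
qed

end

section \<open>Weights and the mesh distance\<close>

lemma essinf_eq_uminus_esssup:
  assumes "f \<in> borel_measurable M"
  shows "essinf M f = - esssup M (\<lambda>x. - f x)"
proof -
  have "(\<lambda>x. - f x) \<in> borel_measurable M" using assms by measurable
  then show ?thesis
    using assms ereal_Limsup_uminus[of "ae_filter M" f] by (simp add: essinf_def esssup_def)
qed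

lemma essinf_AE:
  assumes "f \<in> borel_measurable M"
  shows "AE x in M. essinf M f \<le> f x"
  using esssup_AE[of "\<lambda>x. - f x" M] unfolding essinf_eq_uminus_esssup[OF assms]
  by (auto simp: ereal_uminus_le_reorder)

lemma essinf_const:
  assumes "emeasure M (space M) \<noteq> 0" and f: "f \<in> borel_measurable M" and c: "AE x in M. f x = c"
  shows "essinf M f = c" "esssup M f = c"
proof -
  have m: "(\<lambda>x. - f x) \<in> borel_measurable M" using f by measurable
  show "esssup M f = c"
    using esssup_AE_cong[OF f _ c] esssup_const[OF assms(1)] by simp
  have "AE x in M. - f x = - c" using c by eventually_elim simp
  then have "esssup M (\<lambda>x. - f x) = - c"
    using esssup_AE_cong[OF m, of "\<lambda>x. - c"] esssup_const[OF assms(1), of "- c"] by simp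
  then show "essinf M f = c" by (simp add: essinf_eq_uminus_esssup[OF f])
qed

lemma AE_nonempty:
  assumes "AE x in M. P x" "emeasure M (space M) \<noteq> 0"
  shows "\<exists>x. P x"
proof -
  have "ae_filter M \<noteq> bot" using assms(2) by (simp add: ae_filter_eq_bot_iff)
  then show ?thesis using assms(1) eventually_happens by blast
qed

section \<open>Weights on a single simplex and piecewise constant functions\<close>

context triangulated_domain
begin

lemma AE_on_simplex_iff:
  "T \<in> \<T> \<Longrightarrow> (AE x in lebesgue_on (T \<inter> \<Omega>). P x) \<longleftrightarrow> (AE x in lebesgue_on \<Omega>. x \<in> T \<longrightarrow> P x)"
  by (simp add: AE_restrict_space_iff) (auto simp: imp_conjL conj_commute cong: conj_cong)

lemma measurable_on_simplex:
  "f \<in> borel_measurable (lebesgue_on \<Omega>) \<Longrightarrow> f \<in> borel_measurable (lebesgue_on (T \<inter> \<Omega>))"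
  by (rule measurable_restrict_mono) auto

lemma emeasure_simplex_space:
  assumes "T \<in> \<T>"
  shows "emeasure (lebesgue_on (T \<inter> \<Omega>)) (space (lebesgue_on (T \<inter> \<Omega>))) \<noteq> 0"
  using emeasure_simplex[OF assms] vol_pos[OF assms] assms
  by (simp add: emeasure_restrict_space)

text \<open>The point is finiteness: the weight is only integrable, but a single point with 0 <
  \<rho> x shows that the essential supremum is positive and the essential infimum is below
  \<infinity>. The grading inequality then makes both real.\<close>

lemma weight_on_simplex:
  assumes \<rho>: "weight_with_grading \<Omega> \<T> N \<rho> \<gamma>" and T: "T \<in> \<T>"
  obtains r where "0 < r" "esssup_on \<Omega> T \<rho> = ereal r"
    "AE x in lebesgue_on \<Omega>. x \<in> T \<longrightarrow> 0 < \<rho> x \<and> \<rho> x \<le> r \<and> r \<le> \<gamma> * \<rho> x"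
proof -
  let ?M = "lebesgue_on (T \<inter> \<Omega>)"
  let ?S = "esssup_on \<Omega> T \<rho>" and ?s = "essinf_on \<Omega> T \<rho>"
  have \<gamma>: "1 \<le> \<gamma>" and le: "?S \<le> ereal \<gamma> * ?s" and "AE x in lebesgue_on \<Omega>. 0 < \<rho> x"
    using \<rho> T by (auto simp: weight_with_grading_def)
  then have pos: "AE x in ?M. 0 < \<rho> x" by (auto simp: AE_on_simplex_iff[OF T])
  have "\<rho> \<in> borel_measurable (lebesgue_on \<Omega>)"
    using \<rho> by (auto simp: weight_with_grading_def)
  then have [measurable]: "\<rho> \<in> borel_measurable ?M" by (rule measurable_on_simplex)
  have S: "AE x in ?M. ereal (\<rho> x) \<le> ?S" by (rule esssup_AE)
  have s: "AE x in ?M. ?s \<le> ereal (\<rho> x)" by (rule essinf_AE) measurable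
  have "AE x in ?M. 0 < \<rho> x \<and> ereal (\<rho> x) \<le> ?S \<and> ?s \<le> ereal (\<rho> x)"
    using pos S s by eventually_elim simp
  then obtain x where x: "0 < \<rho> x" "ereal (\<rho> x) \<le> ?S" "?s \<le> ereal (\<rho> x)"
    using AE_nonempty emeasure_simplex_space[OF T] by blast
  have "?S > 0" using x by (metis ereal_less(2) less_le_trans)
  with le \<gamma> x(3) obtain s' where s': "?s = ereal s'"
    by (cases ?s) (auto split: if_splits)
  then obtain r where r: "?S = ereal r" "r \<le> \<gamma> * s'" using le \<open>?S > 0\<close> by (cases ?S) auto
  have "0 < r" using r \<open>?S > 0\<close> by simp
  moreover have "AE x in ?M. 0 < \<rho> x \<and> \<rho> x \<le> r \<and> r \<le> \<gamma> * \<rho> x"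
    using pos S s
  proof eventually_elim
    case (elim x)
    then have "\<gamma> * s' \<le> \<gamma> * \<rho> x" using \<gamma> s' by (intro mult_left_mono) auto
    with elim r s' show ?case by auto
  qed
  ultimately show ?thesis using that[OF _ r(1)] unfolding AE_on_simplex_iff[OF T] by blast
qed

text \<open>On shared faces the values of several simplices add up, which affects only a null set;
  in return no simplex has to be selected for a point and measurability is immediate.\<close>

definition piecewise :: "((real ^ 'n) set \<Rightarrow> real) \<Rightarrow> real ^ 'n \<Rightarrow> real" where
  "piecewise w x = (\<Sum>T\<in>\<T>. w T * indicator T x)"

text \<open>\<open>w\<close> is quantified under the almost-everywhere sign: the exceptional set
  does not depend on it, so several piecewise constant functions can be evaluated on the same
  simplex at once.\<close>

lemma AE_piecewise: "AE x in lebesgue_on \<Omega>. \<exists>T\<in>\<T>. x \<in> T \<and> (\<forall>w. piecewise w x = w T)"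
  using AE_unique_simplex
proof eventually_elim
  case (elim x)
  then obtain T where T: "T \<in> \<T>" "x \<in> T" "\<And>T'. T' \<in> \<T> \<Longrightarrow> x \<in> T' \<longleftrightarrow> T' = T" by blast
  have "piecewise w x = (\<Sum>T'\<in>\<T>. if T' = T then w T' else 0)" for w
    unfolding piecewise_def using T by (intro sum.cong) (auto simp: indicator_def)
  then show ?case using T finite_T by auto
qed

lemma piecewise_on_simplex:
  assumes "T \<in> \<T>"
  shows "AE x in lebesgue_on \<Omega>. x \<in> T \<longrightarrow> piecewise w x = w T"
  using AE_unique_simplex AE_piecewise by eventually_elim (use assms in blast)

lemma measurable_indicator_simplex [measurable]:
  "T \<in> \<T> \<Longrightarrow> (indicator T :: _ \<Rightarrow> real) \<in> borel_measurable (lebesgue_on \<Omega>)"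
  by (intro measurable_restrict_space1 borel_measurable_indicator sets_simplex)

lemma measurable_piecewise [measurable]: "piecewise w \<in> borel_measurable (lebesgue_on \<Omega>)"
  unfolding piecewise_def by measurable

lemma piecewise_bound: "\<bar>piecewise w x\<bar> \<le> (\<Sum>T\<in>\<T>. \<bar>w T\<bar>)"
  unfolding piecewise_def
  by (rule order_trans[OF sum_abs]) (auto intro!: sum_mono simp: abs_mult indicator_def)

lemma integrable_piecewise: "integrable (lebesgue_on \<Omega>) (piecewise w)"
  by (rule integrable_bounded[OF measurable_piecewise piecewise_bound])

lemma integral_piecewise_mult:
  assumes f: "integrable (lebesgue_on \<Omega>) f"
  shows "(\<integral>x. piecewise w x * f x \<partial>lebesgue_on \<Omega>) =
      (\<Sum>T\<in>\<T>. w T * (\<integral>x. indicator T x * f x \<partial>lebesgue_on \<Omega>))"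
    and "integrable (lebesgue_on \<Omega>) (\<lambda>x. piecewise w x * f x)"
    and "T \<in> \<T> \<Longrightarrow> integrable (lebesgue_on \<Omega>) (\<lambda>x. indicator T x * f x)"
proof -
  show int: "integrable (lebesgue_on \<Omega>) (\<lambda>x. indicator T x * f x)" if "T \<in> \<T>" for T
    using integrable_bounded_mult[OF f measurable_indicator_simplex[OF that], of 1]
    by (simp add: mult.commute indicator_def)
  show "integrable (lebesgue_on \<Omega>) (\<lambda>x. piecewise w x * f x)"
    using integrable_bounded_mult[OF f measurable_piecewise piecewise_bound] by (simp add: mult.commute)
  have "(\<integral>x. piecewise w x * f x \<partial>lebesgue_on \<Omega>) = (\<integral>x. (\<Sum>T\<in>\<T>. w T * (indicator T x * f x)) \<partial>lebesgue_on \<Omega>)"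
    by (simp add: piecewise_def sum_distrib_right mult.assoc)
  also have "\<dots> = (\<Sum>T\<in>\<T>. \<integral>x. w T * (indicator T x * f x) \<partial>lebesgue_on \<Omega>)"
    using int by (intro Bochner_Integration.integral_sum) auto
  finally show "(\<integral>x. piecewise w x * f x \<partial>lebesgue_on \<Omega>) =
      (\<Sum>T\<in>\<T>. w T * (\<integral>x. indicator T x * f x \<partial>lebesgue_on \<Omega>))" by simp
qed

lemma integral_piecewise: "(\<integral>x. piecewise w x \<partial>lebesgue_on \<Omega>) = (\<Sum>T\<in>\<T>. w T * vol T)"
proof -
  have "integrable (lebesgue_on \<Omega>) (\<lambda>_. 1 :: real)" by (rule integrable_bounded[where b=1]) auto
  from integral_piecewise_mult(1)[OF this, of w]
  have "(\<integral>x. piecewise w x \<partial>lebesgue_on \<Omega>) = (\<Sum>T\<in>\<T>. w T * (\<integral>x. indicator T x \<partial>lebesgue_on \<Omega>))"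
    by (simp only: mult_1_right)
  also have "\<dots> = (\<Sum>T\<in>\<T>. w T * vol T)"
    by (intro sum.cong refl) (simp only: integral_vol)
  finally show ?thesis .
qed

end

section \<open>The mesh distance, and gradings as conditions on one number per simplex\<close>

locale neighbor_mesh = triangulated_domain \<Omega> \<T> \<kappa> for \<Omega> :: "(real ^ 'n) set" and \<T> \<kappa> +
  fixes N :: "((real ^ 'n) set \<times> (real ^ 'n) set) set"
  assumes neighbors: "neighbor_relation \<T> N"
begin

lemma neighbor_mem: "(T, T') \<in> N \<Longrightarrow> T \<in> \<T> \<and> T' \<in> \<T> \<and> T \<inter> T' \<noteq> {} \<and> T \<noteq> T' \<and> (T', T) \<in> N"
  using neighbors by (auto simp: neighbor_relation_def irrefl_def sym_def)

lemma mesh_dist_relpow: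
  assumes "T \<in> \<T>" "T' \<in> \<T>"
  shows "(T, T') \<in> N ^^ mesh_dist N T T'"
proof -
  have "(T, T') \<in> N\<^sup>*" using neighbors assms by (auto simp: neighbor_relation_def)
  then obtain n where "(T, T') \<in> N ^^ n" by (metis rtrancl_imp_relpow)
  then show ?thesis unfolding mesh_dist_def by (rule LeastI)
qed

lemma mesh_dist_le: "(T, T') \<in> N ^^ n \<Longrightarrow> mesh_dist N T T' \<le> n"
  unfolding mesh_dist_def by (rule Least_le)

lemma mesh_dist_refl: "mesh_dist N T T = 0"
  using mesh_dist_le[of T T 0] by simp

lemma mesh_dist_eq_1_iff:
  assumes "T \<in> \<T>" "T' \<in> \<T>"
  shows "mesh_dist N T T' = 1 \<longleftrightarrow> (T, T') \<in> N"
proof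
  assume "mesh_dist N T T' = 1"
  then show "(T, T') \<in> N" using mesh_dist_relpow[OF assms] by simp
next
  assume N: "(T, T') \<in> N"
  then have "mesh_dist N T T' \<le> 1" using mesh_dist_le[of T T' 1] by simp
  moreover have "mesh_dist N T T' \<noteq> 0"
    using mesh_dist_relpow[OF assms] neighbor_mem[OF N] by (metis relpow_0_E)
  ultimately show "mesh_dist N T T' = 1" by simp
qed

lemma mesh_dist_neighbor:
  assumes "(T, T') \<in> N" "S \<in> \<T>"
  shows "mesh_dist N T S \<le> Suc (mesh_dist N T' S)"
  using assms neighbor_mem[OF assms(1)] mesh_dist_relpow[of T' S]
  by (intro mesh_dist_le relpow_Suc_I2) auto

text \<open>What the grading conditions become for a weight that is constant on simplices, where
  essential supremum and infimum coincide. Ratios are bounded from both sides because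
  \<open>N\<close> is symmetric.\<close>

definition graded :: "real \<Rightarrow> ((real ^ 'n) set \<Rightarrow> real) \<Rightarrow> bool" where
  "graded \<gamma> w \<longleftrightarrow> (\<forall>T\<in>\<T>. 0 < w T) \<and> (\<forall>(T, T')\<in>N. w T' \<le> \<gamma> * w T)"

text \<open>The number chosen on each simplex is the essential supremum. It inherits \<gamma> itself
  and no power of it, so the strict hypothesis on the gradings survives the reduction; the
  comparison with \<rho> costs one factor \<gamma>.\<close>

lemma weight_obtain_graded:
  assumes \<rho>: "weight_with_grading \<Omega> \<T> N \<rho> \<gamma>"
  obtains r where "graded \<gamma> r" "\<And>T. T \<in> \<T> \<Longrightarrow> esssup_on \<Omega> T \<rho> = ereal (r T)"
    "AE x in lebesgue_on \<Omega>. 0 < \<rho> x \<and> \<rho> x \<le> piecewise r x \<and> piecewise r x \<le> \<gamma> * \<rho> x"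
proof -
  define r where "r T = real_of_ereal (esssup_on \<Omega> T \<rho>)" for T
  have r: "0 < r T \<and> esssup_on \<Omega> T \<rho> = ereal (r T) \<and>
      (AE x in lebesgue_on \<Omega>. x \<in> T \<longrightarrow> 0 < \<rho> x \<and> \<rho> x \<le> r T \<and> r T \<le> \<gamma> * \<rho> x)" if T: "T \<in> \<T>" for T
  proof -
    obtain a where "0 < a" "esssup_on \<Omega> T \<rho> = ereal a"
      "AE x in lebesgue_on \<Omega>. x \<in> T \<longrightarrow> 0 < \<rho> x \<and> \<rho> x \<le> a \<and> a \<le> \<gamma> * \<rho> x"
      by (rule weight_on_simplex[OF \<rho> T])
    moreover have "r T = a" using calculation by (simp add: r_def)
    ultimately show ?thesis by blast
  qed
  have "r T' \<le> \<gamma> * r T" if N: "(T, T') \<in> N" for T T'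
  proof -
    have "T \<in> \<T>" "T' \<in> \<T>" using neighbor_mem[OF N] by auto
    moreover from this have "esssup_on \<Omega> T' \<rho> \<le> ereal \<gamma> * esssup_on \<Omega> T \<rho>"
      using \<rho> N mesh_dist_eq_1_iff by (auto simp: weight_with_grading_def)
    ultimately show ?thesis using r by auto
  qed
  then have "graded \<gamma> r" using r by (auto simp: graded_def)
  moreover have "AE x in lebesgue_on \<Omega>. \<forall>T\<in>\<T>. x \<in> T \<longrightarrow> 0 < \<rho> x \<and> \<rho> x \<le> r T \<and> r T \<le> \<gamma> * \<rho> x"
    using r finite_T by (intro AE_finite_allI) auto
  then have "AE x in lebesgue_on \<Omega>. 0 < \<rho> x \<and> \<rho> x \<le> piecewise r x \<and> piecewise r x \<le> \<gamma> * \<rho> x"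
    using AE_piecewise by eventually_elim auto
  ultimately show ?thesis using that r by blast
qed

text \<open>Lets constructed weights be fed into \<open>worst_grading\<close>. On a single simplex
  the condition is just 1 \<le> \<gamma>.\<close>

lemma piecewise_weight:
  assumes "graded \<gamma> w" "1 \<le> \<gamma>"
  shows "weight_with_grading \<Omega> \<T> N (piecewise w) \<gamma>"
proof -
  have w: "\<And>T. T \<in> \<T> \<Longrightarrow> 0 < w T" "\<And>T T'. (T, T') \<in> N \<Longrightarrow> w T' \<le> \<gamma> * w T"
    using assms by (auto simp: graded_def)
  have pos: "AE x in lebesgue_on \<Omega>. 0 < piecewise w x"
    using AE_piecewise by eventually_elim (use w in auto)
  have const: "essinf_on \<Omega> T (piecewise w) = ereal (w T)" "esssup_on \<Omega> T (piecewise w) = ereal (w T)"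
    if T: "T \<in> \<T>" for T
  proof -
    have "piecewise w \<in> borel_measurable (lebesgue_on (T \<inter> \<Omega>))"
      by (rule measurable_on_simplex) measurable
    then have "(\<lambda>x. ereal (piecewise w x)) \<in> borel_measurable (lebesgue_on (T \<inter> \<Omega>))" by measurable
    moreover have "AE x in lebesgue_on (T \<inter> \<Omega>). ereal (piecewise w x) = ereal (w T)"
      using piecewise_on_simplex[OF T, of w] by (simp add: AE_on_simplex_iff[OF T])
    ultimately show "essinf_on \<Omega> T (piecewise w) = ereal (w T)" "esssup_on \<Omega> T (piecewise w) = ereal (w T)"
      using essinf_const emeasure_simplex_space[OF T] by blast+
  qed
  show ?thesis
    unfolding weight_with_grading_def
  proof (intro conjI ballI impI assms integrable_piecewise pos)
    fix T assume T: "T \<in> \<T>"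
    show "esssup_on \<Omega> T (piecewise w) \<le> ereal \<gamma> * essinf_on \<Omega> T (piecewise w)"
      using w(1)[OF T] assms(2) mult_right_mono[of 1 \<gamma> "w T"] by (simp add: const[OF T])
    fix T' assume T': "T' \<in> \<T>" and "mesh_dist N T T' = 1"
    then have "(T, T') \<in> N" using mesh_dist_eq_1_iff T by blast
    then show "esssup_on \<Omega> T' (piecewise w) \<le> ereal \<gamma> * esssup_on \<Omega> T (piecewise w)"
      "essinf_on \<Omega> T' (piecewise w) \<le> ereal \<gamma> * essinf_on \<Omega> T (piecewise w)"
      using w(2) by (auto simp: const T T')
  qed
qed

end

section \<open>Volume growth and the maximal function\<close>

lemma summable_power_mult_geometric:
  assumes "0 \<le> q" "q < (1 :: real)"
  shows "summable (\<lambda>n. real (n + 1) ^ d * q ^ n)"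
proof -
  have "(\<lambda>n. (real n + 2) / (real n + 1)) \<longlonglongrightarrow> 1"
    using LIMSEQ_Suc[OF LIMSEQ_Suc_n_over_n[where 'a = real]] by (simp add: add_ac)
  then have "(\<lambda>n. ((real n + 2) / (real n + 1)) ^ d * q) \<longlonglongrightarrow> 1 ^ d * q"
    by (intro tendsto_intros)
  \<comment> \<open>Any number strictly between the limit \<open>q\<close> of the ratios and 1 would
    do.\<close>
  moreover have "1 ^ d * q < (1 + q) / 2" using assms by simp
  ultimately have "eventually (\<lambda>n. ((real n + 2) / (real n + 1)) ^ d * q < (1 + q) / 2) sequentially"
    by (rule order_tendstoD)
  then obtain n0 where n0: "\<And>n. n \<ge> n0 \<Longrightarrow> ((real n + 2) / (real n + 1)) ^ d * q < (1 + q) / 2"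
    by (auto simp: eventually_sequentially)
  show ?thesis
  proof (rule summable_ratio_test)
    show "(1 + q) / 2 < 1" using assms by simp
    fix n assume n: "n \<ge> n0"
    have "real (Suc n + 1) ^ d * q ^ Suc n = (((real n + 2) / (real n + 1)) ^ d * q) * (real (n + 1) ^ d * q ^ n)"
      by (simp add: power_divide add_ac)
    also have "\<dots> \<le> (1 + q) / 2 * (real (n + 1) ^ d * q ^ n)"
      using n0[OF n] assms by (intro mult_right_mono) auto
    finally show "norm (real (Suc n + 1) ^ d * q ^ Suc n) \<le> (1 + q) / 2 * norm (real (n + 1) ^ d * q ^ n)"
      using assms by simp
  qed
qed

locale graded_mesh = neighbor_mesh \<Omega> \<T> \<kappa> N for \<Omega> :: "(real ^ 'n) set" and \<T> \<kappa> N +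
  fixes h :: "real ^ 'n \<Rightarrow> real" and m M \<gamma>h :: real
  assumes mesh_size: "mesh_size_function m M \<Omega> \<T> N h \<gamma>h" and m_pos: "0 < m"
begin

lemma grading_ge_1: "1 \<le> \<gamma>h"
  using mesh_size by (simp add: mesh_size_function_def weight_with_grading_def)

text \<open>\<open>H\<close> is the essential supremum of \<open>h\<close> divided by
  \<open>m\<close>: the scaling leaves the grading alone and makes \<open>H\<close> dominate the
  diameters.\<close>

lemma mesh_size_obtain:
  obtains H where "graded \<gamma>h H" "\<And>T. T \<in> \<T> \<Longrightarrow> diameter T \<le> H T"
    "\<And>T. T \<in> \<T> \<Longrightarrow> H T \<le> M / m * diameter T"
proof -
  have "weight_with_grading \<Omega> \<T> N h \<gamma>h" using mesh_size by (simp add: mesh_size_function_def)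
  then obtain r where r: "graded \<gamma>h r" "\<And>T. T \<in> \<T> \<Longrightarrow> esssup_on \<Omega> T h = ereal (r T)"
    by (rule weight_obtain_graded) blast
  have "m * diameter T \<le> r T \<and> r T \<le> M * diameter T" if "T \<in> \<T>" for T
    using mesh_size r(2)[OF that] that unfolding mesh_size_function_def by auto
  then have "diameter T \<le> r T / m" "r T / m \<le> M / m * diameter T" if "T \<in> \<T>" for T
    using m_pos that by (auto simp: field_simps)
  moreover have "graded \<gamma>h (\<lambda>T. r T / m)"
    using r(1) m_pos unfolding graded_def by (auto simp: divide_right_mono)
  ultimately show ?thesis using that by blast
qed

text \<open>Consecutive simplices of the chain touch, so the distance is at most the sum of all
  diameters, and j steps away from \<open>T'\<close> a diameter is at most \<gamma>h^j H T'. The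
  induction removes the simplex farthest from \<open>T'\<close>.\<close>

lemma relpow_dist:
  assumes H: "graded \<gamma>h H" "\<And>T. T \<in> \<T> \<Longrightarrow> diameter T \<le> H T"
    and "(T, T') \<in> N ^^ n" "T \<in> \<T>" "T' \<in> \<T>" "x \<in> T" "y \<in> T'"
  shows "H T \<le> \<gamma>h ^ n * H T' \<and> dist x y \<le> (\<Sum>j\<le>n. \<gamma>h ^ j) * H T'"
  using assms(3-)
proof (induction n arbitrary: T x)
  case 0
  then have "dist x y \<le> diameter T"
    using simplex_properties(1)[of T] diameter_bounded_bound[of T x y] by (auto simp: compact_imp_bounded)
  with 0 H(2)[of T] show ?case by auto
next
  case (Suc n)
  then obtain T1 where T1: "(T, T1) \<in> N" "(T1, T') \<in> N ^^ n" by (meson relpow_Suc_D2)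
  have T1': "T1 \<in> \<T>" "(T1, T) \<in> N" using neighbor_mem[OF T1(1)] by auto
  obtain z where z: "z \<in> T" "z \<in> T1" using neighbor_mem[OF T1(1)] by blast
  have IH: "H T1 \<le> \<gamma>h ^ n * H T'" "dist z y \<le> (\<Sum>j\<le>n. \<gamma>h ^ j) * H T'"
    using Suc.IH[OF T1(2) T1'(1) _ z(2)] Suc.prems by auto
  have "H T \<le> \<gamma>h * H T1" using H(1) T1'(2) by (auto simp: graded_def)
  also have "\<dots> \<le> \<gamma>h * (\<gamma>h ^ n * H T')" using IH(1) grading_ge_1 by (intro mult_left_mono) auto
  finally have HT: "H T \<le> \<gamma>h ^ Suc n * H T'" by simp
  have "dist x z \<le> diameter T"
    using simplex_properties(1)[of T] Suc.prems z diameter_bounded_bound[of T x z] by (auto simp: compact_imp_bounded)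
  also have "\<dots> \<le> H T" using H(2) Suc.prems by auto
  finally have "dist x z \<le> \<gamma>h ^ Suc n * H T'" using HT by simp
  with IH(2) dist_triangle[of x y z] HT show ?case by (simp add: algebra_simps)
qed

text \<open>The bound for (H T' / r)^d when \<open>T'\<close> contains a ball of radius r: H is at
  most M / m times the diameter, and the diameter at most 2 \<kappa> r.\<close>

definition volume_const :: real where
  "volume_const = (2 * \<kappa> * M / m) ^ CARD('n)"

lemma layer_volume:
  assumes T': "T' \<in> \<T>"
  shows "(\<Sum>T | T \<in> \<T> \<and> mesh_dist N T T' = n. vol T)
    \<le> volume_const * (real (n + 1) ^ CARD('n) * (\<gamma>h ^ CARD('n)) ^ n) * vol T'"
proof -
  let ?d = "CARD('n)"
  let ?\<omega> = "unit_ball_vol (real ?d)"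
  let ?L = "{T. T \<in> \<T> \<and> mesh_dist N T T' = n}"
  obtain H where H: "graded \<gamma>h H" "\<And>T. T \<in> \<T> \<Longrightarrow> diameter T \<le> H T"
    "\<And>T. T \<in> \<T> \<Longrightarrow> H T \<le> M / m * diameter T"
    by (rule mesh_size_obtain) blast
  obtain y where y: "y \<in> T'" using simplex_properties(3)[OF T'] interior_subset by blast
  have HT': "0 < H T'" using H(1) T' by (simp add: graded_def)
  obtain a r where ar: "0 < r" "cball a r \<subseteq> T'" "diameter T' \<le> 2 * \<kappa> * r"
    by (rule ball_in_simplex[OF T'])
  have "0 \<le> diameter T'"
    using simplex_properties[OF T'] by (simp add: compact_imp_bounded diameter_ge_0)
  \<comment> \<open>\<open>M\<close> has no sign hypothesis; positivity is read off from 0 < H T'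
    \<le> M / m diam T'.\<close>
  then have "0 < M / m" using HT' H(3)[OF T'] by (smt (verit) mult_nonneg_nonneg zero_less_mult_iff)
  then have Hr: "H T' \<le> M / m * (2 * \<kappa> * r)"
    using H(3)[OF T'] ar(3) by (smt (verit) mult_left_mono)
  let ?R = "real (n + 1) * \<gamma>h ^ n * H T'"
  \<comment> \<open>Cruder than summing the geometric series, but valid also for \<gamma>h = 1; the
    extra factor n + 1 is harmless for the later summation over layers.\<close>
  have "(\<Sum>j\<le>n. \<gamma>h ^ j) \<le> (\<Sum>j\<le>n. \<gamma>h ^ n)"
    using grading_ge_1 by (intro sum_mono power_increasing) auto
  then have R: "(\<Sum>j\<le>n. \<gamma>h ^ j) * H T' \<le> ?R" using HT' by (intro mult_right_mono) auto
  have sub: "\<Union>?L \<subseteq> cball y ?R"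
  proof
    fix x assume "x \<in> \<Union>?L"
    then obtain T where T: "T \<in> \<T>" "mesh_dist N T T' = n" "x \<in> T" by blast
    then have "(T, T') \<in> N ^^ n" using mesh_dist_relpow[OF _ T'] by blast
    from relpow_dist[OF H(1,2) this T(1) T' T(3) y] R
    show "x \<in> cball y ?R" by (simp add: dist_commute)
  qed
  have lm: "T \<in> lmeasurable" if "T \<in> \<T>" for T
    using simplex_properties[OF that] by (simp add: lmeasurable_compact)
  have "(\<Sum>T\<in>?L. vol T) = measure lebesgue (\<Union>?L)"
    using finite_T lm negligible_overlap
    by (intro measure_negligible_finite_Union[symmetric]) (auto simp: pairwise_def)
  also have "\<dots> \<le> measure lebesgue (cball y ?R)"
    using finite_T lm by (intro measure_mono_fmeasurable sub) (auto intro!: sets.finite_Union fmeasurableD)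
  also have "\<dots> = ?\<omega> * ?R ^ ?d"
    using HT' grading_ge_1 by (simp add: content_cball)
  also have "\<dots> \<le> ?\<omega> * (real (n + 1) * \<gamma>h ^ n * (M / m * (2 * \<kappa> * r))) ^ ?d"
    using HT' Hr grading_ge_1 by (intro mult_left_mono power_mono) auto
  also have "\<dots> = volume_const * (real (n + 1) ^ ?d * (\<gamma>h ^ ?d) ^ n) * (?\<omega> * r ^ ?d)"
    by (simp add: volume_const_def power_mult_distrib power_divide power_mult[symmetric] mult_ac
        del: of_nat_Suc of_nat_add)
  also have "\<dots> \<le> volume_const * (real (n + 1) ^ ?d * (\<gamma>h ^ ?d) ^ n) * vol T'"
    using ar \<open>0 < M / m\<close> shape_nonneg grading_ge_1 m_pos
    by (intro mult_left_mono vol_le_vol T' mult_nonneg_nonneg)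
      (auto simp: volume_const_def zero_less_divide_iff)
  finally show ?thesis .
qed

text \<open>Layer 0 around a simplex contains that simplex, so \<open>layer_volume\<close> gives vol
  T \<le> \<open>volume_const\<close> vol T, which rules out a negative constant.\<close>

lemma volume_const_nonneg: "0 \<le> volume_const"
proof -
  obtain x where "x \<in> \<Omega>" using domain_ne by blast
  then obtain T where T: "T \<in> \<T>" using simplex_covering by blast
  have "T \<in> {S. S \<in> \<T> \<and> mesh_dist N S T = 0}" using T mesh_dist_refl by simp
  then have "vol T \<le> (\<Sum>S | S \<in> \<T> \<and> mesh_dist N S T = 0. vol S)"
    using finite_T by (intro member_le_sum) auto
  also have "\<dots> \<le> volume_const * vol T" using layer_volume[OF T, of 0] by simp
  finally show ?thesis using vol_pos[OF T] by (smt (verit) mult_neg_pos)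
qed

definition sum_const :: "real \<Rightarrow> real" where
  "sum_const q = volume_const * (\<Sum>n. real (n + 1) ^ CARD('n) * q ^ n)"

lemma layer_sum:
  assumes T': "T' \<in> \<T>" and \<theta>: "0 \<le> \<theta>" "\<gamma>h ^ CARD('n) * \<theta> < 1"
  shows "(\<Sum>T\<in>\<T>. vol T * \<theta> ^ mesh_dist N T T')
    \<le> sum_const (\<gamma>h ^ CARD('n) * \<theta>) * vol T'"
proof -
  let ?d = "CARD('n)"
  let ?q = "\<gamma>h ^ ?d * \<theta>"
  let ?D = "(\<lambda>T. mesh_dist N T T') ` \<T>"
  have q: "0 \<le> ?q" using \<theta> grading_ge_1 by simp
  have "(\<Sum>T\<in>\<T>. vol T * \<theta> ^ mesh_dist N T T') =
      (\<Sum>n\<in>?D. \<Sum>T | T \<in> \<T> \<and> mesh_dist N T T' = n. vol T * \<theta> ^ mesh_dist N T T')"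
    by (rule sum.image_gen[OF finite_T])
  also have "\<dots> = (\<Sum>n\<in>?D. (\<Sum>T | T \<in> \<T> \<and> mesh_dist N T T' = n. vol T) * \<theta> ^ n)"
    by (simp add: sum_distrib_right)
  also have "\<dots> \<le> (\<Sum>n\<in>?D. volume_const * (real (n + 1) ^ ?d * (\<gamma>h ^ ?d) ^ n) * vol T' * \<theta> ^ n)"
    using \<theta> by (intro sum_mono mult_right_mono layer_volume T') auto
  also have "\<dots> = volume_const * vol T' * (\<Sum>n\<in>?D. real (n + 1) ^ ?d * ?q ^ n)"
    by (simp add: sum_distrib_left power_mult_distrib mult_ac)
  also have "\<dots> \<le> volume_const * vol T' * (\<Sum>n. real (n + 1) ^ ?d * ?q ^ n)"
    using volume_const_nonneg finite_T q \<theta>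
    by (intro mult_left_mono sum_le_suminf summable_power_mult_geometric) auto
  finally show ?thesis by (simp add: sum_const_def mult_ac)
qed

text \<open>The R-th power of a maximum is at most the sum of the R-th powers, so no maximal theorem
  is needed: after swapping the summations, \<open>layer_sum\<close> with damping \<eta>^(-R) gives
  the bound, for any positive \<open>R\<close>. The simplex \<open>T0\<close> with 0 < g T0 makes
  the majorant positive everywhere, as \<open>graded\<close> demands.\<close>

lemma graded_majorant:
  assumes R: "0 < R" and lam: "1 \<le> \<eta>" and q: "\<gamma>h ^ CARD('n) * (1 / \<eta>) powr R < 1"
    and g: "\<And>T. T \<in> \<T> \<Longrightarrow> 0 \<le> g T" and T0: "T0 \<in> \<T>" "0 < g T0"
  obtains G where "graded \<eta> G" "\<And>T. T \<in> \<T> \<Longrightarrow> g T \<le> G T"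
    "(\<Sum>T\<in>\<T>. vol T * G T powr R) \<le>
      sum_const (\<gamma>h ^ CARD('n) * (1 / \<eta>) powr R) *
      (\<Sum>T\<in>\<T>. vol T * g T powr R)"
proof -
  let ?a = "\<lambda>T S. g S * (1 / \<eta>) ^ mesh_dist N T S"
  let ?\<theta> = "(1 / \<eta>) powr R"
  let ?S = "sum_const (\<gamma>h ^ CARD('n) * ?\<theta>)"
  define G where "G T = Max (?a T ` \<T>)" for T
  have ge: "?a T S \<le> G T" if "S \<in> \<T>" for T S
    unfolding G_def using that finite_T by (intro Max_ge) auto
  have attain: "\<exists>S\<in>\<T>. G T = ?a T S" for T
  proof -
    have "G T \<in> ?a T ` \<T>" unfolding G_def using finite_T T0 by (intro Max_in) auto
    then show ?thesis by blast
  qed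
  have "0 < G T" for T
  proof -
    have "0 < ?a T T0" using T0 lam by simp
    then show ?thesis using ge[OF T0(1), of T] by linarith
  qed
  moreover have "G T' \<le> \<eta> * G T" if N: "(T, T') \<in> N" for T T'
  proof -
    obtain S where S: "S \<in> \<T>" "G T' = ?a T' S" using attain by blast
    \<comment> \<open>Passing to a neighbor changes the distance to the maximising simplex by at
      most one, hence the damping by at most one factor \<eta>.\<close>
    have "(1 / \<eta>) ^ Suc (mesh_dist N T' S) \<le> (1 / \<eta>) ^ mesh_dist N T S"
      using mesh_dist_neighbor[OF N S(1)] lam by (intro power_decreasing) auto
    then have "(1 / \<eta>) ^ mesh_dist N T' S \<le> \<eta> * (1 / \<eta>) ^ mesh_dist N T S"
      using lam by (simp add: field_simps)
    then have "G T' \<le> g S * (\<eta> * (1 / \<eta>) ^ mesh_dist N T S)"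
      unfolding S(2) using g[OF S(1)] by (rule mult_left_mono)
    also have "\<dots> = \<eta> * ?a T S" by simp
    also have "\<dots> \<le> \<eta> * G T" using ge[OF S(1)] lam by (intro mult_left_mono) auto
    finally show ?thesis .
  qed
  ultimately have "graded \<eta> G" by (auto simp: graded_def)
  moreover have "g T \<le> G T" if "T \<in> \<T>" for T
    using ge[OF that, of T] by (simp add: mesh_dist_refl)
  moreover have "(\<Sum>T\<in>\<T>. vol T * G T powr R) \<le> ?S * (\<Sum>T\<in>\<T>. vol T * g T powr R)"
  proof -
    have le: "G T powr R \<le> (\<Sum>S\<in>\<T>. g S powr R * ?\<theta> ^ mesh_dist N T S)" for T
    proof -
      obtain S where S: "S \<in> \<T>" "G T = ?a T S" using attain by blast
      have "G T powr R = g S powr R * ?\<theta> ^ mesh_dist N T S"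
        unfolding S(2) using g[OF S(1)] lam
        by (subst powr_mult) (auto simp: powr_realpow[symmetric] powr_powr mult.commute)
      also have "\<dots> \<le> (\<Sum>S\<in>\<T>. g S powr R * ?\<theta> ^ mesh_dist N T S)"
        using finite_T S(1) by (intro member_le_sum) auto
      finally show ?thesis .
    qed
    have "(\<Sum>T\<in>\<T>. vol T * G T powr R) \<le> (\<Sum>T\<in>\<T>. vol T * (\<Sum>S\<in>\<T>. g S powr R * ?\<theta> ^ mesh_dist N T S))"
      by (intro sum_mono mult_left_mono le) auto
    also have "\<dots> = (\<Sum>S\<in>\<T>. g S powr R * (\<Sum>T\<in>\<T>. vol T * ?\<theta> ^ mesh_dist N T S))"
      unfolding sum_distrib_left by (subst sum.swap) (simp add: mult_ac)
    also have "\<dots> \<le> (\<Sum>S\<in>\<T>. g S powr R * (?S * vol S))"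
      using q by (intro sum_mono mult_left_mono layer_sum) auto
    also have "\<dots> = ?S * (\<Sum>T\<in>\<T>. vol T * g T powr R)"
      unfolding sum_distrib_left by (intro sum.cong refl) (simp only: mult_ac)
    finally show ?thesis .
  qed
  ultimately show ?thesis using that by blast
qed

end

section \<open>Weighted L^2 stability as an inequality between finite sums\<close>

lemma Lp_norm_2:
  assumes f: "f \<in> borel_measurable (lebesgue_on \<Omega>)" and int: "integrable (lebesgue_on \<Omega>) (\<lambda>x. (f x)\<^sup>2)"
  shows "Lp_norm 2 \<Omega> f = ennreal (sqrt (\<integral>x. (f x)\<^sup>2 \<partial>lebesgue_on \<Omega>))"
proof -
  have "(\<integral>\<^sup>+ x. ennreal (\<bar>f x\<bar> powr enn2real 2) \<partial>lebesgue_on \<Omega>) = (\<integral>\<^sup>+ x. ennreal ((f x)\<^sup>2) \<partial>lebesgue_on \<Omega>)"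
    by (intro nn_integral_cong) simp
  also have "\<dots> = ennreal (\<integral>x. (f x)\<^sup>2 \<partial>lebesgue_on \<Omega>)"
    by (rule nn_integral_eq_integral[OF int]) simp
  finally show ?thesis
    by (simp add: Lp_norm_def powr_half_sqrt integral_nonneg_AE)
qed

context neighbor_mesh
begin

lemma piecewise_square: "AE x in lebesgue_on \<Omega>. (piecewise w x)\<^sup>2 = piecewise (\<lambda>T. (w T)\<^sup>2) x"
  using AE_piecewise by eventually_elim auto

lemma integrable_of_square:
  assumes "u \<in> borel_measurable (lebesgue_on \<Omega>)" "integrable (lebesgue_on \<Omega>) (\<lambda>x. (u x)\<^sup>2)"
  shows "integrable (lebesgue_on \<Omega>) (u :: _ \<Rightarrow> real)"
proof (rule Bochner_Integration.integrable_bound)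
  show "integrable (lebesgue_on \<Omega>) (\<lambda>x. 1 + (u x)\<^sup>2)"
    using assms(2) integrable_bounded[of "\<lambda>_. 1" 1] by (intro Bochner_Integration.integrable_add) auto
  show "AE x in lebesgue_on \<Omega>. norm (u x) \<le> norm (1 + (u x)\<^sup>2)"
  proof (intro AE_I2)
    fix x
    have "0 \<le> (\<bar>u x\<bar> - 1)\<^sup>2" by simp
    then show "norm (u x) \<le> norm (1 + (u x)\<^sup>2)" by (simp add: power2_eq_square algebra_simps)
  qed
qed fact

text \<open>The form in which \<open>worst_grading\<close> is used: norms become real sums in which
  the weight is one factor per simplex, ready for a majorant to be inserted.\<close>

lemma weighted_L2_stability:
  assumes wg: "worst_grading C \<Omega> \<T> N K g" and w: "graded \<gamma> w" and \<gamma>: "1 \<le> \<gamma>" "ereal \<gamma> < g"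
    and u: "u \<in> borel_measurable (lebesgue_on \<Omega>)" "integrable (lebesgue_on \<Omega>) (\<lambda>x. (u x)\<^sup>2)"
  shows "(\<Sum>T\<in>\<T>. (w T)\<^sup>2 * (\<integral>x. indicator T x * (L2_projection \<Omega> \<T> K u x)\<^sup>2 \<partial>lebesgue_on \<Omega>))
    \<le> (C \<gamma>)\<^sup>2 * (\<Sum>T\<in>\<T>. (w T)\<^sup>2 * (\<integral>x. indicator T x * (u x)\<^sup>2 \<partial>lebesgue_on \<Omega>))"
proof -
  let ?Q = "L2_projection \<Omega> \<T> K u"
  have Q: "?Q \<in> lagrange_space \<Omega> \<T> K" by (rule L2_projection(1)[OF integrable_of_square[OF u]])
  have Qm: "?Q \<in> borel_measurable (lebesgue_on \<Omega>)" by (rule lagrange_measurable[OF Q])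
  have Q2: "integrable (lebesgue_on \<Omega>) (\<lambda>x. (?Q x)\<^sup>2)"
    using lagrange_integrable_mult[OF Q lagrange_integrable[OF Q]] by (simp add: power2_eq_square)
  have key: "Lp_norm 2 \<Omega> (\<lambda>x. piecewise w x * f x) =
      ennreal (sqrt (\<Sum>T\<in>\<T>. (w T)\<^sup>2 * (\<integral>x. indicator T x * (f x)\<^sup>2 \<partial>lebesgue_on \<Omega>)))"
    if f: "f \<in> borel_measurable (lebesgue_on \<Omega>)" "integrable (lebesgue_on \<Omega>) (\<lambda>x. (f x)\<^sup>2)" for f
  proof -
    have m: "(\<lambda>x. piecewise w x * f x) \<in> borel_measurable (lebesgue_on \<Omega>)"
      using f(1) by measurable
    have AE: "AE x in lebesgue_on \<Omega>. piecewise (\<lambda>T. (w T)\<^sup>2) x * (f x)\<^sup>2 = (piecewise w x * f x)\<^sup>2"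
      using piecewise_square[of w] by eventually_elim (simp add: power_mult_distrib)
    have int: "integrable (lebesgue_on \<Omega>) (\<lambda>x. (piecewise w x * f x)\<^sup>2)"
      by (rule integrable_cong_AE_imp[OF integral_piecewise_mult(2)[OF f(2)]]) (use m AE in auto)
    have "(\<integral>x. (piecewise w x * f x)\<^sup>2 \<partial>lebesgue_on \<Omega>) = (\<integral>x. piecewise (\<lambda>T. (w T)\<^sup>2) x * (f x)\<^sup>2 \<partial>lebesgue_on \<Omega>)"
      by (rule integral_cong_AE) (use m f AE in auto)
    then show ?thesis
      using Lp_norm_2[OF m int] integral_piecewise_mult(1)[OF f(2)] by simp
  qed
  have "u \<in> Lp_space 2 \<Omega>" using u Lp_norm_2[OF u] by (simp add: Lp_space_def)
  with wg piecewise_weight[OF w \<gamma>(1)] \<gamma>(2)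
  have "Lp_norm 2 \<Omega> (\<lambda>x. piecewise w x * ?Q x) \<le> ennreal (C \<gamma>) * Lp_norm 2 \<Omega> (\<lambda>x. piecewise w x * u x)"
    unfolding worst_grading_def by blast
  then have le: "ennreal (sqrt (\<Sum>T\<in>\<T>. (w T)\<^sup>2 * (\<integral>x. indicator T x * (?Q x)\<^sup>2 \<partial>lebesgue_on \<Omega>)))
      \<le> ennreal (C \<gamma>) * ennreal (sqrt (\<Sum>T\<in>\<T>. (w T)\<^sup>2 * (\<integral>x. indicator T x * (u x)\<^sup>2 \<partial>lebesgue_on \<Omega>)))"
    (is "ennreal (sqrt ?a) \<le> _ * ennreal (sqrt ?b)")
    by (simp only: key[OF Qm Q2] key[OF u])
  have a: "0 \<le> ?a" and b: "0 \<le> ?b" by (auto intro!: sum_nonneg mult_nonneg_nonneg integral_nonneg_AE)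
  \<comment> \<open>\<open>C\<close> may take negative values, which \<open>ennreal\<close> maps to
    0. The absolute value covers this and disappears on squaring.\<close>
  have "ennreal (C \<gamma>) \<le> ennreal \<bar>C \<gamma>\<bar>" by (intro ennreal_leI) simp
  then have "ennreal (sqrt ?a) \<le> ennreal \<bar>C \<gamma>\<bar> * ennreal (sqrt ?b)"
    using le by (meson mult_right_mono order_trans zero_le)
  also have "\<dots> = ennreal (\<bar>C \<gamma>\<bar> * sqrt ?b)" using b by (simp add: ennreal_mult)
  finally have "sqrt ?a \<le> \<bar>C \<gamma>\<bar> * sqrt ?b" using b by (simp add: ennreal_le_iff)
  then have "(sqrt ?a)\<^sup>2 \<le> (\<bar>C \<gamma>\<bar> * sqrt ?b)\<^sup>2" using a by (intro power_mono) auto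
  then show ?thesis using a b by (simp add: power_mult_distrib)
qed

end

section \<open>Stability for a fixed mesh\<close>

text \<open>The free parameter \<open>t\<close> shifts weight to the first term, so that the
  coefficient of the second can be made small enough to absorb it.\<close>

lemma Young_scaled:
  fixes p q t x y :: real
  assumes "1 < p" "1 < q" "1 / p + 1 / q = 1" "0 < t" "0 \<le> x" "0 \<le> y"
  shows "x * y \<le> t powr p * x powr p + t powr (- q) * y powr q"
proof -
  have le: "z / r \<le> z" if "0 \<le> z" "1 < r" for z r :: real
    using that by (simp add: pos_divide_le_eq mult_le_cancel_left1)
  have "x * y = (t * x) * (y / t)" using assms by simp
  also have "\<dots> \<le> (t * x) powr p / p + (y / t) powr q / q"
    using assms by (intro Youngs_inequality) auto
  also have "\<dots> \<le> (t * x) powr p + (y / t) powr q"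
    using assms by (intro add_mono le) auto
  also have "\<dots> = t powr p * x powr p + t powr (- q) * y powr q"
    using assms by (simp add: powr_mult powr_divide powr_minus_divide)
  finally show ?thesis .
qed

context neighbor_mesh
begin

lemma integrable_powr_mono:
  assumes u: "u \<in> borel_measurable (lebesgue_on \<Omega>)" "integrable (lebesgue_on \<Omega>) (\<lambda>x. \<bar>u x\<bar> powr p)"
    and q: "0 < q" "q \<le> p"
  shows "integrable (lebesgue_on \<Omega>) (\<lambda>x. \<bar>u x :: real\<bar> powr q)"
proof (rule Bochner_Integration.integrable_bound)
  show "integrable (lebesgue_on \<Omega>) (\<lambda>x. 1 + \<bar>u x\<bar> powr p)"
    using u(2) integrable_bounded[of "\<lambda>_. 1" 1] by (intro Bochner_Integration.integrable_add) auto
  show "AE x in lebesgue_on \<Omega>. norm (\<bar>u x\<bar> powr q) \<le> norm (1 + \<bar>u x\<bar> powr p)"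
  proof (intro AE_I2)
    fix x
    have "\<bar>u x\<bar> powr q \<le> 1 + \<bar>u x\<bar> powr p"
    proof (cases "\<bar>u x\<bar> \<le> 1")
      case True
      then have "\<bar>u x\<bar> powr q \<le> 1" using q by (simp add: powr_le1)
      then show ?thesis by (rule order_trans) simp
    next
      case False
      then have "\<bar>u x\<bar> powr q \<le> \<bar>u x\<bar> powr p" using q by (intro powr_mono) auto
      then show ?thesis by simp
    qed
    then show "norm (\<bar>u x\<bar> powr q) \<le> norm (1 + \<bar>u x\<bar> powr p)" by simp
  qed
qed (use u(1) in measurable)

lemma integrable_piecewise_powr:
  assumes u: "u \<in> borel_measurable (lebesgue_on \<Omega>)" "integrable (lebesgue_on \<Omega>) (\<lambda>x. \<bar>u x\<bar> powr p)"
  shows "integrable (lebesgue_on \<Omega>) (\<lambda>x. \<bar>piecewise w x * u x\<bar> powr p)"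
proof (rule integrable_cong_AE_imp[OF integral_piecewise_mult(2)[OF u(2)]])
  show "(\<lambda>x. \<bar>piecewise w x * u x\<bar> powr p) \<in> borel_measurable (lebesgue_on \<Omega>)"
    using u(1) by measurable
  show "AE x in lebesgue_on \<Omega>. piecewise (\<lambda>T. \<bar>w T\<bar> powr p) x * \<bar>u x\<bar> powr p = \<bar>piecewise w x * u x\<bar> powr p"
    using AE_piecewise by eventually_elim (auto simp: abs_mult powr_mult)
qed

lemma lagrange_integrable_powr:
  assumes v: "v \<in> lagrange_space \<Omega> \<T> K" and p: "0 \<le> p"
  shows "integrable (lebesgue_on \<Omega>) (\<lambda>x. \<bar>v x\<bar> powr p)"
proof -
  obtain b where b: "\<And>x. x \<in> \<Omega> \<Longrightarrow> \<bar>v x\<bar> \<le> b" using lagrange_bounded[OF v] by blast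
  have [measurable]: "v \<in> borel_measurable (lebesgue_on \<Omega>)" by (rule lagrange_measurable[OF v])
  show ?thesis
    by (rule integrable_bounded[where b = "b powr p"]) (use b p in \<open>auto intro!: powr_mono2\<close>)
qed

lemma inverse_bound_AE:
  assumes B: "0 < B" "inverse_bound K B" and v: "v \<in> lagrange_space \<Omega> \<T> K"
  defines "I T \<equiv> \<integral>x. indicator T x * (v x)\<^sup>2 \<partial>lebesgue_on \<Omega>"
  shows "AE x in lebesgue_on \<Omega>. \<exists>T\<in>\<T>. x \<in> T \<and> (\<forall>w. piecewise w x = w T) \<and>
    \<bar>v x\<bar> \<le> sqrt B * sqrt (I T / vol T)"
  using AE_piecewise AE_space
proof eventually_elim
  case (elim x)
  then obtain T where T: "T \<in> \<T>" "x \<in> T" "\<forall>w. piecewise w x = w T" and x: "x \<in> \<Omega>" by auto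
  have "(v x)\<^sup>2 * vol T \<le> B * I T"
    using B(2) v T x unfolding inverse_bound_def I_def by blast
  then have "(v x)\<^sup>2 \<le> B * (I T / vol T)"
    using vol_pos[OF T(1)] by (simp add: pos_le_divide_eq)
  then have "sqrt ((v x)\<^sup>2) \<le> sqrt (B * (I T / vol T))" by (rule real_sqrt_le_mono)
  then have "\<bar>v x\<bar> \<le> sqrt B * sqrt (I T / vol T)"
    by (simp only: real_sqrt_mult real_sqrt_abs)
  with T show ?case by blast
qed

text \<open>Inverting the inequality for the reversed pair of neighbors: the weight of the dual
  problem has the same grading.\<close>

lemma graded_inverse: "graded \<gamma> r \<Longrightarrow> graded \<gamma> (\<lambda>T. 1 / r T)"
  unfolding graded_def using neighbor_mem by (fastforce simp: field_simps)

end

context graded_mesh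
begin

text \<open>A majorant enters an L^2 estimate through its square root, so the grading (\<gamma>' /
  \<gamma>)^2 of \<open>G\<close> raises the grading of the weight from \<gamma> only to
  \<gamma>'.\<close>

lemma majorized_L2_stability:
  assumes wg: "worst_grading C \<Omega> \<T> N K g" and r: "graded \<gamma> r" and \<gamma>: "1 \<le> \<gamma>" "\<gamma> \<le> \<gamma>'" "ereal \<gamma>' < g"
    and G: "graded ((\<gamma>' / \<gamma>)\<^sup>2) G"
    and u: "u \<in> borel_measurable (lebesgue_on \<Omega>)" "integrable (lebesgue_on \<Omega>) (\<lambda>x. (u x)\<^sup>2)"
  shows "(\<Sum>T\<in>\<T>. (r T)\<^sup>2 * G T * (\<integral>x. indicator T x * (L2_projection \<Omega> \<T> K u x)\<^sup>2 \<partial>lebesgue_on \<Omega>))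
    \<le> (C \<gamma>')\<^sup>2 * (\<Sum>T\<in>\<T>. (r T)\<^sup>2 * G T * (\<integral>x. indicator T x * (u x)\<^sup>2 \<partial>lebesgue_on \<Omega>))"
proof -
  let ?w = "\<lambda>T. r T * sqrt (G T)"
  have G0: "0 < G T" if "T \<in> \<T>" for T using G that by (simp add: graded_def)
  have "graded \<gamma>' ?w"
    unfolding graded_def
  proof (intro conjI ballI, goal_cases)
    case (1 T)
    then show ?case using r G by (auto simp: graded_def)
  next
    case (2 e)
    obtain T T' where e: "e = (T, T')" by (cases e)
    then have TT: "(T, T') \<in> N" and "T \<in> \<T>" "T' \<in> \<T>" using neighbor_mem 2 by auto
    then have "r T' \<le> \<gamma> * r T" "0 < r T" "0 < r T'" "G T' \<le> (\<gamma>' / \<gamma>)\<^sup>2 * G T"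
      using r G by (auto simp: graded_def)
    moreover from this(4) have "sqrt (G T') \<le> \<gamma>' / \<gamma> * sqrt (G T)"
      using real_sqrt_le_mono[of "G T'" "(\<gamma>' / \<gamma>)\<^sup>2 * G T"] \<gamma> by (simp add: real_sqrt_mult)
    ultimately have "r T' * sqrt (G T') \<le> (\<gamma> * r T) * (\<gamma>' / \<gamma> * sqrt (G T))"
      using G0[OF \<open>T' \<in> \<T>\<close>] \<gamma> by (intro mult_mono) auto
    then show ?case using \<gamma> e by (simp add: mult_ac)
  qed
  from weighted_L2_stability[OF wg this _ \<gamma>(3) u] \<gamma>
  have "(\<Sum>T\<in>\<T>. (?w T)\<^sup>2 * (\<integral>x. indicator T x * (L2_projection \<Omega> \<T> K u x)\<^sup>2 \<partial>lebesgue_on \<Omega>))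
    \<le> (C \<gamma>')\<^sup>2 * (\<Sum>T\<in>\<T>. (?w T)\<^sup>2 * (\<integral>x. indicator T x * (u x)\<^sup>2 \<partial>lebesgue_on \<Omega>))" by simp
  moreover have "(?w T)\<^sup>2 = (r T)\<^sup>2 * G T" if "T \<in> \<T>" for T
    using G0[OF that] by (simp add: power_mult_distrib)
  ultimately show ?thesis by simp
qed

text \<open>\<open>powr 1\<close> is the limiting case of R = p / (p - 2). Nothing has to be
  absorbed, because \<open>b\<close> already bounds the data on each simplex.\<close>

lemma Linf_stability:
  assumes wg: "worst_grading C \<Omega> \<T> N K g" and r: "graded \<gamma> r" and \<gamma>: "1 \<le> \<gamma>" "\<gamma> \<le> \<gamma>'" "ereal \<gamma>' < g"
    and q: "\<gamma>h ^ CARD('n) * (1 / (\<gamma>' / \<gamma>)\<^sup>2) powr 1 < 1"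
    and B: "0 < B" "inverse_bound K B"
    and u: "u \<in> borel_measurable (lebesgue_on \<Omega>)" "integrable (lebesgue_on \<Omega>) (\<lambda>x. (u x)\<^sup>2)"
    and b: "0 \<le> b" "AE x in lebesgue_on \<Omega>. \<bar>piecewise r x * u x\<bar> \<le> b"
  shows "AE x in lebesgue_on \<Omega>. \<bar>piecewise r x * L2_projection \<Omega> \<T> K u x\<bar>
    \<le> sqrt (B * sum_const (\<gamma>h ^ CARD('n) * (1 / (\<gamma>' / \<gamma>)\<^sup>2) powr 1)) * \<bar>C \<gamma>'\<bar> * b"
proof -
  let ?Q = "L2_projection \<Omega> \<T> K u"
  let ?S = "sum_const (\<gamma>h ^ CARD('n) * (1 / (\<gamma>' / \<gamma>)\<^sup>2) powr 1)"
  define I where "I T = (\<integral>x. indicator T x * (?Q x)\<^sup>2 \<partial>lebesgue_on \<Omega>)" for T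
  have Q: "?Q \<in> lagrange_space \<Omega> \<T> K" by (rule L2_projection(1)[OF integrable_of_square[OF u]])
  have \<eta>: "1 \<le> (\<gamma>' / \<gamma>)\<^sup>2" using \<gamma> by (intro one_le_power) simp
  have rpos: "0 < r T" if "T \<in> \<T>" for T using r that by (simp add: graded_def)
  have I0: "0 \<le> I T" for T unfolding I_def by (intro integral_nonneg_AE) auto
  have main: "(r T0)\<^sup>2 * I T0 \<le> (C \<gamma>')\<^sup>2 * b\<^sup>2 * ?S * vol T0" if T0: "T0 \<in> \<T>" for T0
  proof -
    \<comment> \<open>For this choice the sum of vol T G T is at most \<open>?S\<close> vol T0: the
      estimate is local, and vol T0 cancels against the volume in the inverse estimate.\<close>
    let ?g = "\<lambda>T. if T = T0 then 1 else 0 :: real"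
    obtain G where G: "graded ((\<gamma>' / \<gamma>)\<^sup>2) G" "\<And>T. T \<in> \<T> \<Longrightarrow> ?g T \<le> G T"
      "(\<Sum>T\<in>\<T>. vol T * G T powr 1) \<le> ?S * (\<Sum>T\<in>\<T>. vol T * ?g T powr 1)"
      by (rule graded_majorant[of 1 "(\<gamma>' / \<gamma>)\<^sup>2" ?g T0]) (use \<eta> q T0 in auto)
    have G0: "0 < G T" if "T \<in> \<T>" for T using G(1) that by (simp add: graded_def)
    have bd: "(r T)\<^sup>2 * (\<integral>x. indicator T x * (u x)\<^sup>2 \<partial>lebesgue_on \<Omega>) \<le> b\<^sup>2 * vol T" if T: "T \<in> \<T>" for T
    proof -
      have "(\<integral>x. (r T)\<^sup>2 * (indicator T x * (u x)\<^sup>2) \<partial>lebesgue_on \<Omega>) \<le> (\<integral>x. b\<^sup>2 * indicator T x \<partial>lebesgue_on \<Omega>)"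
      proof (rule integral_mono_AE)
        show "integrable (lebesgue_on \<Omega>) (\<lambda>x. (r T)\<^sup>2 * (indicator T x * (u x)\<^sup>2))"
          using integral_piecewise_mult(3)[OF u(2) T] by simp
        show "integrable (lebesgue_on \<Omega>) (\<lambda>x. b\<^sup>2 * indicator T x)"
        proof (rule integrable_mult_right)
          have "integrable (lebesgue_on \<Omega>) (\<lambda>_. 1 :: real)" by (rule integrable_bounded[where b = 1]) auto
          from integral_piecewise_mult(3)[OF this T]
          show "integrable (lebesgue_on \<Omega>) (indicator T :: _ \<Rightarrow> real)" by (simp only: mult_1_right)
        qed
        show "AE x in lebesgue_on \<Omega>. (r T)\<^sup>2 * (indicator T x * (u x)\<^sup>2) \<le> b\<^sup>2 * indicator T x"
          using b(2) piecewise_on_simplex[OF T, of r]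
        proof eventually_elim
          case (elim x)
          show ?case
          proof (cases "x \<in> T")
            case True
            then have "\<bar>r T * u x\<bar>\<^sup>2 \<le> b\<^sup>2" using elim by (intro power_mono) auto
            then show ?thesis using True by (simp add: power_mult_distrib)
          qed simp
        qed
      qed
      then show ?thesis using integral_vol[OF T] by simp
    qed
    have "(r T0)\<^sup>2 * I T0 \<le> (r T0)\<^sup>2 * G T0 * I T0"
      using G(2)[OF T0] I0[of T0] mult_right_mono[of 1 "G T0" "(r T0)\<^sup>2 * I T0"] by (simp add: mult_ac)
    also have "\<dots> \<le> (\<Sum>T\<in>\<T>. (r T)\<^sup>2 * G T * I T)"
      using finite_T T0 G0 I0 by (intro member_le_sum) (auto simp: less_imp_le)
    also have "\<dots> \<le> (C \<gamma>')\<^sup>2 * (\<Sum>T\<in>\<T>. (r T)\<^sup>2 * G T * (\<integral>x. indicator T x * (u x)\<^sup>2 \<partial>lebesgue_on \<Omega>))"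
      unfolding I_def by (rule majorized_L2_stability[OF wg r \<gamma> G(1) u])
    also have "\<dots> = (C \<gamma>')\<^sup>2 * (\<Sum>T\<in>\<T>. G T * ((r T)\<^sup>2 * (\<integral>x. indicator T x * (u x)\<^sup>2 \<partial>lebesgue_on \<Omega>)))"
      by (simp add: mult_ac)
    also have "\<dots> \<le> (C \<gamma>')\<^sup>2 * (\<Sum>T\<in>\<T>. G T * (b\<^sup>2 * vol T))"
      using G0 by (intro mult_left_mono sum_mono bd) (auto simp: less_imp_le)
    also have "\<dots> = (C \<gamma>')\<^sup>2 * b\<^sup>2 * (\<Sum>T\<in>\<T>. vol T * G T powr 1)"
      using G0 by (simp add: sum_distrib_left mult_ac less_imp_le)
    also have "\<dots> \<le> (C \<gamma>')\<^sup>2 * b\<^sup>2 * (?S * (\<Sum>T\<in>\<T>. vol T * ?g T powr 1))"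
      by (intro mult_left_mono G(3)) auto
    also have "(\<Sum>T\<in>\<T>. vol T * ?g T powr 1) = (\<Sum>T\<in>\<T>. if T = T0 then vol T else 0)"
      by (intro sum.cong) auto
    also have "\<dots> = vol T0" using finite_T T0 by simp
    finally show ?thesis by (simp add: mult_ac)
  qed
  show ?thesis
    using inverse_bound_AE[OF B Q, folded I_def]
  proof eventually_elim
    case (elim x)
    then obtain T where T: "T \<in> \<T>" "piecewise r x = r T" "\<bar>?Q x\<bar> \<le> sqrt B * sqrt (I T / vol T)" by blast
    have "(r T)\<^sup>2 * (I T / vol T) \<le> (C \<gamma>')\<^sup>2 * b\<^sup>2 * ?S"
      using main[OF T(1)] vol_pos[OF T(1)] by (simp add: pos_divide_le_eq)
    then have "sqrt ((r T)\<^sup>2 * (I T / vol T)) \<le> sqrt ((C \<gamma>')\<^sup>2 * b\<^sup>2 * ?S)" by (rule real_sqrt_le_mono)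
    then have *: "r T * sqrt (I T / vol T) \<le> \<bar>C \<gamma>'\<bar> * b * sqrt ?S"
      using rpos[OF T(1)] b(1) by (simp add: real_sqrt_mult real_sqrt_divide)
    have "\<bar>piecewise r x * ?Q x\<bar> = r T * \<bar>?Q x\<bar>" using T(2) rpos[OF T(1)] by (simp add: abs_mult)
    also have "\<dots> \<le> r T * (sqrt B * sqrt (I T / vol T))"
      using T(3) rpos[OF T(1)] by (intro mult_left_mono) auto
    also have "\<dots> = sqrt B * (r T * sqrt (I T / vol T))" by simp
    also have "\<dots> \<le> sqrt B * (\<bar>C \<gamma>'\<bar> * b * sqrt ?S)" using B(1) by (intro mult_left_mono *) auto
    also have "\<dots> = sqrt (B * ?S) * \<bar>C \<gamma>'\<bar> * b" by (simp add: real_sqrt_mult)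
    finally show ?case .
  qed
qed

text \<open>\<open>R\<close> is conjugate to p / 2, the exponent at which the square of the weighted
  function is integrable. The bound for \<open>G\<close> in L^R therefore returns the quantity
  \<open>A\<close> being estimated, with a coefficient that \<open>t\<close> makes at most
  1/2.\<close>

lemma Lp_stability_gt_2:
  fixes p R t :: real
  assumes wg: "worst_grading C \<Omega> \<T> N K g" and r: "graded \<gamma> r" and \<gamma>: "1 \<le> \<gamma>" "\<gamma> \<le> \<gamma>'" "ereal \<gamma>' < g"
    and p: "2 < p" and R: "R = p / (p - 2)"
    and q: "\<gamma>h ^ CARD('n) * (1 / (\<gamma>' / \<gamma>)\<^sup>2) powr R < 1"
    and B: "0 < B" "inverse_bound K B"
    and t: "0 < t" "(C \<gamma>')\<^sup>2 * t powr (- R) * sum_const (\<gamma>h ^ CARD('n) * (1 / (\<gamma>' / \<gamma>)\<^sup>2) powr R) \<le> 1 / 2"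
    and u: "u \<in> borel_measurable (lebesgue_on \<Omega>)" "integrable (lebesgue_on \<Omega>) (\<lambda>x. \<bar>u x\<bar> powr p)"
  shows "(\<integral>x. \<bar>piecewise r x * L2_projection \<Omega> \<T> K u x\<bar> powr p \<partial>lebesgue_on \<Omega>)
    \<le> sqrt B powr p * (2 * (C \<gamma>')\<^sup>2 * t powr (p / 2)) * (\<integral>x. \<bar>piecewise r x * u x\<bar> powr p \<partial>lebesgue_on \<Omega>)"
proof -
  let ?Q = "L2_projection \<Omega> \<T> K u"
  let ?S = "sum_const (\<gamma>h ^ CARD('n) * (1 / (\<gamma>' / \<gamma>)\<^sup>2) powr R)"
  let ?U = "\<integral>x. \<bar>piecewise r x * u x\<bar> powr p \<partial>lebesgue_on \<Omega>"
  have u2: "integrable (lebesgue_on \<Omega>) (\<lambda>x. (u x)\<^sup>2)"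
    using integrable_powr_mono[OF u, of 2] p by simp
  have Q: "?Q \<in> lagrange_space \<Omega> \<T> K" by (rule L2_projection(1)[OF integrable_of_square[OF u(1) u2]])
  define I where "I T = (\<integral>x. indicator T x * (?Q x)\<^sup>2 \<partial>lebesgue_on \<Omega>)" for T
  \<comment> \<open>The root mean square over \<open>T\<close> of the function to be estimated. By
    the inverse estimate it controls its supremum there, so \<open>A\<close> controls the p-th power
    integral.\<close>
  define a where "a T = r T * sqrt (I T / vol T)" for T
  define A where "A = (\<Sum>T\<in>\<T>. vol T * a T powr p)"
  have \<eta>: "1 \<le> (\<gamma>' / \<gamma>)\<^sup>2" using \<gamma> by (intro one_le_power) simp
  have rpos: "0 < r T" if "T \<in> \<T>" for T using r that by (simp add: graded_def)
  have I0: "0 \<le> I T" for T unfolding I_def by (intro integral_nonneg_AE) auto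
  have a0: "0 \<le> a T" if "T \<in> \<T>" for T
    unfolding a_def using rpos[OF that] I0[of T] by simp
  have U0: "0 \<le> ?U" by (intro integral_nonneg_AE) auto
  have Qm[measurable]: "?Q \<in> borel_measurable (lebesgue_on \<Omega>)" by (rule lagrange_measurable[OF Q])
  have "(\<integral>x. \<bar>piecewise r x * ?Q x\<bar> powr p \<partial>lebesgue_on \<Omega>) \<le>
      (\<integral>x. piecewise (\<lambda>T. sqrt B powr p * a T powr p) x \<partial>lebesgue_on \<Omega>)"
  proof (rule integral_mono_AE[OF _ integrable_piecewise])
    show "integrable (lebesgue_on \<Omega>) (\<lambda>x. \<bar>piecewise r x * ?Q x\<bar> powr p)"
      using p by (intro integrable_piecewise_powr lagrange_integrable_powr[OF Q] Qm) auto
    show "AE x in lebesgue_on \<Omega>. \<bar>piecewise r x * ?Q x\<bar> powr p \<le> piecewise (\<lambda>T. sqrt B powr p * a T powr p) x"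
      using inverse_bound_AE[OF B Q, folded I_def]
    proof eventually_elim
      case (elim x)
      then obtain T where T: "T \<in> \<T>" "\<And>w. piecewise w x = w T" "\<bar>?Q x\<bar> \<le> sqrt B * sqrt (I T / vol T)" by blast
      have "\<bar>piecewise r x * ?Q x\<bar> = r T * \<bar>?Q x\<bar>" using T(2) rpos[OF T(1)] by (simp add: abs_mult)
      also have "\<dots> \<le> r T * (sqrt B * sqrt (I T / vol T))"
        using T(3) rpos[OF T(1)] by (intro mult_left_mono) auto
      finally have "\<bar>piecewise r x * ?Q x\<bar> powr p \<le> (sqrt B * a T) powr p"
        using p by (intro powr_mono2) (auto simp: a_def mult_ac)
      then show ?case using a0[OF T(1)] B(1) by (simp add: T(2) powr_mult)
    qed
  qed
  also have "\<dots> = sqrt B powr p * A"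
    by (simp add: integral_piecewise A_def sum_distrib_left mult_ac)
  finally have LHS: "(\<integral>x. \<bar>piecewise r x * ?Q x\<bar> powr p \<partial>lebesgue_on \<Omega>) \<le> sqrt B powr p * A" .
  have "A \<le> 2 * (C \<gamma>')\<^sup>2 * t powr (p / 2) * ?U"
  proof (cases "\<exists>T\<in>\<T>. 0 < a T")
    \<comment> \<open>\<open>graded_majorant\<close> asks for one positive value, so the trivial
      case is split off.\<close>
    case False
    then have "a T = 0" if "T \<in> \<T>" for T using a0[OF that] that by (metis antisym_conv1)
    then have "A = 0" by (simp add: A_def)
    then show ?thesis using U0 by simp
  next
    case True
    then obtain T0 where T0: "T0 \<in> \<T>" "0 < a T0" by blast
    let ?g = "\<lambda>T. a T powr (p - 2)"
    obtain G where G: "graded ((\<gamma>' / \<gamma>)\<^sup>2) G" "\<And>T. T \<in> \<T> \<Longrightarrow> ?g T \<le> G T"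
      "(\<Sum>T\<in>\<T>. vol T * G T powr R) \<le> ?S * (\<Sum>T\<in>\<T>. vol T * ?g T powr R)"
      by (rule graded_majorant[of R "(\<gamma>' / \<gamma>)\<^sup>2" ?g T0]) (use \<eta> q T0 p R in auto)
    have G0: "0 < G T" if "T \<in> \<T>" for T using G(1) that by (simp add: graded_def)
    \<comment> \<open>(p - 2) R = p: this identity closes the argument.\<close>
    have gR: "?g T powr R = a T powr p" for T
      using p by (simp add: powr_powr R)
    have "vol T * a T powr p = (r T)\<^sup>2 * ?g T * I T" if T: "T \<in> \<T>" for T
    proof -
      have "a T powr p = a T powr (p - 2) * a T powr 2" by (simp add: powr_add[symmetric])
      also have "a T powr 2 = (r T)\<^sup>2 * (I T / vol T)"
        using a0[OF T] I0[of T] by (simp add: a_def power_mult_distrib)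
      finally show ?thesis using vol_pos[OF T] by simp
    qed
    then have "A = (\<Sum>T\<in>\<T>. (r T)\<^sup>2 * ?g T * I T)" by (simp add: A_def)
    also have "\<dots> \<le> (\<Sum>T\<in>\<T>. (r T)\<^sup>2 * G T * I T)"
      using I0 by (intro sum_mono mult_right_mono mult_left_mono G) auto
    also have "\<dots> \<le> (C \<gamma>')\<^sup>2 * (\<Sum>T\<in>\<T>. (r T)\<^sup>2 * G T * (\<integral>x. indicator T x * (u x)\<^sup>2 \<partial>lebesgue_on \<Omega>))"
      unfolding I_def by (rule majorized_L2_stability[OF wg r \<gamma> G(1) u(1) u2])
    also have "\<dots> = (C \<gamma>')\<^sup>2 * (\<integral>x. piecewise (\<lambda>T. (r T)\<^sup>2 * G T) x * (u x)\<^sup>2 \<partial>lebesgue_on \<Omega>)"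
      using integral_piecewise_mult(1)[OF u2] by simp
    also have "\<dots> \<le> (C \<gamma>')\<^sup>2 * (\<integral>x. t powr (p / 2) * \<bar>piecewise r x * u x\<bar> powr p +
        t powr (- R) * piecewise (\<lambda>T. G T powr R) x \<partial>lebesgue_on \<Omega>)"
    proof (intro mult_left_mono integral_mono_AE integral_piecewise_mult(2) u2)
      show "integrable (lebesgue_on \<Omega>) (\<lambda>x. t powr (p / 2) * \<bar>piecewise r x * u x\<bar> powr p +
          t powr (- R) * piecewise (\<lambda>T. G T powr R) x)"
        by (intro Bochner_Integration.integrable_add integrable_mult_right integrable_piecewise_powr u integrable_piecewise)
      show "AE x in lebesgue_on \<Omega>. piecewise (\<lambda>T. (r T)\<^sup>2 * G T) x * (u x)\<^sup>2 \<le>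
          t powr (p / 2) * \<bar>piecewise r x * u x\<bar> powr p + t powr (- R) * piecewise (\<lambda>T. G T powr R) x"
        using AE_piecewise
      proof eventually_elim
        case (elim x)
        then obtain T where T: "T \<in> \<T>" "\<And>w. piecewise w x = w T" by blast
        \<comment> \<open>Young's inequality with exponents p / 2 and \<open>R\<close>.\<close>
        have "(r T * u x)\<^sup>2 * G T \<le> t powr (p / 2) * ((r T * u x)\<^sup>2) powr (p / 2) + t powr (- R) * G T powr R"
          using p t(1) G0[OF T(1)] by (intro Young_scaled) (auto simp: R field_simps)
        also have "((r T * u x)\<^sup>2) powr (p / 2) = \<bar>r T * u x\<bar> powr p"
        proof -
          have "(r T * u x)\<^sup>2 = \<bar>r T * u x\<bar> powr 2" by simp
          then show ?thesis by (simp only: powr_powr) simp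
        qed
        finally show ?case by (simp add: T(2) power_mult_distrib mult_ac)
      qed
    qed auto
    also have "\<dots> = (C \<gamma>')\<^sup>2 * (t powr (p / 2) * ?U + t powr (- R) * (\<Sum>T\<in>\<T>. vol T * G T powr R))"
      using integrable_piecewise_powr[OF u, of r] integrable_piecewise
      by (simp add: integral_piecewise mult.commute)
    also have "\<dots> \<le> (C \<gamma>')\<^sup>2 * (t powr (p / 2) * ?U + t powr (- R) * (?S * A))"
      using G(3) by (intro mult_left_mono add_left_mono) (auto simp: A_def gR)
    also have "\<dots> = (C \<gamma>')\<^sup>2 * t powr (p / 2) * ?U + ((C \<gamma>')\<^sup>2 * t powr (- R) * ?S) * A"
      by (simp add: algebra_simps)
    \<comment> \<open>\<open>A\<close> is a real number, so half of it can be moved to the left-hand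
      side.\<close>
    also have "\<dots> \<le> (C \<gamma>')\<^sup>2 * t powr (p / 2) * ?U + 1 / 2 * A"
      by (intro add_left_mono mult_right_mono t) (auto simp: A_def intro!: sum_nonneg)
    finally show ?thesis by simp
  qed
  then have "sqrt B powr p * A \<le> sqrt B powr p * (2 * (C \<gamma>')\<^sup>2 * t powr (p / 2) * ?U)"
    by (intro mult_left_mono) auto
  with LHS show ?thesis by (simp add: mult_ac)
qed

end

section \<open>Exponents below 2 by duality\<close>

context neighbor_mesh
begin

lemma L2_projection_symmetric:
  assumes "integrable (lebesgue_on \<Omega>) u" "integrable (lebesgue_on \<Omega>) v"
  shows "(\<integral>x. v x * L2_projection \<Omega> \<T> K u x \<partial>lebesgue_on \<Omega>) = (\<integral>x. u x * L2_projection \<Omega> \<T> K v x \<partial>lebesgue_on \<Omega>)"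
  using L2_projection(2)[OF assms(2) L2_projection(1)[OF assms(1)]]
    L2_projection(2)[OF assms(1) L2_projection(1)[OF assms(2)]]
  by (simp add: mult.commute)

text \<open>Duality without dual norms. The test function \<psi> is the one for which Hoelder's
  inequality is sharp; symmetry moves the projection onto it, and the dual estimate bounds the
  result by a multiple of the quantity one started from, which is absorbed.\<close>

lemma Lp_stability_lt_2:
  fixes p p' t c :: real
  assumes r: "graded \<gamma> r" and p: "1 < p" "p' = p / (p - 1)"
    and dual: "\<And>u. u \<in> borel_measurable (lebesgue_on \<Omega>) \<Longrightarrow> integrable (lebesgue_on \<Omega>) (\<lambda>x. \<bar>u x\<bar> powr p') \<Longrightarrow>
      (\<integral>x. \<bar>piecewise (\<lambda>T. 1 / r T) x * L2_projection \<Omega> \<T> K u x\<bar> powr p' \<partial>lebesgue_on \<Omega>)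
      \<le> c * (\<integral>x. \<bar>piecewise (\<lambda>T. 1 / r T) x * u x\<bar> powr p' \<partial>lebesgue_on \<Omega>)"
    and t: "0 < t" "t powr (- p') * c \<le> 1 / 2"
    and u: "u \<in> borel_measurable (lebesgue_on \<Omega>)" "integrable (lebesgue_on \<Omega>) (\<lambda>x. \<bar>u x\<bar> powr p)"
  shows "(\<integral>x. \<bar>piecewise r x * L2_projection \<Omega> \<T> K u x\<bar> powr p \<partial>lebesgue_on \<Omega>)
    \<le> 2 * t powr p * (\<integral>x. \<bar>piecewise r x * u x\<bar> powr p \<partial>lebesgue_on \<Omega>)"
proof -
  let ?Q = "L2_projection \<Omega> \<T> K"
  let ?s = "\<lambda>T. 1 / r T"
  have p': "1 < p'" "1 / p + 1 / p' = 1" "(p - 1) * p' = p"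
    using p(1) unfolding p(2) by (auto simp: divide_simps)
  have rpos: "0 < r T" if "T \<in> \<T>" for T using r that by (simp add: graded_def)
  have u1: "integrable (lebesgue_on \<Omega>) u"
  proof -
    have "integrable (lebesgue_on \<Omega>) (\<lambda>x. \<bar>u x\<bar>)"
      using integrable_powr_mono[OF u, of 1] p by simp
    then show ?thesis using u(1) by (simp add: integrable_abs_iff)
  qed
  have Qu: "?Q u \<in> lagrange_space \<Omega> \<T> K" by (rule L2_projection(1)[OF u1])
  have Qum[measurable]: "?Q u \<in> borel_measurable (lebesgue_on \<Omega>)" by (rule lagrange_measurable[OF Qu])
  define f where "f x = piecewise r x * ?Q u x" for x
  \<comment> \<open>|v|^p' = |f|^p because (p - 1) p' = p, so \<psi> divided by the weight has the
    same integral \<open>A\<close>. Since \<open>?Q u\<close> is bounded, so is \<psi>, which makes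
    it admissible in the dual estimate.\<close>
  define v where "v x = sgn (?Q u x) * \<bar>f x\<bar> powr (p - 1)" for x
  define \<psi> where "\<psi> x = piecewise r x * v x" for x
  obtain b0 where b0: "\<And>x. x \<in> \<Omega> \<Longrightarrow> \<bar>?Q u x\<bar> \<le> b0" using lagrange_bounded[OF Qu] by blast
  let ?b = "(\<Sum>T\<in>\<T>. \<bar>r T\<bar>)"
  have fb: "\<bar>f x\<bar> \<le> ?b * b0" if "x \<in> \<Omega>" for x
    unfolding f_def abs_mult by (intro mult_mono piecewise_bound b0 that sum_nonneg) auto
  have vb: "\<bar>v x\<bar> \<le> (?b * b0) powr (p - 1)" if "x \<in> \<Omega>" for x
  proof -
    have "\<bar>v x\<bar> \<le> \<bar>f x\<bar> powr (p - 1)" by (simp add: v_def abs_mult abs_sgn_eq)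
    also have "\<dots> \<le> (?b * b0) powr (p - 1)" using fb[OF that] p by (intro powr_mono2) auto
    finally show ?thesis .
  qed
  have \<psi>b: "\<bar>\<psi> x\<bar> \<le> ?b * (?b * b0) powr (p - 1)" if "x \<in> \<Omega>" for x
    unfolding \<psi>_def abs_mult by (intro mult_mono piecewise_bound vb that sum_nonneg) auto
  have fm[measurable]: "f \<in> borel_measurable (lebesgue_on \<Omega>)" unfolding f_def by measurable
  have vm[measurable]: "v \<in> borel_measurable (lebesgue_on \<Omega>)" unfolding v_def by measurable
  have \<psi>m[measurable]: "\<psi> \<in> borel_measurable (lebesgue_on \<Omega>)" unfolding \<psi>_def by measurable
  have \<psi>1: "integrable (lebesgue_on \<Omega>) \<psi>" by (rule integrable_bounded[OF \<psi>m \<psi>b])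
  have \<psi>p: "integrable (lebesgue_on \<Omega>) (\<lambda>x. \<bar>\<psi> x\<bar> powr p')"
    by (rule integrable_bounded[where b = "(?b * (?b * b0) powr (p - 1)) powr p'"])
      (use \<psi>b p' in \<open>auto intro!: powr_mono2\<close>)
  have Q\<psi>: "?Q \<psi> \<in> lagrange_space \<Omega> \<T> K" by (rule L2_projection(1)[OF \<psi>1])
  define A where "A = (\<integral>x. \<bar>f x\<bar> powr p \<partial>lebesgue_on \<Omega>)"
  let ?U = "\<integral>x. \<bar>piecewise r x * u x\<bar> powr p \<partial>lebesgue_on \<Omega>"
  let ?V = "\<integral>x. \<bar>piecewise ?s x * ?Q \<psi> x\<bar> powr p' \<partial>lebesgue_on \<Omega>"
  have rx: "AE x in lebesgue_on \<Omega>. 0 < piecewise r x \<and> piecewise ?s x = 1 / piecewise r x"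
    using AE_piecewise by eventually_elim (use rpos in auto)
  have "A = (\<integral>x. \<psi> x * ?Q u x \<partial>lebesgue_on \<Omega>)"
    unfolding A_def
  proof (rule integral_cong_AE)
    show "AE x in lebesgue_on \<Omega>. \<bar>f x\<bar> powr p = \<psi> x * ?Q u x"
      using rx
    proof eventually_elim
      case (elim x)
      have "\<psi> x * ?Q u x = (piecewise r x * (sgn (?Q u x) * ?Q u x)) * \<bar>f x\<bar> powr (p - 1)"
        by (simp add: \<psi>_def v_def mult_ac)
      also have "sgn (?Q u x) * ?Q u x = \<bar>?Q u x\<bar>" by (simp add: sgn_if)
      also have "piecewise r x * \<bar>?Q u x\<bar> = \<bar>f x\<bar>" using elim by (simp add: f_def abs_mult)
      also have "\<bar>f x\<bar> * \<bar>f x\<bar> powr (p - 1) = \<bar>f x\<bar> powr p"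
        using powr_mult_base[of "\<bar>f x\<bar>" "p - 1"] by simp
      finally show ?case by simp
    qed
  qed measurable
  also have "\<dots> = (\<integral>x. u x * ?Q \<psi> x \<partial>lebesgue_on \<Omega>)" by (rule L2_projection_symmetric[OF u1 \<psi>1])
  also have "\<dots> \<le> (\<integral>x. t powr p * \<bar>piecewise r x * u x\<bar> powr p +
      t powr (- p') * \<bar>piecewise ?s x * ?Q \<psi> x\<bar> powr p' \<partial>lebesgue_on \<Omega>)"
  proof (rule integral_mono_AE)
    show "integrable (lebesgue_on \<Omega>) (\<lambda>x. u x * ?Q \<psi> x)" by (rule lagrange_integrable_mult[OF Q\<psi> u1])
    show "integrable (lebesgue_on \<Omega>) (\<lambda>x. t powr p * \<bar>piecewise r x * u x\<bar> powr p +
      t powr (- p') * \<bar>piecewise ?s x * ?Q \<psi> x\<bar> powr p')"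
      using p' by (intro Bochner_Integration.integrable_add integrable_mult_right integrable_piecewise_powr u
          lagrange_integrable_powr[OF Q\<psi>] lagrange_measurable[OF Q\<psi>]) auto
    show "AE x in lebesgue_on \<Omega>. u x * ?Q \<psi> x \<le> t powr p * \<bar>piecewise r x * u x\<bar> powr p +
      t powr (- p') * \<bar>piecewise ?s x * ?Q \<psi> x\<bar> powr p'"
      using rx
    proof eventually_elim
      case (elim x)
      have "u x * ?Q \<psi> x = (piecewise r x * u x) * (piecewise ?s x * ?Q \<psi> x)" using elim by simp
      also have "\<dots> \<le> \<bar>piecewise r x * u x\<bar> * \<bar>piecewise ?s x * ?Q \<psi> x\<bar>"
        unfolding abs_mult[symmetric] by (rule abs_ge_self)
      also have "\<dots> \<le> t powr p * \<bar>piecewise r x * u x\<bar> powr p +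
          t powr (- p') * \<bar>piecewise ?s x * ?Q \<psi> x\<bar> powr p'"
        using p p' t by (intro Young_scaled) auto
      finally show ?case .
    qed
  qed
  also have "\<dots> = t powr p * ?U + t powr (- p') * ?V"
    using integrable_piecewise_powr[OF u, of r]
      integrable_piecewise_powr[OF lagrange_measurable[OF Q\<psi>] lagrange_integrable_powr[OF Q\<psi>], of p' ?s] p'
    by simp
  also have "\<dots> \<le> t powr p * ?U + t powr (- p') * (c * (\<integral>x. \<bar>piecewise ?s x * \<psi> x\<bar> powr p' \<partial>lebesgue_on \<Omega>))"
    by (intro add_left_mono mult_left_mono dual \<psi>m \<psi>p) auto
  also have "(\<integral>x. \<bar>piecewise ?s x * \<psi> x\<bar> powr p' \<partial>lebesgue_on \<Omega>) = A"
    unfolding A_def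
  proof (rule integral_cong_AE)
    show "AE x in lebesgue_on \<Omega>. \<bar>piecewise ?s x * \<psi> x\<bar> powr p' = \<bar>f x\<bar> powr p"
      using rx
    proof eventually_elim
      case (elim x)
      then have "piecewise ?s x * \<psi> x = v x" by (simp add: \<psi>_def)
      moreover have "\<bar>v x\<bar> = \<bar>f x\<bar> powr (p - 1)"
        by (cases "?Q u x = 0") (simp_all add: v_def f_def abs_mult abs_sgn_eq)
      ultimately show ?case by (simp add: powr_powr p')
    qed
  qed measurable
  also have "t powr p * ?U + t powr (- p') * (c * A) = t powr p * ?U + (t powr (- p') * c) * A" by simp
  also have "\<dots> \<le> t powr p * ?U + 1 / 2 * A"
    using t(2) by (intro add_left_mono mult_right_mono) (auto simp: A_def intro!: integral_nonneg_AE)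
  finally show ?thesis by (simp add: A_def f_def)
qed

text \<open>The test function is now the weight times the sign of the projection; divided by the
  weight it is bounded by 1, which is the normalisation in the dual hypothesis.\<close>

lemma L1_stability:
  assumes r: "graded \<gamma> r"
    and dual: "\<And>u. u \<in> borel_measurable (lebesgue_on \<Omega>) \<Longrightarrow> integrable (lebesgue_on \<Omega>) (\<lambda>x. (u x)\<^sup>2) \<Longrightarrow>
      AE x in lebesgue_on \<Omega>. \<bar>piecewise (\<lambda>T. 1 / r T) x * u x\<bar> \<le> 1 \<Longrightarrow>
      AE x in lebesgue_on \<Omega>. \<bar>piecewise (\<lambda>T. 1 / r T) x * L2_projection \<Omega> \<T> K u x\<bar> \<le> c"
    and u1: "integrable (lebesgue_on \<Omega>) u"
  shows "(\<integral>x. \<bar>piecewise r x * L2_projection \<Omega> \<T> K u x\<bar> \<partial>lebesgue_on \<Omega>)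
    \<le> c * (\<integral>x. \<bar>piecewise r x * u x\<bar> \<partial>lebesgue_on \<Omega>)"
proof -
  let ?Q = "L2_projection \<Omega> \<T> K"
  let ?s = "\<lambda>T. 1 / r T"
  have rpos: "0 < r T" if "T \<in> \<T>" for T using r that by (simp add: graded_def)
  have um[measurable]: "u \<in> borel_measurable (lebesgue_on \<Omega>)" using u1 by auto
  have Qu: "?Q u \<in> lagrange_space \<Omega> \<T> K" by (rule L2_projection(1)[OF u1])
  have Qum[measurable]: "?Q u \<in> borel_measurable (lebesgue_on \<Omega>)" by (rule lagrange_measurable[OF Qu])
  define \<psi> where "\<psi> x = piecewise r x * sgn (?Q u x)" for x
  let ?b = "(\<Sum>T\<in>\<T>. \<bar>r T\<bar>)"
  have \<psi>b: "\<bar>\<psi> x\<bar> \<le> ?b" for x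
    using piecewise_bound[of r x] sum_nonneg[of \<T> "\<lambda>T. \<bar>r T\<bar>"]
    by (auto simp: \<psi>_def abs_mult abs_sgn_eq)
  have \<psi>m[measurable]: "\<psi> \<in> borel_measurable (lebesgue_on \<Omega>)" unfolding \<psi>_def by measurable
  have \<psi>1: "integrable (lebesgue_on \<Omega>) \<psi>" by (rule integrable_bounded[OF \<psi>m \<psi>b])
  have \<psi>2: "integrable (lebesgue_on \<Omega>) (\<lambda>x. (\<psi> x)\<^sup>2)"
    using integrable_bounded_mult[OF \<psi>1 \<psi>m \<psi>b] by (simp add: power2_eq_square)
  have Q\<psi>: "?Q \<psi> \<in> lagrange_space \<Omega> \<T> K" by (rule L2_projection(1)[OF \<psi>1])
  have rx: "AE x in lebesgue_on \<Omega>. 0 < piecewise r x \<and> piecewise ?s x = 1 / piecewise r x"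
    using AE_piecewise by eventually_elim (use rpos in auto)
  have "AE x in lebesgue_on \<Omega>. \<bar>piecewise ?s x * \<psi> x\<bar> \<le> 1"
    using rx by eventually_elim (simp add: \<psi>_def abs_mult abs_sgn_eq)
  from dual[OF \<psi>m \<psi>2 this]
  have Qb: "AE x in lebesgue_on \<Omega>. \<bar>piecewise ?s x * ?Q \<psi> x\<bar> \<le> c" .
  have "(\<integral>x. \<bar>piecewise r x * ?Q u x\<bar> \<partial>lebesgue_on \<Omega>) = (\<integral>x. \<psi> x * ?Q u x \<partial>lebesgue_on \<Omega>)"
  proof (rule integral_cong_AE)
    show "AE x in lebesgue_on \<Omega>. \<bar>piecewise r x * ?Q u x\<bar> = \<psi> x * ?Q u x"
      using rx by eventually_elim (auto simp: \<psi>_def abs_mult sgn_if)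
  qed measurable
  also have "\<dots> = (\<integral>x. u x * ?Q \<psi> x \<partial>lebesgue_on \<Omega>)" by (rule L2_projection_symmetric[OF u1 \<psi>1])
  also have "\<dots> \<le> (\<integral>x. c * \<bar>piecewise r x * u x\<bar> \<partial>lebesgue_on \<Omega>)"
  proof (rule integral_mono_AE)
    show "integrable (lebesgue_on \<Omega>) (\<lambda>x. u x * ?Q \<psi> x)" by (rule lagrange_integrable_mult[OF Q\<psi> u1])
    show "integrable (lebesgue_on \<Omega>) (\<lambda>x. c * \<bar>piecewise r x * u x\<bar>)"
      using integral_piecewise_mult(2)[OF u1, of r] by simp
    show "AE x in lebesgue_on \<Omega>. u x * ?Q \<psi> x \<le> c * \<bar>piecewise r x * u x\<bar>"
      using rx Qb
    proof eventually_elim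
      case (elim x)
      have "u x * ?Q \<psi> x = (piecewise ?s x * ?Q \<psi> x) * (piecewise r x * u x)" using elim by simp
      also have "\<dots> \<le> \<bar>piecewise ?s x * ?Q \<psi> x\<bar> * \<bar>piecewise r x * u x\<bar>"
        unfolding abs_mult[symmetric] by (rule abs_ge_self)
      also have "\<dots> \<le> c * \<bar>piecewise r x * u x\<bar>" using elim by (intro mult_right_mono) auto
      finally show ?case .
    qed
  qed
  finally show ?thesis by simp
qed

end

section \<open>Uniform stability\<close>

text \<open>The strict hypothesis leaves room for a \<gamma>' whose ratio x to \<gamma> still
  exceeds \<gamma>h^(d s), that is x^(1/s) > \<gamma>h^d. For s = 1/2 - 1/p the exponent 1 / (2 s)
  is the \<open>R\<close> of the maximal function.\<close>

lemma intermediate_grading: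
  fixes d :: nat and s \<gamma> \<gamma>h :: real and g :: ereal
  assumes s: "0 < s" and \<gamma>: "1 \<le> \<gamma>" "1 \<le> \<gamma>h" and g: "ereal (\<gamma> * \<gamma>h powr (real d * s)) < g"
  obtains \<gamma>' where "\<gamma> \<le> \<gamma>'" "ereal \<gamma>' < g" "\<gamma>h ^ d * (1 / (\<gamma>' / \<gamma>)\<^sup>2) powr (1 / (2 * s)) < 1"
proof -
  obtain z where z: "\<gamma> * \<gamma>h powr (real d * s) < z" "ereal z < g"
    using ereal_dense2[OF g] by auto
  define x where "x = z / \<gamma>"
  have h1: "1 \<le> \<gamma>h powr (real d * s)" using \<gamma> s by (intro ge_one_powr_ge_zero) auto
  have x: "\<gamma>h powr (real d * s) < x" using z(1) \<gamma> by (simp add: x_def pos_less_divide_eq mult.commute)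
  then have x0: "0 < x" using h1 by linarith
  have "\<gamma> * 1 \<le> \<gamma> * \<gamma>h powr (real d * s)" using h1 \<gamma> by (intro mult_left_mono) auto
  then have "\<gamma> \<le> z" using z by simp
  moreover have "\<gamma>h ^ d * (1 / x\<^sup>2) powr (1 / (2 * s)) < 1"
  proof -
    have "\<gamma>h ^ d = (\<gamma>h powr (real d * s)) powr (1 / s)"
      using s \<gamma> by (simp add: powr_powr powr_realpow)
    also have "\<dots> < x powr (1 / s)" using x s by (intro powr_less_mono2) auto
    finally have "\<gamma>h ^ d * x powr (- (1 / s)) < x powr (1 / s) * x powr (- (1 / s))"
      using x0 by (intro mult_strict_right_mono) auto
    also have "\<dots> = 1" using x0 by (simp add: powr_add[symmetric])
    also have "x powr (- (1 / s)) = (x powr (- 2)) powr (1 / (2 * s))"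
      using s by (simp only: powr_powr) (simp add: field_simps)
    also have "x powr (- 2) = 1 / x\<^sup>2" using x0 by (simp add: powr_minus_divide)
    finally show ?thesis .
  qed
  ultimately show ?thesis using that[of z] z(2) by (simp add: x_def)
qed

lemma absorbing_parameter:
  fixes R a :: real
  assumes "0 < R" "0 \<le> a"
  obtains t where "0 < t" "t powr (- R) * a \<le> 1 / 2"
proof
  \<comment> \<open>With this witness the product is a / (2 a + 1); the added 1 keeps
    \<open>t\<close> positive for \<open>a\<close> = 0.\<close>
  have "((2 * a + 1) powr (1 / R)) powr (- R) = 1 / (2 * a + 1)"
    using assms by (simp add: powr_powr powr_minus_divide)
  then show "((2 * a + 1) powr (1 / R)) powr (- R) * a \<le> 1 / 2"
    by (simp only:) (use assms in \<open>simp add: field_simps\<close>)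
qed (use assms in simp)

text \<open>The order of choices is the content: \<gamma>' comes from the gradings and
  \<open>g\<close>, \<open>B\<close> from \<kappa> and \<open>K\<close>, \<open>S\<close> from these
  gradings, \<kappa> and M / m, \<open>t\<close> from \<open>S\<close> and
  \<open>C \<gamma>'\<close>, and only then is a mesh introduced.\<close>

lemma uniform_Lp_stability_gt_2:
  fixes p \<gamma> \<gamma>h \<kappa> m M :: real and g :: ereal and K :: nat and C :: "real \<Rightarrow> real"
  assumes p: "2 < p" and \<gamma>: "1 \<le> \<gamma>" "1 \<le> \<gamma>h"
    and g: "ereal (\<gamma> * \<gamma>h powr (real CARD('n) * (1 / 2 - 1 / p))) < g"
  obtains c where "0 < c"
    "\<And>(\<Omega> :: (real ^ 'n) set) \<T> N h r u. graded_mesh \<Omega> \<T> \<kappa> N h m M \<gamma>h \<Longrightarrow>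
      worst_grading C \<Omega> \<T> N K g \<Longrightarrow> neighbor_mesh.graded \<T> N \<gamma> r \<Longrightarrow>
      u \<in> borel_measurable (lebesgue_on \<Omega>) \<Longrightarrow> integrable (lebesgue_on \<Omega>) (\<lambda>x. \<bar>u x\<bar> powr p) \<Longrightarrow>
      (\<integral>x. \<bar>triangulated_domain.piecewise \<T> r x * L2_projection \<Omega> \<T> K u x\<bar> powr p \<partial>lebesgue_on \<Omega>)
      \<le> c * (\<integral>x. \<bar>triangulated_domain.piecewise \<T> r x * u x\<bar> powr p \<partial>lebesgue_on \<Omega>)"
proof -
  define R where "R = p / (p - 2)"
  have R: "1 / (2 * (1 / 2 - 1 / p)) = R" using p by (simp add: R_def field_simps)
  have s: "0 < 1 / 2 - 1 / p" using p by (simp add: field_simps)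
  obtain \<gamma>' where \<gamma>': "\<gamma> \<le> \<gamma>'" "ereal \<gamma>' < g" "\<gamma>h ^ CARD('n) * (1 / (\<gamma>' / \<gamma>)\<^sup>2) powr R < 1"
    using intermediate_grading[OF s \<gamma> g] unfolding R by blast
  obtain B where B: "0 < B" "\<And>(\<Omega> :: (real ^ 'n) set) \<T>.
      triangulated_domain \<Omega> \<T> \<kappa> \<Longrightarrow> triangulated_domain.inverse_bound \<Omega> \<T> K B"
    using inverse_bound_exists[of \<kappa> K] by blast
  \<comment> \<open>The value of \<open>sum_const\<close>, spelled out in the parameters because no
    mesh is available yet. For the same reason it is not known to be nonnegative, so
    \<open>t\<close> is chosen for its absolute value.\<close>
  define S where "S = (2 * \<kappa> * M / m) ^ CARD('n) *
    (\<Sum>n. real (n + 1) ^ CARD('n) * (\<gamma>h ^ CARD('n) * (1 / (\<gamma>' / \<gamma>)\<^sup>2) powr R) ^ n)"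
  obtain t where t: "0 < t" "t powr (- R) * ((C \<gamma>')\<^sup>2 * \<bar>S\<bar>) \<le> 1 / 2"
    by (rule absorbing_parameter[of R "(C \<gamma>')\<^sup>2 * \<bar>S\<bar>"]) (use p in \<open>auto simp: R_def\<close>)
  have "t powr (- R) * ((C \<gamma>')\<^sup>2 * S) \<le> t powr (- R) * ((C \<gamma>')\<^sup>2 * \<bar>S\<bar>)"
    by (intro mult_left_mono) auto
  then have tS: "(C \<gamma>')\<^sup>2 * t powr (- R) * S \<le> 1 / 2" using t(2) by (simp add: mult_ac)
  let ?c = "sqrt B powr p * (2 * (C \<gamma>')\<^sup>2 * t powr (p / 2))"
  show ?thesis
  proof
    show "0 < ?c + 1" by (intro add_nonneg_pos mult_nonneg_nonneg) auto
    fix \<Omega> :: "(real ^ 'n) set" and \<T> N h r u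
    assume mesh: "graded_mesh \<Omega> \<T> \<kappa> N h m M \<gamma>h" and wg: "worst_grading C \<Omega> \<T> N K g"
      and r: "neighbor_mesh.graded \<T> N \<gamma> r" and u: "u \<in> borel_measurable (lebesgue_on \<Omega>)"
        "integrable (lebesgue_on \<Omega>) (\<lambda>x. \<bar>u x\<bar> powr p)"
    interpret graded_mesh \<Omega> \<T> \<kappa> N h m M \<gamma>h by (rule mesh)
    have tS': "(C \<gamma>')\<^sup>2 * t powr (- R) * sum_const (\<gamma>h ^ CARD('n) * (1 / (\<gamma>' / \<gamma>)\<^sup>2) powr R) \<le> 1 / 2"
      using tS unfolding S_def sum_const_def volume_const_def .
    have "(\<integral>x. \<bar>piecewise r x * L2_projection \<Omega> \<T> K u x\<bar> powr p \<partial>lebesgue_on \<Omega>)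
      \<le> ?c * (\<integral>x. \<bar>piecewise r x * u x\<bar> powr p \<partial>lebesgue_on \<Omega>)"
      by (rule Lp_stability_gt_2[OF wg r \<gamma>(1) \<gamma>'(1,2) p R_def \<gamma>'(3) B(1) B(2)[OF triangulated_domain_axioms] t(1)
          tS' u])
    also have "\<dots> \<le> (?c + 1) * (\<integral>x. \<bar>piecewise r x * u x\<bar> powr p \<partial>lebesgue_on \<Omega>)"
      by (intro mult_right_mono integral_nonneg_AE) auto
    finally show "(\<integral>x. \<bar>piecewise r x * L2_projection \<Omega> \<T> K u x\<bar> powr p \<partial>lebesgue_on \<Omega>)
      \<le> (?c + 1) * (\<integral>x. \<bar>piecewise r x * u x\<bar> powr p \<partial>lebesgue_on \<Omega>)" .
  qed
qed

lemma uniform_Linf_stability: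
  fixes \<gamma> \<gamma>h \<kappa> m M :: real and g :: ereal and K :: nat and C :: "real \<Rightarrow> real"
  assumes \<gamma>: "1 \<le> \<gamma>" "1 \<le> \<gamma>h" and g: "ereal (\<gamma> * \<gamma>h powr (real CARD('n) * (1 / 2))) < g"
  obtains c where "0 < c"
    "\<And>(\<Omega> :: (real ^ 'n) set) \<T> N h r u b. graded_mesh \<Omega> \<T> \<kappa> N h m M \<gamma>h \<Longrightarrow>
      worst_grading C \<Omega> \<T> N K g \<Longrightarrow> neighbor_mesh.graded \<T> N \<gamma> r \<Longrightarrow>
      u \<in> borel_measurable (lebesgue_on \<Omega>) \<Longrightarrow> integrable (lebesgue_on \<Omega>) (\<lambda>x. (u x)\<^sup>2) \<Longrightarrow>
      0 \<le> b \<Longrightarrow> AE x in lebesgue_on \<Omega>. \<bar>triangulated_domain.piecewise \<T> r x * u x\<bar> \<le> b \<Longrightarrow>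
      AE x in lebesgue_on \<Omega>. \<bar>triangulated_domain.piecewise \<T> r x * L2_projection \<Omega> \<T> K u x\<bar> \<le> c * b"
proof -
  obtain \<gamma>' where \<gamma>': "\<gamma> \<le> \<gamma>'" "ereal \<gamma>' < g" "\<gamma>h ^ CARD('n) * (1 / (\<gamma>' / \<gamma>)\<^sup>2) powr 1 < 1"
    using intermediate_grading[OF _ \<gamma> g] by auto
  obtain B where B: "0 < B" "\<And>(\<Omega> :: (real ^ 'n) set) \<T>.
      triangulated_domain \<Omega> \<T> \<kappa> \<Longrightarrow> triangulated_domain.inverse_bound \<Omega> \<T> K B"
    using inverse_bound_exists[of \<kappa> K] by blast
  define S where "S = (2 * \<kappa> * M / m) ^ CARD('n) *
    (\<Sum>n. real (n + 1) ^ CARD('n) * (\<gamma>h ^ CARD('n) * (1 / (\<gamma>' / \<gamma>)\<^sup>2) powr 1) ^ n)"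
  define c where "c = \<bar>sqrt (B * S) * \<bar>C \<gamma>'\<bar>\<bar> + 1"
  show ?thesis
  proof
    show "0 < c" unfolding c_def by linarith
    fix \<Omega> :: "(real ^ 'n) set" and \<T> N h r u b
    assume mesh: "graded_mesh \<Omega> \<T> \<kappa> N h m M \<gamma>h" and wg: "worst_grading C \<Omega> \<T> N K g"
      and r: "neighbor_mesh.graded \<T> N \<gamma> r" and u: "u \<in> borel_measurable (lebesgue_on \<Omega>)"
        "integrable (lebesgue_on \<Omega>) (\<lambda>x. (u x)\<^sup>2)"
      and b: "0 \<le> b" "AE x in lebesgue_on \<Omega>. \<bar>triangulated_domain.piecewise \<T> r x * u x\<bar> \<le> b"
    interpret graded_mesh \<Omega> \<T> \<kappa> N h m M \<gamma>h by (rule mesh)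
    have le: "sqrt (B * S) * \<bar>C \<gamma>'\<bar> * b \<le> c * b" unfolding c_def using b(1) by (intro mult_right_mono) auto
    show "AE x in lebesgue_on \<Omega>. \<bar>piecewise r x * L2_projection \<Omega> \<T> K u x\<bar> \<le> c * b"
      using Linf_stability[OF wg r \<gamma>(1) \<gamma>'(1,2,3) B(1) B(2)[OF triangulated_domain_axioms] u b,
          unfolded sum_const_def volume_const_def, folded S_def]
      by eventually_elim (use le in linarith)
  qed
qed

lemma uniform_Lp_stability_lt_2:
  fixes p \<gamma> \<gamma>h \<kappa> m M :: real and g :: ereal and K :: nat and C :: "real \<Rightarrow> real"
  assumes p: "1 \<le> p" "p < 2" and \<gamma>: "1 \<le> \<gamma>" "1 \<le> \<gamma>h"
    and g: "ereal (\<gamma> * \<gamma>h powr (real CARD('n) * (1 / p - 1 / 2))) < g"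
  obtains c where "0 < c"
    "\<And>(\<Omega> :: (real ^ 'n) set) \<T> N h r u. graded_mesh \<Omega> \<T> \<kappa> N h m M \<gamma>h \<Longrightarrow>
      worst_grading C \<Omega> \<T> N K g \<Longrightarrow> neighbor_mesh.graded \<T> N \<gamma> r \<Longrightarrow>
      u \<in> borel_measurable (lebesgue_on \<Omega>) \<Longrightarrow> integrable (lebesgue_on \<Omega>) (\<lambda>x. \<bar>u x\<bar> powr p) \<Longrightarrow>
      (\<integral>x. \<bar>triangulated_domain.piecewise \<T> r x * L2_projection \<Omega> \<T> K u x\<bar> powr p \<partial>lebesgue_on \<Omega>)
      \<le> c * (\<integral>x. \<bar>triangulated_domain.piecewise \<T> r x * u x\<bar> powr p \<partial>lebesgue_on \<Omega>)"
proof (cases "p = 1")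
  \<comment> \<open>The conjugate exponent of 1 is not a real number, so this endpoint uses the
    estimate for bounded functions.\<close>
  case True
  have g1: "ereal (\<gamma> * \<gamma>h powr (real CARD('n) * (1 / 2))) < g" using g True by simp
  obtain c where c: "0 < c"
    "\<And>(\<Omega> :: (real ^ 'n) set) \<T> N h r u b. graded_mesh \<Omega> \<T> \<kappa> N h m M \<gamma>h \<Longrightarrow>
      worst_grading C \<Omega> \<T> N K g \<Longrightarrow> neighbor_mesh.graded \<T> N \<gamma> r \<Longrightarrow>
      u \<in> borel_measurable (lebesgue_on \<Omega>) \<Longrightarrow> integrable (lebesgue_on \<Omega>) (\<lambda>x. (u x)\<^sup>2) \<Longrightarrow>
      0 \<le> b \<Longrightarrow> AE x in lebesgue_on \<Omega>. \<bar>triangulated_domain.piecewise \<T> r x * u x\<bar> \<le> b \<Longrightarrow>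
      AE x in lebesgue_on \<Omega>. \<bar>triangulated_domain.piecewise \<T> r x * L2_projection \<Omega> \<T> K u x\<bar> \<le> c * b"
    using uniform_Linf_stability[OF \<gamma> g1, of \<kappa> m M C K] by blast
  show ?thesis
  proof
    show "0 < c" by fact
    fix \<Omega> :: "(real ^ 'n) set" and \<T> N h r u
    assume mesh: "graded_mesh \<Omega> \<T> \<kappa> N h m M \<gamma>h" and wg: "worst_grading C \<Omega> \<T> N K g"
      and r: "neighbor_mesh.graded \<T> N \<gamma> r" and u: "u \<in> borel_measurable (lebesgue_on \<Omega>)"
        "integrable (lebesgue_on \<Omega>) (\<lambda>x. \<bar>u x\<bar> powr p)"
    interpret graded_mesh \<Omega> \<T> \<kappa> N h m M \<gamma>h by (rule mesh)
    have u1: "integrable (lebesgue_on \<Omega>) u" using u True by (simp add: integrable_abs_iff)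
    show "(\<integral>x. \<bar>piecewise r x * L2_projection \<Omega> \<T> K u x\<bar> powr p \<partial>lebesgue_on \<Omega>)
      \<le> c * (\<integral>x. \<bar>piecewise r x * u x\<bar> powr p \<partial>lebesgue_on \<Omega>)"
      using L1_stability[OF r _ u1, of K c] c(2)[OF mesh wg graded_inverse[OF r], of _ 1] True by simp
  qed
next
  case False
  define p' where "p' = p / (p - 1)"
  have p1: "1 < p" using p False by simp
  \<comment> \<open>Conjugate exponents are equally far from 2 on the scale of reciprocals, so the
    hypothesis on the gradings is the one needed at p'.\<close>
  have p': "2 < p'" "1 / 2 - 1 / p' = 1 / p - 1 / 2" using p p1 by (auto simp: p'_def field_simps)
  obtain c where c: "0 < c"
    "\<And>(\<Omega> :: (real ^ 'n) set) \<T> N h r u. graded_mesh \<Omega> \<T> \<kappa> N h m M \<gamma>h \<Longrightarrow>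
      worst_grading C \<Omega> \<T> N K g \<Longrightarrow> neighbor_mesh.graded \<T> N \<gamma> r \<Longrightarrow>
      u \<in> borel_measurable (lebesgue_on \<Omega>) \<Longrightarrow> integrable (lebesgue_on \<Omega>) (\<lambda>x. \<bar>u x\<bar> powr p') \<Longrightarrow>
      (\<integral>x. \<bar>triangulated_domain.piecewise \<T> r x * L2_projection \<Omega> \<T> K u x\<bar> powr p' \<partial>lebesgue_on \<Omega>)
      \<le> c * (\<integral>x. \<bar>triangulated_domain.piecewise \<T> r x * u x\<bar> powr p' \<partial>lebesgue_on \<Omega>)"
    using uniform_Lp_stability_gt_2[OF p'(1) \<gamma>, of g, where 'n = 'n, unfolded p'(2), OF g, of \<kappa> m M C K] by blast
  obtain t where t: "0 < t" "t powr (- p') * c \<le> 1 / 2"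
    by (rule absorbing_parameter[of p' c]) (use p' c(1) in auto)
  show ?thesis
  proof
    show "0 < 2 * t powr p" using t(1) by simp
    fix \<Omega> :: "(real ^ 'n) set" and \<T> N h r u
    assume mesh: "graded_mesh \<Omega> \<T> \<kappa> N h m M \<gamma>h" and wg: "worst_grading C \<Omega> \<T> N K g"
      and r: "neighbor_mesh.graded \<T> N \<gamma> r" and u: "u \<in> borel_measurable (lebesgue_on \<Omega>)"
        "integrable (lebesgue_on \<Omega>) (\<lambda>x. \<bar>u x\<bar> powr p)"
    interpret graded_mesh \<Omega> \<T> \<kappa> N h m M \<gamma>h by (rule mesh)
    show "(\<integral>x. \<bar>piecewise r x * L2_projection \<Omega> \<T> K u x\<bar> powr p \<partial>lebesgue_on \<Omega>)
      \<le> 2 * t powr p * (\<integral>x. \<bar>piecewise r x * u x\<bar> powr p \<partial>lebesgue_on \<Omega>)"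
      by (rule Lp_stability_lt_2[OF r p1 p'_def c(2)[OF mesh wg graded_inverse[OF r]] t u])
  qed
qed

section \<open>From piecewise constant weights and real integrals to general weights and
  norms\<close>

lemma Lp_norm_mono_of_nn_integral:
  assumes p: "0 < p" and k: "0 < k"
    and le: "(\<integral>\<^sup>+ x. ennreal (\<bar>f x\<bar> powr p) \<partial>lebesgue_on \<Omega>)
      \<le> ennreal k * (\<integral>\<^sup>+ x. ennreal (\<bar>g x\<bar> powr p) \<partial>lebesgue_on \<Omega>)" (is "?F \<le> _ * ?G")
  shows "Lp_norm (ennreal p) \<Omega> f \<le> ennreal (k powr (1 / p)) * Lp_norm (ennreal p) \<Omega> g"
proof (cases "?G = \<infinity>")
  case True
  then have "Lp_norm (ennreal p) \<Omega> g = \<infinity>" using p by (simp add: Lp_norm_def Let_def)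
  then show ?thesis using k by (simp add: ennreal_mult_top)
next
  case False
  then obtain b where b: "0 \<le> b" "?G = ennreal b" by (cases ?G) auto
  then have "?F \<le> ennreal (k * b)" using le k by (simp add: ennreal_mult)
  then obtain a where a: "0 \<le> a" "?F = ennreal a" by (cases ?F) (auto simp: top_unique)
  have "a \<le> k * b" using \<open>?F \<le> ennreal (k * b)\<close> a k b by (simp add: ennreal_le_iff)
  then have "a powr (1 / p) \<le> (k * b) powr (1 / p)" using a p by (intro powr_mono2) auto
  also have "\<dots> = k powr (1 / p) * b powr (1 / p)" using k b by (simp add: powr_mult)
  finally have "ennreal (a powr (1 / p)) \<le> ennreal (k powr (1 / p)) * ennreal (b powr (1 / p))"
    by (simp add: ennreal_mult[symmetric])
  then show ?thesis using a b p by (simp add: Lp_norm_def Let_def)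
qed

lemma Lp_space_integrable:
  assumes u: "u \<in> Lp_space (ennreal p) \<Omega>" and p: "0 < p"
  shows "u \<in> borel_measurable (lebesgue_on \<Omega>)" "integrable (lebesgue_on \<Omega>) (\<lambda>x. \<bar>u x\<bar> powr p)"
proof -
  show m: "u \<in> borel_measurable (lebesgue_on \<Omega>)" using u by (simp add: Lp_space_def)
  have "(\<integral>\<^sup>+ x. ennreal (\<bar>u x\<bar> powr p) \<partial>lebesgue_on \<Omega>) \<noteq> \<infinity>"
    using u p by (auto simp: Lp_space_def Lp_norm_def Let_def)
  then show "integrable (lebesgue_on \<Omega>) (\<lambda>x. \<bar>u x\<bar> powr p)"
    using m by (intro integrableI_nonneg) (auto simp: less_top)
qed

context neighbor_mesh
begin

text \<open>\<rho> is replaced from above by its piecewise constant representative on the left, at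
  no cost, and recovered on the right at the price of one factor \<gamma>.\<close>

lemma Lp_norm_weighted:
  assumes \<rho>: "weight_with_grading \<Omega> \<T> N \<rho> \<gamma>" and p: "1 \<le> p" and c: "0 < c"
    and stable: "\<And>r. graded \<gamma> r \<Longrightarrow> (\<integral>x. \<bar>piecewise r x * v x\<bar> powr p \<partial>lebesgue_on \<Omega>)
      \<le> c * (\<integral>x. \<bar>piecewise r x * u x\<bar> powr p \<partial>lebesgue_on \<Omega>)"
    and v: "v \<in> lagrange_space \<Omega> \<T> K" and u: "u \<in> Lp_space (ennreal p) \<Omega>"
  shows "Lp_norm (ennreal p) \<Omega> (\<lambda>x. \<rho> x * v x)
    \<le> ennreal ((c * \<gamma> powr p) powr (1 / p)) * Lp_norm (ennreal p) \<Omega> (\<lambda>x. \<rho> x * u x)"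
proof -
  have um: "u \<in> borel_measurable (lebesgue_on \<Omega>)" "integrable (lebesgue_on \<Omega>) (\<lambda>x. \<bar>u x\<bar> powr p)"
    using Lp_space_integrable[OF u] p by auto
  have \<gamma>: "1 \<le> \<gamma>" using \<rho> by (simp add: weight_with_grading_def)
  have [measurable]: "\<rho> \<in> borel_measurable (lebesgue_on \<Omega>)"
    using \<rho> by (auto simp: weight_with_grading_def)
  obtain r where r: "graded \<gamma> r"
    "AE x in lebesgue_on \<Omega>. 0 < \<rho> x \<and> \<rho> x \<le> piecewise r x \<and> piecewise r x \<le> \<gamma> * \<rho> x"
    by (rule weight_obtain_graded[OF \<rho>]) blast
  have nn: "(\<integral>\<^sup>+ x. ennreal (\<bar>piecewise r x * f x\<bar> powr p) \<partial>lebesgue_on \<Omega>) =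
      ennreal (\<integral>x. \<bar>piecewise r x * f x\<bar> powr p \<partial>lebesgue_on \<Omega>)"
    if "f \<in> borel_measurable (lebesgue_on \<Omega>)" "integrable (lebesgue_on \<Omega>) (\<lambda>x. \<bar>f x\<bar> powr p)" for f
    using integrable_piecewise_powr[OF that, of r] by (intro nn_integral_eq_integral) auto
  have "(\<integral>\<^sup>+ x. ennreal (\<bar>\<rho> x * v x\<bar> powr p) \<partial>lebesgue_on \<Omega>) \<le>
      (\<integral>\<^sup>+ x. ennreal (\<bar>piecewise r x * v x\<bar> powr p) \<partial>lebesgue_on \<Omega>)"
  proof (rule nn_integral_mono_AE)
    show "AE x in lebesgue_on \<Omega>. ennreal (\<bar>\<rho> x * v x\<bar> powr p) \<le> ennreal (\<bar>piecewise r x * v x\<bar> powr p)"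
      using r(2) by eventually_elim
        (use p in \<open>auto intro!: ennreal_leI powr_mono2 mult_right_mono simp: abs_mult\<close>)
  qed
  also have "\<dots> \<le> ennreal (c * (\<integral>x. \<bar>piecewise r x * u x\<bar> powr p \<partial>lebesgue_on \<Omega>))"
    using p by (subst nn[OF lagrange_measurable[OF v] lagrange_integrable_powr[OF v]])
      (auto intro!: ennreal_leI stable r(1))
  also have "\<dots> = ennreal c * (\<integral>\<^sup>+ x. ennreal (\<bar>piecewise r x * u x\<bar> powr p) \<partial>lebesgue_on \<Omega>)"
    using c by (simp add: nn[OF um] ennreal_mult')
  also have "\<dots> \<le> ennreal c * (\<integral>\<^sup>+ x. ennreal (\<gamma> powr p) * ennreal (\<bar>\<rho> x * u x\<bar> powr p) \<partial>lebesgue_on \<Omega>)"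
  proof (intro mult_left_mono nn_integral_mono_AE)
    show "AE x in lebesgue_on \<Omega>. ennreal (\<bar>piecewise r x * u x\<bar> powr p) \<le>
        ennreal (\<gamma> powr p) * ennreal (\<bar>\<rho> x * u x\<bar> powr p)"
      using r(2)
    proof eventually_elim
      case (elim x)
      then have "\<bar>piecewise r x * u x\<bar> \<le> \<gamma> * \<bar>\<rho> x * u x\<bar>"
        using mult_right_mono[of "piecewise r x" "\<gamma> * \<rho> x" "\<bar>u x\<bar>"] by (simp add: abs_mult mult_ac)
      then have "\<bar>piecewise r x * u x\<bar> powr p \<le> (\<gamma> * \<bar>\<rho> x * u x\<bar>) powr p"
        using p by (intro powr_mono2) auto
      also have "\<dots> = \<gamma> powr p * \<bar>\<rho> x * u x\<bar> powr p" using \<gamma> by (simp add: powr_mult)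
      finally show ?case by (simp add: ennreal_mult[symmetric] ennreal_leI)
    qed
  qed simp
  also have "\<dots> = ennreal (c * \<gamma> powr p) * (\<integral>\<^sup>+ x. ennreal (\<bar>\<rho> x * u x\<bar> powr p) \<partial>lebesgue_on \<Omega>)"
    using um(1) c by (subst nn_integral_cmult) (auto simp: ennreal_mult mult.assoc)
  finally show ?thesis
    using p c \<gamma> by (intro Lp_norm_mono_of_nn_integral) auto
qed

text \<open>The same comparison of weights for essential suprema. Square integrability of
  \<open>u\<close>, which the L^2 theory needs, follows from its boundedness on a set of finite
  measure.\<close>

lemma Linf_norm_weighted:
  assumes \<rho>: "weight_with_grading \<Omega> \<T> N \<rho> \<gamma>" and c: "0 < c"
    and stable: "\<And>r b. graded \<gamma> r \<Longrightarrow> integrable (lebesgue_on \<Omega>) (\<lambda>x. (u x)\<^sup>2) \<Longrightarrow> 0 \<le> b \<Longrightarrow>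
      AE x in lebesgue_on \<Omega>. \<bar>piecewise r x * u x\<bar> \<le> b \<Longrightarrow>
      AE x in lebesgue_on \<Omega>. \<bar>piecewise r x * L2_projection \<Omega> \<T> K u x\<bar> \<le> c * b"
    and u: "u \<in> Lp_space \<infinity> \<Omega>"
  shows "Lp_norm \<infinity> \<Omega> (\<lambda>x. \<rho> x * L2_projection \<Omega> \<T> K u x)
    \<le> ennreal (c * \<gamma>) * Lp_norm \<infinity> \<Omega> (\<lambda>x. \<rho> x * u x)"
proof -
  let ?Q = "L2_projection \<Omega> \<T> K u"
  have um[measurable]: "u \<in> borel_measurable (lebesgue_on \<Omega>)" using u by (simp add: Lp_space_def)
  have \<gamma>: "1 \<le> \<gamma>" using \<rho> by (simp add: weight_with_grading_def)
  have [measurable]: "\<rho> \<in> borel_measurable (lebesgue_on \<Omega>)"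
    using \<rho> by (auto simp: weight_with_grading_def)
  have "esssup (lebesgue_on \<Omega>) (\<lambda>x. ennreal \<bar>u x\<bar>) < \<infinity>" using u by (simp add: Lp_space_def Lp_norm_def)
  then obtain b0 where b0: "0 \<le> b0" "esssup (lebesgue_on \<Omega>) (\<lambda>x. ennreal \<bar>u x\<bar>) = ennreal b0"
    by (cases "esssup (lebesgue_on \<Omega>) (\<lambda>x. ennreal \<bar>u x\<bar>)") auto
  have u_le: "AE x in lebesgue_on \<Omega>. \<bar>u x\<bar> \<le> b0"
    using esssup_AE[of "\<lambda>x. ennreal \<bar>u x\<bar>" "lebesgue_on \<Omega>"] unfolding b0(2)
    by eventually_elim (use b0(1) in \<open>simp add: ennreal_le_iff\<close>)
  have u2: "integrable (lebesgue_on \<Omega>) (\<lambda>x. (u x)\<^sup>2)"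
  proof (rule Bochner_Integration.integrable_bound)
    show "integrable (lebesgue_on \<Omega>) (\<lambda>_. b0\<^sup>2)" by (rule integrable_bounded[where b = "b0\<^sup>2"]) auto
    show "AE x in lebesgue_on \<Omega>. norm ((u x)\<^sup>2) \<le> norm (b0\<^sup>2)"
      using u_le by eventually_elim (simp add: abs_le_square_iff[symmetric])
  qed measurable
  have [measurable]: "?Q \<in> borel_measurable (lebesgue_on \<Omega>)"
    by (rule lagrange_measurable[OF L2_projection(1)[OF integrable_of_square[OF um u2]]])
  obtain r where r: "graded \<gamma> r"
    "AE x in lebesgue_on \<Omega>. 0 < \<rho> x \<and> \<rho> x \<le> piecewise r x \<and> piecewise r x \<le> \<gamma> * \<rho> x"
    by (rule weight_obtain_graded[OF \<rho>]) blast
  show ?thesis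
  proof (cases "Lp_norm \<infinity> \<Omega> (\<lambda>x. \<rho> x * u x) = \<infinity>")
    case True
    then show ?thesis using c \<gamma> by (simp add: ennreal_mult_top)
  next
    case False
    then obtain b where b: "0 \<le> b" "Lp_norm \<infinity> \<Omega> (\<lambda>x. \<rho> x * u x) = ennreal b"
      by (cases "Lp_norm \<infinity> \<Omega> (\<lambda>x. \<rho> x * u x)") auto
    have "AE x in lebesgue_on \<Omega>. ennreal \<bar>\<rho> x * u x\<bar> \<le> ennreal b"
      using esssup_AE[of "\<lambda>x. ennreal \<bar>\<rho> x * u x\<bar>" "lebesgue_on \<Omega>"] b(2) by (simp add: Lp_norm_def)
    then have "AE x in lebesgue_on \<Omega>. \<bar>piecewise r x * u x\<bar> \<le> \<gamma> * b"
      using r(2)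
    proof eventually_elim
      case (elim x)
      then have "\<bar>piecewise r x * u x\<bar> \<le> \<gamma> * \<bar>\<rho> x * u x\<bar>"
        using mult_right_mono[of "piecewise r x" "\<gamma> * \<rho> x" "\<bar>u x\<bar>"] by (simp add: abs_mult mult_ac)
      also have "\<dots> \<le> \<gamma> * b" using elim b(1) \<gamma> by (intro mult_left_mono) (auto simp: ennreal_le_iff)
      finally show ?case .
    qed
    from stable[OF r(1) u2 _ this] b(1) \<gamma>
    have "AE x in lebesgue_on \<Omega>. \<bar>piecewise r x * ?Q x\<bar> \<le> c * (\<gamma> * b)" by simp
    then have "AE x in lebesgue_on \<Omega>. ennreal \<bar>\<rho> x * ?Q x\<bar> \<le> ennreal (c * \<gamma> * b)"
      using r(2)
    proof eventually_elim
      case (elim x)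
      then have "\<bar>\<rho> x * ?Q x\<bar> \<le> \<bar>piecewise r x * ?Q x\<bar>"
        by (auto simp: abs_mult intro!: mult_right_mono)
      with elim show ?case by (intro ennreal_leI) (simp add: mult.assoc)
    qed
    then have "esssup (lebesgue_on \<Omega>) (\<lambda>x. ennreal \<bar>\<rho> x * ?Q x\<bar>) \<le> ennreal (c * \<gamma> * b)"
      by (intro esssup_I) measurable
    then show ?thesis using b c \<gamma> by (simp add: Lp_norm_def ennreal_mult)
  qed
qed

end

theorem theorem4p12:
  fixes K :: nat and p :: ennreal and \<gamma>\<^sub>\<rho> \<gamma>\<^sub>h \<chi>\<^sub>0 m M :: real
    and \<gamma>max :: ereal and C :: "real \<Rightarrow> real"
  assumes "1 \<le> K" and "1 \<le> p" and "0 < m"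
    and "ereal (\<gamma>\<^sub>\<rho> * \<gamma>\<^sub>h powr (real CARD('n) * \<bar>1 / 2 - enn2real (1 / p)\<bar>)) < \<gamma>max"
  shows "\<exists>c::real. \<forall>(\<Omega> :: (real ^ 'n) set) \<T> N \<rho> h.
    polyhedral_domain \<Omega> \<longrightarrow> regular_triangulation \<Omega> \<T> \<longrightarrow> shape_regularity \<T> = \<chi>\<^sub>0 \<longrightarrow>
    neighbor_relation \<T> N \<longrightarrow> worst_grading C \<Omega> \<T> N K \<gamma>max \<longrightarrow>
    weight_with_grading \<Omega> \<T> N \<rho> \<gamma>\<^sub>\<rho> \<longrightarrow> mesh_size_function m M \<Omega> \<T> N h \<gamma>\<^sub>h \<longrightarrow>
    (\<forall>u\<in>Lp_space p \<Omega>. Lp_norm p \<Omega> (\<lambda>x. \<rho> x * L2_projection \<Omega> \<T> K u x)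
      \<le> ennreal c * Lp_norm p \<Omega> (\<lambda>x. \<rho> x * u x))"
proof (cases "1 \<le> \<gamma>\<^sub>\<rho> \<and> 1 \<le> \<gamma>\<^sub>h")
  \<comment> \<open>A grading is at least 1 by definition, so otherwise the claim is
    vacuous.\<close>
  case False
  then have "\<not> (weight_with_grading \<Omega> \<T> N \<rho> \<gamma>\<^sub>\<rho> \<and> mesh_size_function m M \<Omega> \<T> N h \<gamma>\<^sub>h)"
    for \<Omega> :: "(real ^ 'n) set" and \<T> N \<rho> h
    by (auto simp: mesh_size_function_def weight_with_grading_def)
  then show ?thesis by simp
next
  case True
  then have \<gamma>: "1 \<le> \<gamma>\<^sub>\<rho>" "1 \<le> \<gamma>\<^sub>h" by auto
  have "\<exists>c. \<forall>(\<Omega> :: (real ^ 'n) set) \<T> N \<rho> h u. graded_mesh \<Omega> \<T> \<chi>\<^sub>0 N h m M \<gamma>\<^sub>h \<longrightarrow>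
      worst_grading C \<Omega> \<T> N K \<gamma>max \<longrightarrow> weight_with_grading \<Omega> \<T> N \<rho> \<gamma>\<^sub>\<rho> \<longrightarrow>
      u \<in> Lp_space p \<Omega> \<longrightarrow> Lp_norm p \<Omega> (\<lambda>x. \<rho> x * L2_projection \<Omega> \<T> K u x)
      \<le> ennreal c * Lp_norm p \<Omega> (\<lambda>x. \<rho> x * u x)"
  proof (cases p)
    case top
    \<comment> \<open>1 / \<infinity> is 0 in \<open>ennreal\<close>, so the exponent is d /
      2.\<close>
    then have g: "ereal (\<gamma>\<^sub>\<rho> * \<gamma>\<^sub>h powr (real CARD('n) * (1 / 2))) < \<gamma>max" using assms(4) by simp
    obtain c where c: "0 < c"
      "\<And>(\<Omega> :: (real ^ 'n) set) \<T> N h r u b. graded_mesh \<Omega> \<T> \<chi>\<^sub>0 N h m M \<gamma>\<^sub>h \<Longrightarrow>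
        worst_grading C \<Omega> \<T> N K \<gamma>max \<Longrightarrow> neighbor_mesh.graded \<T> N \<gamma>\<^sub>\<rho> r \<Longrightarrow>
        u \<in> borel_measurable (lebesgue_on \<Omega>) \<Longrightarrow> integrable (lebesgue_on \<Omega>) (\<lambda>x. (u x)\<^sup>2) \<Longrightarrow>
        0 \<le> b \<Longrightarrow> AE x in lebesgue_on \<Omega>. \<bar>triangulated_domain.piecewise \<T> r x * u x\<bar> \<le> b \<Longrightarrow>
        AE x in lebesgue_on \<Omega>. \<bar>triangulated_domain.piecewise \<T> r x * L2_projection \<Omega> \<T> K u x\<bar> \<le> c * b"
      using uniform_Linf_stability[OF \<gamma> g, of \<chi>\<^sub>0 m M C K] by blast
    show ?thesis
    proof (intro exI allI impI)
      fix \<Omega> :: "(real ^ 'n) set" and \<T> N \<rho> h u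
      assume mesh: "graded_mesh \<Omega> \<T> \<chi>\<^sub>0 N h m M \<gamma>\<^sub>h" and wg: "worst_grading C \<Omega> \<T> N K \<gamma>max"
        and \<rho>: "weight_with_grading \<Omega> \<T> N \<rho> \<gamma>\<^sub>\<rho>" and u: "u \<in> Lp_space p \<Omega>"
      interpret graded_mesh \<Omega> \<T> \<chi>\<^sub>0 N h m M \<gamma>\<^sub>h by (rule mesh)
      have um: "u \<in> borel_measurable (lebesgue_on \<Omega>)" using u by (simp add: Lp_space_def)
      show "Lp_norm p \<Omega> (\<lambda>x. \<rho> x * L2_projection \<Omega> \<T> K u x)
          \<le> ennreal (c * \<gamma>\<^sub>\<rho>) * Lp_norm p \<Omega> (\<lambda>x. \<rho> x * u x)"
        using Linf_norm_weighted[OF \<rho> c(1) c(2)[OF mesh wg _ um]] u top by simp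
    qed
  next
    case (real q)
    then have q: "1 \<le> q" "p = ennreal q" using assms(2) by auto
    have "1 / p = ennreal 1 / ennreal q" by (simp add: q(2))
    also have "\<dots> = ennreal (1 / q)" using q(1) by (intro divide_ennreal) auto
    finally have inv: "enn2real (1 / p) = 1 / q" using q(1) by simp
    \<comment> \<open>Shared by the cases \<open>q\<close> < 2 and 2 < \<open>q\<close>, which
      differ only in the uniform lemma that supplies \<open>c\<close>.\<close>
    have stable: ?thesis if c: "0 < c"
      "\<And>(\<Omega> :: (real ^ 'n) set) \<T> N h r u. graded_mesh \<Omega> \<T> \<chi>\<^sub>0 N h m M \<gamma>\<^sub>h \<Longrightarrow>
        worst_grading C \<Omega> \<T> N K \<gamma>max \<Longrightarrow> neighbor_mesh.graded \<T> N \<gamma>\<^sub>\<rho> r \<Longrightarrow>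
        u \<in> borel_measurable (lebesgue_on \<Omega>) \<Longrightarrow> integrable (lebesgue_on \<Omega>) (\<lambda>x. \<bar>u x\<bar> powr q) \<Longrightarrow>
        (\<integral>x. \<bar>triangulated_domain.piecewise \<T> r x * L2_projection \<Omega> \<T> K u x\<bar> powr q \<partial>lebesgue_on \<Omega>)
        \<le> c * (\<integral>x. \<bar>triangulated_domain.piecewise \<T> r x * u x\<bar> powr q \<partial>lebesgue_on \<Omega>)" for c
    proof (intro exI allI impI)
      fix \<Omega> :: "(real ^ 'n) set" and \<T> N \<rho> h u
      assume mesh: "graded_mesh \<Omega> \<T> \<chi>\<^sub>0 N h m M \<gamma>\<^sub>h" and wg: "worst_grading C \<Omega> \<T> N K \<gamma>max"
        and \<rho>: "weight_with_grading \<Omega> \<T> N \<rho> \<gamma>\<^sub>\<rho>" and u: "u \<in> Lp_space p \<Omega>"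
      interpret graded_mesh \<Omega> \<T> \<chi>\<^sub>0 N h m M \<gamma>\<^sub>h by (rule mesh)
      have uq: "u \<in> Lp_space (ennreal q) \<Omega>" using u q(2) by simp
      have um: "u \<in> borel_measurable (lebesgue_on \<Omega>)" "integrable (lebesgue_on \<Omega>) (\<lambda>x. \<bar>u x\<bar> powr q)"
        using Lp_space_integrable[OF uq] q(1) by auto
      have u1: "integrable (lebesgue_on \<Omega>) u"
        using integrable_powr_mono[OF um, of 1] um(1) q(1) by (simp add: integrable_abs_iff)
      show "Lp_norm p \<Omega> (\<lambda>x. \<rho> x * L2_projection \<Omega> \<T> K u x)
          \<le> ennreal ((c * \<gamma>\<^sub>\<rho> powr q) powr (1 / q)) * Lp_norm p \<Omega> (\<lambda>x. \<rho> x * u x)"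
        unfolding q(2)
        by (rule Lp_norm_weighted[OF \<rho> q(1) c(1) c(2)[OF mesh wg _ um] L2_projection(1)[OF u1] uq])
    qed
    consider "q < 2" | "q = 2" | "2 < q" by linarith
    then show ?thesis
    proof cases
      case 1
      then have "\<bar>1 / 2 - 1 / q\<bar> = 1 / q - 1 / 2" using q(1) by (simp add: field_simps)
      then have g: "ereal (\<gamma>\<^sub>\<rho> * \<gamma>\<^sub>h powr (real CARD('n) * (1 / q - 1 / 2))) < \<gamma>max"
        using assms(4) inv by simp
      show ?thesis
        by (rule uniform_Lp_stability_lt_2[OF q(1) 1 \<gamma> g, of \<chi>\<^sub>0 m M C K]) (rule stable)
    next
      case 2
      \<comment> \<open>The exponent of \<open>\<gamma>\<^sub>h\<close> is 0 and its power is 1, so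
        \<open>worst_grading\<close> applies to \<rho> itself, without passing to a piecewise
        constant weight.\<close>
      have "ereal \<gamma>\<^sub>\<rho> < \<gamma>max" using assms(4) \<gamma> unfolding inv 2 by simp
      moreover have "p = 2" using q(2) 2 by simp
      ultimately show ?thesis
        by (intro exI[of _ "C \<gamma>\<^sub>\<rho>"] allI impI) (simp add: worst_grading_def)
    next
      case 3
      then have "\<bar>1 / 2 - 1 / q\<bar> = 1 / 2 - 1 / q" by (simp add: field_simps)
      then have g: "ereal (\<gamma>\<^sub>\<rho> * \<gamma>\<^sub>h powr (real CARD('n) * (1 / 2 - 1 / q))) < \<gamma>max"
        using assms(4) inv by simp
      show ?thesis
        by (rule uniform_Lp_stability_gt_2[OF 3 \<gamma> g, of \<chi>\<^sub>0 m M C K]) (rule stable)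
    qed
  qed
  then obtain c where c: "\<forall>(\<Omega> :: (real ^ 'n) set) \<T> N \<rho> h u. graded_mesh \<Omega> \<T> \<chi>\<^sub>0 N h m M \<gamma>\<^sub>h \<longrightarrow>
      worst_grading C \<Omega> \<T> N K \<gamma>max \<longrightarrow> weight_with_grading \<Omega> \<T> N \<rho> \<gamma>\<^sub>\<rho> \<longrightarrow>
      u \<in> Lp_space p \<Omega> \<longrightarrow> Lp_norm p \<Omega> (\<lambda>x. \<rho> x * L2_projection \<Omega> \<T> K u x)
      \<le> ennreal c * Lp_norm p \<Omega> (\<lambda>x. \<rho> x * u x)" ..
  show ?thesis
  proof (intro exI allI impI ballI)
    fix \<Omega> :: "(real ^ 'n) set" and \<T> N \<rho> h u
    assume "polyhedral_domain \<Omega>" "regular_triangulation \<Omega> \<T>" "shape_regularity \<T> = \<chi>\<^sub>0"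
      "neighbor_relation \<T> N" "mesh_size_function m M \<Omega> \<T> N h \<gamma>\<^sub>h"
    then have "graded_mesh \<Omega> \<T> \<chi>\<^sub>0 N h m M \<gamma>\<^sub>h"
      using assms(3) by unfold_locales
    moreover assume "worst_grading C \<Omega> \<T> N K \<gamma>max" "weight_with_grading \<Omega> \<T> N \<rho> \<gamma>\<^sub>\<rho>" "u \<in> Lp_space p \<Omega>"
    ultimately show "Lp_norm p \<Omega> (\<lambda>x. \<rho> x * L2_projection \<Omega> \<T> K u x)
      \<le> ennreal c * Lp_norm p \<Omega> (\<lambda>x. \<rho> x * u x)" by (rule c[rule_format])
  qed
qed

end
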